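(* Let $d\ge1$. Assume $\kappa_d$ is algebraic, let $K=\mathbb{Q}(\kappa_d)$, let $p\in\mathrm{Tame}_d$, put $r_p=\nu_p(a_d(p)-1)$, and fix a prime $\mathfrak p$ of $K$ above $p$. In the completion $K_{\mathfrak p}\supseteq\mathbb{Q}_p$: (1) If $v_{\mathfrak p}(\kappa_d-1)>0$, then for all sufficiently large $k$ we have $v_{\mathfrak p}\bigl(\kappa_d^{(p)}-\kappa_d^{p^{kd}}\bigr)=e_{\mathfrak p}\,r_p$. (2) If $v_{\mathfrak p}(\kappa_d-1)\le0$, then for every $k\ge1$ we have $v_{\mathfrak p}\bigl(\kappa_d^{(p)}-\kappa_d^{p^{kd}}\bigr)=v_{\mathfrak p}\bigl(\kappa_d^{p^{kd}}-1\bigr)\le0$. In particular, $\kappa_d^{(p)}\ne\kappa_d^{p^{kd}}$ for all sufficiently large $k$, and $\kappa_d^{(p)}$ is never a $\mathfrak p$-adic limit point of the sequence $\{\kappa_d^{p^{kd}}\}_{k\ge1}$.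
   Context: For integers $d,n\ge1$, $T_d(n)$ is the Cayley graph of $(\mathbb{Z}/n\mathbb{Z})^d$ with respect to $\{\pm e_1,\dots,\pm e_d\}\setminus\{0\}$ ($e_i$ the standard basis vectors); it is a simple graph, and $T_d(1)$ is a single vertex with no edges. $a_d(n)$ is the number of independent sets of $T_d(n)$ (including the empty set). The limit $\kappa_d=\lim_{n\to\infty}a_d(n)^{1/n^d}$ exists and is a positive real number. $\nu_p$ is the $p$-adic valuation with $\nu_p(p)=1$. A prime $p$ is tame with respect to $d$ if $\nu_p(a_d(p^k)-1)=\nu_p(a_d(p)-1)$ for every $k\ge1$; $\mathrm{Tame}_d$ is the set of such primes. For every prime $p$, the sequence $\{a_d(p^k)\}_{k\ge1}$ converges in $\mathbb{Z}_p$, and $\kappa_d^{(p)}\in\mathbb{Z}_p$ denotes its limit. For a prime $\mathfrak p$ of (the ring of integers of) $K$ above $p$, $v_{\mathfrak p}$ is the normalized valuation (value group $\mathbb{Z}$) on $K_{\mathfrak p}$ and $e_{\mathfrak p}=v_{\mathfrak p}(p)$ is the ramification index. *)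

theory Defs
  imports
    Complex_Main
    "HOL-Library.Extended_Real"
    "HOL-Computational_Algebra.Computational_Algebra"
    "HOL-Algebra.Product_Groups"
    "HOL-Algebra.Elementary_Groups"
    "HOL-Algebra.Ideal_Product"
    "HOL-Algebra.QuotRing"
    "HOL-Algebra.Generated_Fields"
    "HOL-Algebra.Algebraic_Closure_Type"
begin

section \<open>Independent sets of discrete tori\<close>

definition cayley_adj :: "('a, 'b) monoid_scheme \<Rightarrow> 'a set \<Rightarrow> 'a \<Rightarrow> 'a \<Rightarrow> bool" where
  "cayley_adj G S x y \<longleftrightarrow> x \<in> carrier G \<and> y \<in> carrier G \<and> (\<exists>s\<in>S. y = x \<otimes>\<^bsub>G\<^esub> s)"

definition torus_group :: "nat \<Rightarrow> nat \<Rightarrow> (nat \<Rightarrow> int) monoid" where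
  "torus_group d n = product_group {..<d} (\<lambda>_. integer_mod_group n)"

text \<open>The entry \<open>1 mod n\<close> makes \<open>std_basis d 1 i\<close> the neutral element, as it should be
  in the trivial group.\<close>

definition std_basis :: "nat \<Rightarrow> nat \<Rightarrow> nat \<Rightarrow> (nat \<Rightarrow> int)" where
  "std_basis d n i = (\<lambda>j\<in>{..<d}. if j = i then 1 mod int n else 0)"

definition torus_steps :: "nat \<Rightarrow> nat \<Rightarrow> (nat \<Rightarrow> int) set" where
  "torus_steps d n =
     (\<Union>i<d. {std_basis d n i, inv\<^bsub>torus_group d n\<^esub> (std_basis d n i)}) - {\<one>\<^bsub>torus_group d n\<^esub>}"

definition torus_adj :: "nat \<Rightarrow> nat \<Rightarrow> (nat \<Rightarrow> int) \<Rightarrow> (nat \<Rightarrow> int) \<Rightarrow> bool" where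
  "torus_adj d n = cayley_adj (torus_group d n) (torus_steps d n)"

definition indep_sets :: "'a set \<Rightarrow> ('a \<Rightarrow> 'a \<Rightarrow> bool) \<Rightarrow> 'a set set" where
  "indep_sets V adj = {A. A \<subseteq> V \<and> (\<forall>x\<in>A. \<forall>y\<in>A. \<not> adj x y)}"

definition indep_count :: "nat \<Rightarrow> nat \<Rightarrow> nat" where
  "indep_count d n = card (indep_sets (carrier (torus_group d n)) (torus_adj d n))"

definition kappa :: "nat \<Rightarrow> real" where
  "kappa d = lim (\<lambda>n. real (indep_count d n) powr (1 / real (n ^ d)))"


section \<open>Completion of a valued field\<close>

text \<open>Valuations take values in \<open>ereal\<close>, with \<open>v 0 = \<infinity>\<close>.  The completion of \<open>(R, v)\<close> is the
  ring of Cauchy sequences modulo the ideal of null sequences.\<close>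

definition cauchy_ring :: "'a ring \<Rightarrow> ('a \<Rightarrow> ereal) \<Rightarrow> (nat \<Rightarrow> 'a) ring" where
  "cauchy_ring R v =
     \<lparr>carrier = {s. range s \<subseteq> carrier R \<and>
        (\<forall>N::nat. \<exists>n0. \<forall>m\<ge>n0. \<forall>n\<ge>n0. v (s m \<ominus>\<^bsub>R\<^esub> s n) \<ge> ereal (real N))},
      monoid.mult = (\<lambda>s t n. s n \<otimes>\<^bsub>R\<^esub> t n), one = (\<lambda>_. \<one>\<^bsub>R\<^esub>),
      zero = (\<lambda>_. \<zero>\<^bsub>R\<^esub>), add = (\<lambda>s t n. s n \<oplus>\<^bsub>R\<^esub> t n)\<rparr>"

definition null_seqs :: "'a ring \<Rightarrow> ('a \<Rightarrow> ereal) \<Rightarrow> (nat \<Rightarrow> 'a) set" where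
  "null_seqs R v = {s \<in> carrier (cauchy_ring R v). (\<lambda>n. v (s n)) \<longlonglongrightarrow> \<infinity>}"

definition completion :: "'a ring \<Rightarrow> ('a \<Rightarrow> ereal) \<Rightarrow> (nat \<Rightarrow> 'a) set ring" where
  "completion R v = cauchy_ring R v Quot null_seqs R v"

definition completion_embed :: "'a ring \<Rightarrow> ('a \<Rightarrow> ereal) \<Rightarrow> 'a \<Rightarrow> (nat \<Rightarrow> 'a) set" where
  "completion_embed R v x = null_seqs R v +>\<^bsub>cauchy_ring R v\<^esub> (\<lambda>_. x)"

text \<open>The continuous extension of \<open>v\<close> to the completion.\<close>

definition completion_val :: "'a ring \<Rightarrow> ('a \<Rightarrow> ereal) \<Rightarrow> (nat \<Rightarrow> 'a) set \<Rightarrow> ereal" where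
  "completion_val R v u = (THE l. \<forall>s\<in>u. (\<lambda>n. v (s n)) \<longlonglongrightarrow> l)"

definition completion_tendsto ::
    "'a ring \<Rightarrow> ('a \<Rightarrow> ereal) \<Rightarrow> (nat \<Rightarrow> (nat \<Rightarrow> 'a) set) \<Rightarrow> (nat \<Rightarrow> 'a) set \<Rightarrow> bool" where
  "completion_tendsto R v u x \<longleftrightarrow>
     (\<lambda>k. completion_val R v (u k \<ominus>\<^bsub>completion R v\<^esub> x)) \<longlonglongrightarrow> \<infinity>"

text \<open>A limit point (cluster point) of a sequence is the limit of one of its subsequences.\<close>

definition completion_limit_point ::
    "'a ring \<Rightarrow> ('a \<Rightarrow> ereal) \<Rightarrow> (nat \<Rightarrow> (nat \<Rightarrow> 'a) set) \<Rightarrow> (nat \<Rightarrow> 'a) set \<Rightarrow> bool" where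
  "completion_limit_point R v u x \<longleftrightarrow>
     (\<exists>r::nat \<Rightarrow> nat. strict_mono r \<and> completion_tendsto R v (u \<circ> r) x)"

text \<open>The map between completions induced by a homomorphism \<open>f\<close> of the underlying fields
  that sends Cauchy sequences to Cauchy sequences and null sequences to null sequences.\<close>

definition completion_map ::
    "('a \<Rightarrow> 'b) \<Rightarrow> 'b ring \<Rightarrow> ('b \<Rightarrow> ereal) \<Rightarrow> (nat \<Rightarrow> 'a) set \<Rightarrow> (nat \<Rightarrow> 'b) set" where
  "completion_map f S w u = the_elem ((\<lambda>s. null_seqs S w +>\<^bsub>cauchy_ring S w\<^esub> (f \<circ> s)) ` u)"


section \<open>The p-adic numbers and the p-adic limit of the counts\<close>

definition padic_val :: "nat \<Rightarrow> rat \<Rightarrow> ereal" where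
  "padic_val p q = (if q = 0 then \<infinity> else
     ereal (real (multiplicity (int p) (fst (quotient_of q)))
          - real (multiplicity (int p) (snd (quotient_of q)))))"

abbreviation rat_ring :: "rat ring" where
  "rat_ring \<equiv> ring_of_type_algebra"

definition padic_ints :: "nat \<Rightarrow> (nat \<Rightarrow> rat) set set" where
  "padic_ints p = {x \<in> carrier (completion rat_ring (padic_val p)).
     completion_val rat_ring (padic_val p) x \<ge> 0}"

text \<open>The sequence below is indexed by all \<open>k \<ge> 0\<close>; this does not affect its limit.\<close>

definition kappa_padic :: "nat \<Rightarrow> nat \<Rightarrow> (nat \<Rightarrow> rat) set" where
  "kappa_padic d p = (THE x. x \<in> padic_ints p \<and>
     completion_tendsto rat_ring (padic_val p)
       (\<lambda>k. completion_embed rat_ring (padic_val p) (of_nat (indep_count d (p ^ k)))) x)"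

definition Tame :: "nat \<Rightarrow> nat set" where
  "Tame d = {p. prime p \<and> (\<forall>k\<ge>1. padic_val p (of_nat (indep_count d (p ^ k)) - 1)
                              = padic_val p (of_nat (indep_count d p) - 1))}"


section \<open>Real number fields and their primes\<close>

abbreviation real_ring :: "real ring" where
  "real_ring \<equiv> ring_of_type_algebra"

definition rat_adjoin :: "real \<Rightarrow> real ring" where
  "rat_adjoin x = real_ring\<lparr>carrier := generate_field real_ring {x}\<rparr>"

definition ring_of_integers :: "real ring \<Rightarrow> real ring" where
  "ring_of_integers K = K\<lparr>carrier := {x \<in> carrier K. algebraic_int x}\<rparr>"

definition prime_above :: "real ring \<Rightarrow> nat \<Rightarrow> real set \<Rightarrow> bool" where
  "prime_above K p P \<longleftrightarrow> primeideal P (ring_of_integers K) \<and> real p \<in> P"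

text \<open>The exponent of \<open>P\<close> in the factorisation of the principal ideal generated by a nonzero
  \<open>x\<close> is the largest \<open>n\<close> with \<open>x \<in> P ^ n\<close>.\<close>

definition prime_exponent :: "real ring \<Rightarrow> real set \<Rightarrow> real \<Rightarrow> nat" where
  "prime_exponent K P x = (GREATEST n::nat. x \<in> P [^]\<^bsub>ideals_set (ring_of_integers K)\<^esub> n)"

definition prime_val :: "real ring \<Rightarrow> real set \<Rightarrow> real \<Rightarrow> ereal" where
  "prime_val K P x = (if x = 0 then \<infinity> else
     (THE l. \<exists>a\<in>carrier (ring_of_integers K) - {0}. \<exists>b\<in>carrier (ring_of_integers K) - {0}.
        x = a / b \<and> l = ereal (real (prime_exponent K P a) - real (prime_exponent K P b))))"

end

(*
  For k >= 1 the independent sets of T_d(p^k) are the p^k-periodic ones among those of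
  T_d(p^(k+1)).  Sort the remaining ones by the first coordinate in which they fail to be
  p^k-periodic: translation in that coordinate has orbits of exactly p^(k+1) elements, so
  a_d(p^(k+1)) and a_d(p^k) are congruent modulo p^(k+1), and a_d(p) is congruent to 1 modulo p
  (no nonempty independent set is 1-periodic).  Hence kappa_d^(p) exists and, p being
  tame, kappa_d^(p) - 1 has valuation e r > 0.  The theorem compares this with the valuation of
  kappa_d^(p^(kd)) - 1, which tends to infinity if kappa_d is congruent to 1 modulo P and stays
  nonpositive otherwise.

  That the exponent of P is a valuation follows from the existence of g in K with g P contained
  in the ring of integers O but not in P: if b has annihilator P modulo p O, then g = b / p works.
  Finiteness of O / N O, which follows from [K : Q] < infinity, is all that is needed about O.
*)

theory Submission
  imports Defs
begin

text \<open>T_d(1) is the obstacle to a uniform congruence: it has two independent sets, while the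
  counts at p demand the value 1. Viewing independent sets as periodic subsets of Z^d restores the
  loop that T_d(1) lacks, which makes its count 1, and turns the inclusion between consecutive
  levels into a literal one. A suitable b is found by maximality: among the elements whose
  annihilator modulo p O lies in P, one with the largest annihilator is taken, and only finitely
  many sizes occur. That g P is not inside P uses finiteness again: otherwise p g^i would be
  integral for every i, and a pigeonhole argument would make g integral. The same argument shows
  that a nonzero integer of K lies in only finitely many P^n. An element \<pi> of P with g \<pi>
  outside P then generates P locally. The comparison in K_P is made on representatives. kappa_d^(p)
  is the class of the counts, and the terms a_d(p^n) - kappa_d^(p^(kd)) with n \<ge> 1 all have the
  same valuation unless kappa_d^(p^(kd)) - 1 has valuation exactly e r.\<close>

section \<open>Congruences between the counts\<close>

text \<open>The least period of each point divides \<open>p ^ Suc k\<close> but not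
  \<open>p ^ k\<close>, so it is \<open>p ^ Suc k\<close>, and \<open>S\<close> splits into orbits
  of exactly that length.\<close>

lemma prime_power_dvd_card_if_period:
  fixes f :: "'a \<Rightarrow> 'a"
  assumes p: "prime p" and S: "finite S" "\<And>x. x \<in> S \<Longrightarrow> f x \<in> S"
    and per: "\<And>x. x \<in> S \<Longrightarrow> (f ^^ (p ^ Suc k)) x = x"
    and nper: "\<And>x. x \<in> S \<Longrightarrow> (f ^^ (p ^ k)) x \<noteq> x"
  shows "p ^ Suc k dvd card S"
proof -
  define n where "n = p ^ Suc k"
  have n: "n > 0" using p by (simp add: n_def prime_gt_0_nat)
  define orb where "orb x = range (\<lambda>m. (f ^^ m) x)" for x
  have mult: "(f ^^ (m * j)) x = x" if "(f ^^ m) x = x" for m j x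
    by (induction j) (simp_all add: funpow_add that)
  have closed: "(f ^^ m) x \<in> S" if "x \<in> S" for m x
    by (induction m) (use that S in auto)
  have modn: "(f ^^ m) x = (f ^^ (m mod n)) x" if "x \<in> S" for m x
  proof -
    have "(f ^^ m) x = (f ^^ (m mod n + n * (m div n))) x" by simp
    also have "\<dots> = (f ^^ (m mod n)) x"
      unfolding funpow_add using mult[of n x] per[OF that] by (simp add: n_def)
    finally show ?thesis .
  qed
  have orb_eq: "orb x = (\<lambda>m. (f ^^ m) x) ` {..<n}" if "x \<in> S" for x
    unfolding orb_def using modn[OF that] n by (auto simp: image_iff) (metis lessThan_iff mod_less_divisor)
  have inj: "inj_on (\<lambda>m. (f ^^ m) x) {..<n}" if x: "x \<in> S" for x
  proof (rule linorder_inj_onI')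
    fix a b assume ab: "a < b" "a \<in> {..<n}" "b \<in> {..<n}"
    show "(f ^^ a) x \<noteq> (f ^^ b) x"
    proof
      \<comment> \<open>Another \<open>n - a\<close> steps turn the collision into the return
        \<open>(f ^^ (b - a)) x = x\<close>, since \<open>n\<close> steps act trivially.\<close>
      assume eq: "(f ^^ a) x = (f ^^ b) x"
      have "(f ^^ (b - a)) x = (f ^^ (b - a)) ((f ^^ n) x)" using per[OF x] by (simp add: n_def)
      also have "\<dots> = (f ^^ (n - a + b)) x" 
      proof -
        have "n - a + b = (b - a) + n" using ab by auto
        then show ?thesis by (simp only: funpow_add o_def)
      qed
      also have "\<dots> = (f ^^ (n - a)) ((f ^^ b) x)" by (simp add: funpow_add)
      also have "\<dots> = (f ^^ (n - a + a)) x" by (simp only: eq[symmetric] funpow_add o_def)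
      also have "\<dots> = x" using per[OF x] ab by (simp add: n_def)
      finally have m: "(f ^^ (b - a)) x = x" .
      \<comment> \<open>By Bezout the gcd of two periods is a period. The gcd with \<open>n\<close>
        is a power of \<open>p\<close> below \<open>n\<close>, hence it divides
        \<open>p ^ k\<close>.\<close>
      obtain u v where uv: "(b - a) * u = n * v + gcd (b - a) n"
        using bezout_nat[of "b - a" n] ab by auto
      have "x = (f ^^ (gcd (b - a) n + n * v)) x" using mult[OF m, of u] uv by (simp add: add.commute)
      also have "\<dots> = (f ^^ gcd (b - a) n) x"
        unfolding funpow_add using mult[of n x v] per[OF x] by (simp add: n_def)
      finally have g: "(f ^^ gcd (b - a) n) x = x" by simp
      have "gcd (b - a) n dvd p ^ Suc k" by (simp add: n_def)
      then obtain j where j: "j \<le> Suc k" "gcd (b - a) n = p ^ j"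
        using divides_primepow_nat[OF p] by blast
      have "gcd (b - a) n \<le> b - a" using ab by (intro gcd_le1_nat) auto
      moreover have "b - a < n" using ab by auto
      ultimately have "gcd (b - a) n < n" by (rule le_less_trans)
      then have "j \<noteq> Suc k" using j n_def by auto
      then have "p ^ k = p ^ j * p ^ (k - j)" using j by (simp flip: power_add)
      then have "(f ^^ (p ^ k)) x = x" using mult[OF g] j by metis
      then show False using nper[OF x] by simp
    qed
  qed
  have sub: "orb y \<subseteq> orb x" if "y \<in> orb x" for x y
    using that unfolding orb_def by (auto simp flip: funpow_add[THEN fun_cong, unfolded o_def])
  \<comment> \<open>Orbits can be run backwards: from \<open>(f ^^ m) x\<close> another
    \<open>n * m - m\<close> steps complete \<open>m\<close> full rounds and return to
    \<open>x\<close>.\<close>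
  have sym: "x \<in> orb y" if xy: "x \<in> S" "y \<in> orb x" for x y
  proof -
    obtain m where m: "y = (f ^^ m) x" using xy(2) unfolding orb_def by blast
    have "x = (f ^^ (n * m)) x" using mult[of n x m] per[OF xy(1)] by (simp add: n_def)
    also have "n * m = (n * m - m) + m" using n by simp
    finally have "x = (f ^^ (n * m - m)) y" by (simp only: m funpow_add o_def)
    then show ?thesis unfolding orb_def by blast
  qed
  have self: "x \<in> orb x" for x unfolding orb_def by (rule range_eqI[of _ _ 0]) simp
  have Un: "\<Union>(orb ` S) = S" using self closed by (auto simp: orb_def)
  have "n * card (orb ` S) = card (\<Union>(orb ` S))"
  proof (rule card_partition)
    show "card c = n" if "c \<in> orb ` S" for c
      using that inj by (auto simp: orb_eq card_image)
    show "c1 \<inter> c2 = {}" if "c1 \<in> orb ` S" "c2 \<in> orb ` S" "c1 \<noteq> c2" for c1 c2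
      using that sub sym by (auto; blast)
  qed (use S Un in auto)
  then show ?thesis using Un n_def by (metis dvd_triv_left)
qed

section \<open>Independent sets of the torus as periodic subsets of Z^d\<close>

definition bump :: "nat \<Rightarrow> int \<Rightarrow> (nat \<Rightarrow> int) \<Rightarrow> nat \<Rightarrow> int" where
  "bump i m x = x(i := x i + m)"

text \<open>For n \<ge> 2 these are the preimages in Z^d of the independent sets of T_d(n), so
  families for different n consist of subsets of one space. Forward steps suffice because adjacency
  is symmetric. For n = 1 and d \<ge> 1 only the empty set remains, whereas
  \<open>indep_count d 1\<close> is 2.\<close>

definition periodic_indep :: "nat \<Rightarrow> nat \<Rightarrow> (nat \<Rightarrow> int) set set" where
  "periodic_indep d n = {B. B \<subseteq> extensional {..<d} \<and>
     (\<forall>i<d. \<forall>x. bump i (int n) x \<in> B \<longleftrightarrow> x \<in> B) \<and> (\<forall>i<d. \<forall>x\<in>B. bump i 1 x \<notin> B)}"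

lemma bump_bump [simp]: "bump i a (bump i b x) = bump i (a + b) x"
  by (simp add: bump_def algebra_simps)

lemma bump_commute: "bump i a (bump j b x) = bump j b (bump i a x)"
  by (auto simp: bump_def)

lemma bump_0 [simp]: "bump i 0 x = x"
  by (simp add: bump_def)

lemma bump_extensional [simp]: "i < d \<Longrightarrow> bump i m x \<in> extensional {..<d} \<longleftrightarrow> x \<in> extensional {..<d}"
  by (auto simp: bump_def extensional_def)

lemma periodic_bump_multiple:
  assumes "\<forall>x. bump i n x \<in> B \<longleftrightarrow> x \<in> B"
  shows "bump i (n * m) x \<in> B \<longleftrightarrow> x \<in> B"
proof (induction m arbitrary: x rule: int_induct[where k = 0])
  case (step1 m)
  have "bump i (n * (m + 1)) x = bump i n (bump i (n * m) x)" by (simp add: algebra_simps)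
  then show ?case using assms step1 by metis
next
  case (step2 m)
  have "bump i (n * m) x = bump i n (bump i (n * (m - 1)) x)" by (simp add: algebra_simps)
  then show ?case using assms step2 by metis
qed simp

lemma periodic_indep_mult:
  assumes "B \<in> periodic_indep d n"
  shows "B \<in> periodic_indep d (n * m)"
  using assms periodic_bump_multiple[of _ "int n" B "int m"] by (auto simp: periodic_indep_def)

text \<open>\<open>x\<close> is changed into \<open>y\<close> one coordinate at a time, and each
  change is a shift by a multiple of n.\<close>

lemma periodic_indep_cong:
  assumes B: "B \<in> periodic_indep d n" and ext: "x \<in> extensional {..<d}" "y \<in> extensional {..<d}"
    and cong: "\<And>j. j < d \<Longrightarrow> int n dvd y j - x j"
  shows "x \<in> B \<longleftrightarrow> y \<in> B"
proof -
  have step: "(\<lambda>j. if j < l then y j else x j) \<in> B \<longleftrightarrow> x \<in> B" if "l \<le> d" for l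
    using that
  proof (induction l)
    case (Suc l)
    obtain c where c: "y l - x l = int n * c" using cong[of l] Suc.prems by (auto elim: dvdE)
    have "(\<lambda>j. if j < Suc l then y j else x j) = bump l (int n * c) (\<lambda>j. if j < l then y j else x j)"
      by (auto simp: bump_def fun_eq_iff less_Suc_eq c[symmetric])
    then show ?case
      using Suc periodic_bump_multiple[of l "int n" B c] B by (auto simp: periodic_indep_def)
  qed simp
  have "(\<lambda>j. if j < d then y j else x j) = y" using ext by (auto simp: fun_eq_iff extensional_def)
  then show ?thesis using step[of d] by simp
qed

definition reduce :: "nat \<Rightarrow> nat \<Rightarrow> (nat \<Rightarrow> int) \<Rightarrow> nat \<Rightarrow> int" where
  "reduce d n x = (\<lambda>j\<in>{..<d}. x j mod int n)"

lemma carrier_torus: "n > 0 \<Longrightarrow> carrier (torus_group d n) = (\<Pi>\<^sub>E i\<in>{..<d}. {0..<int n})"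
  by (simp add: torus_group_def carrier_integer_mod_group)

lemma reduce_carrier: "n > 0 \<Longrightarrow> reduce d n x \<in> carrier (torus_group d n)"
  by (auto simp: carrier_torus reduce_def)

lemma reduce_id: "n > 0 \<Longrightarrow> x \<in> carrier (torus_group d n) \<Longrightarrow> reduce d n x = x"
  by (auto simp: carrier_torus reduce_def fun_eq_iff PiE_def Pi_def extensional_def)

lemma group_torus: "group (torus_group d n)"
  by (simp add: torus_group_def)

text \<open>A step by the inverse of a basis vector from \<open>x\<close> to \<open>y\<close> is a
  step by that basis vector from \<open>y\<close> to \<open>x\<close>. For n \<ge> 2 no basis vector
  is neutral, so removing the neutral element from the steps deletes nothing.\<close>

lemma torus_adj_iff:
  assumes n: "n \<ge> 2" and x: "x \<in> carrier (torus_group d n)" and y: "y \<in> carrier (torus_group d n)"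
  shows "torus_adj d n x y \<longleftrightarrow> (\<exists>i<d. y = reduce d n (bump i 1 x) \<or> x = reduce d n (bump i 1 y))"
proof -
  let ?G = "torus_group d n"
  interpret group ?G by (rule group_torus)
  have basis: "std_basis d n i \<in> carrier ?G" for i
    using n by (auto simp: carrier_torus std_basis_def)
  have ne: "std_basis d n i \<noteq> \<one>\<^bsub>?G\<^esub>" if "i < d" for i
  proof
    assume "std_basis d n i = \<one>\<^bsub>?G\<^esub>"
    from fun_cong[OF this, of i] that n show False by (simp add: std_basis_def torus_group_def)
  qed
  have inv_ne: "inv\<^bsub>?G\<^esub> (std_basis d n i) \<noteq> \<one>\<^bsub>?G\<^esub>" if "i < d" for i
    using ne[OF that] basis by (metis inv_inv inv_one)
  have add: "z \<otimes>\<^bsub>?G\<^esub> std_basis d n i = reduce d n (bump i 1 z)" for z i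
    using n by (auto simp: torus_group_def std_basis_def reduce_def bump_def fun_eq_iff
        integer_mod_group_def mod_simps)
  have sub: "y = x \<otimes>\<^bsub>?G\<^esub> inv\<^bsub>?G\<^esub> (std_basis d n i) \<longleftrightarrow> x = y \<otimes>\<^bsub>?G\<^esub> std_basis d n i" for i
    using x y basis[of i] by (metis inv_solve_right)
  have "torus_adj d n x y \<longleftrightarrow> (\<exists>i<d. y = x \<otimes>\<^bsub>?G\<^esub> std_basis d n i \<or> y = x \<otimes>\<^bsub>?G\<^esub> inv\<^bsub>?G\<^esub> (std_basis d n i))"
    using ne inv_ne x y by (auto simp: torus_adj_def cayley_adj_def torus_steps_def)
  then show ?thesis by (simp add: add sub)
qed

text \<open>The carrier is a fundamental domain for the shifts by n, so a periodic set is recovered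
  from its trace as a preimage under \<open>reduce\<close>. At n = 1 this breaks down: the unit step
  becomes a loop, which excludes the vertex from \<open>periodic_indep\<close> but is absent from
  the torus graph.\<close>

lemma bij_betw_indep_sets_periodic:
  assumes n: "n \<ge> 2"
  shows "bij_betw (\<lambda>B. B \<inter> carrier (torus_group d n)) (periodic_indep d n)
           (indep_sets (carrier (torus_group d n)) (torus_adj d n))"
proof (rule bij_betw_byWitness[where f' = "\<lambda>A. {x \<in> extensional {..<d}. reduce d n x \<in> A}"])
  let ?C = "carrier (torus_group d n)"
  let ?g = "\<lambda>A. {x \<in> extensional {..<d}. reduce d n x \<in> A}"
  have n0: "n > 0" using n by simp
  have ext: "?C \<subseteq> extensional {..<d}" using n0 by (auto simp: carrier_torus PiE_def)
  have red: "reduce d n x \<in> B \<longleftrightarrow> x \<in> B"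
    if "B \<in> periodic_indep d n" "x \<in> extensional {..<d}" for B x
  proof (rule periodic_indep_cong[OF that(1)])
    show "int n dvd x j - reduce d n x j" if "j < d" for j
      using that by (simp add: reduce_def minus_mod_eq_mult_div)
  qed (use that in \<open>auto simp: reduce_def\<close>)
  show "\<forall>B\<in>periodic_indep d n. ?g (B \<inter> ?C) = B"
  proof
    fix B assume B: "B \<in> periodic_indep d n"
    then have "B \<subseteq> extensional {..<d}" by (simp add: periodic_indep_def)
    then show "?g (B \<inter> ?C) = B" using red[OF B] reduce_carrier[OF n0] by blast
  qed
  show "\<forall>A\<in>indep_sets ?C (torus_adj d n). ?g A \<inter> ?C = A"
    using reduce_id[OF n0] ext by (auto simp: indep_sets_def)
  show "(\<lambda>B. B \<inter> ?C) ` periodic_indep d n \<subseteq> indep_sets ?C (torus_adj d n)"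
  proof -
    have "\<not> torus_adj d n x y" if B: "B \<in> periodic_indep d n" and xy: "x \<in> B \<inter> ?C" "y \<in> B \<inter> ?C" for B x y
    proof
      have no: "reduce d n (bump i 1 z) \<notin> B" if "i < d" "z \<in> B" for i z
        using that B red[OF B, of "bump i 1 z"] by (auto simp: periodic_indep_def)
      assume "torus_adj d n x y"
      then show False using torus_adj_iff[OF n] xy no by auto
    qed
    then show ?thesis by (auto simp: indep_sets_def)
  qed
  show "?g ` indep_sets ?C (torus_adj d n) \<subseteq> periodic_indep d n"
  proof -
    have "?g A \<in> periodic_indep d n" if A: "A \<in> indep_sets ?C (torus_adj d n)" for A
    proof -
      have "reduce d n (bump i (int n) x) = reduce d n x" if "i < d" for i x
        using that by (auto simp: reduce_def bump_def fun_eq_iff)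
      moreover have False if "i < d" "reduce d n x \<in> A" "reduce d n (bump i 1 x) \<in> A" for i x
      proof -
        have "reduce d n (bump i 1 x) = reduce d n (bump i 1 (reduce d n x))"
          using that by (auto simp: reduce_def bump_def fun_eq_iff mod_simps)
        then have "torus_adj d n (reduce d n x) (reduce d n (bump i 1 x))"
          using torus_adj_iff[OF n] reduce_carrier[OF n0] that by blast
        then show False using A that by (auto simp: indep_sets_def)
      qed
      ultimately show ?thesis by (auto simp: periodic_indep_def)
    qed
    then show ?thesis by blast
  qed
qed

lemma finite_carrier_torus: "n > 0 \<Longrightarrow> finite (carrier (torus_group d n))"
  by (simp add: carrier_torus finite_PiE)

lemma indep_count_periodic:
  assumes "n \<ge> 2"
  shows "indep_count d n = card (periodic_indep d n)" "finite (periodic_indep d n)"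
proof -
  show "indep_count d n = card (periodic_indep d n)"
    using bij_betw_same_card[OF bij_betw_indep_sets_periodic[OF assms]] by (simp add: indep_count_def)
  have "finite (indep_sets (carrier (torus_group d n)) (torus_adj d n))"
    using finite_carrier_torus[of n d] assms
    by (auto simp: indep_sets_def intro!: finite_subset[OF _ finite_Pow_iff[THEN iffD2, of "carrier (torus_group d n)"]])
  then show "finite (periodic_indep d n)"
    using bij_betw_finite[OF bij_betw_indep_sets_periodic[OF assms]] by simp
qed

lemma periodic_indep_1:
  assumes "d \<ge> 1"
  shows "periodic_indep d 1 = {{}}"
  using assms by (auto simp: periodic_indep_def)

section \<open>Translations and the congruence modulo prime powers\<close>

definition translate :: "nat \<Rightarrow> nat \<Rightarrow> (nat \<Rightarrow> int) set \<Rightarrow> (nat \<Rightarrow> int) set" where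
  "translate d i B = {x \<in> extensional {..<d}. bump i 1 x \<in> B}"

lemma funpow_translate:
  assumes "B \<subseteq> extensional {..<d}" "i < d"
  shows "(translate d i ^^ m) B = {x \<in> extensional {..<d}. bump i (int m) x \<in> B}"
  using assms by (induction m) (auto simp: translate_def algebra_simps)

lemma translate_fixed_iff:
  assumes "B \<subseteq> extensional {..<d}" "i < d"
  shows "(translate d i ^^ m) B = B \<longleftrightarrow> (\<forall>x. bump i (int m) x \<in> B \<longleftrightarrow> x \<in> B)"
  using assms bump_extensional[OF assms(2)] unfolding funpow_translate[OF assms] by blast

lemma translate_periodic:
  assumes "B \<in> periodic_indep d n" "i < d"
  shows "translate d i B \<in> periodic_indep d n"
  using assms bump_commute[of i 1] by (auto simp: translate_def periodic_indep_def)

lemma card_periodic_indep_cong: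
  assumes p: "prime p" and d: "d \<ge> 1"
  shows "int (p ^ Suc k) dvd int (card (periodic_indep d (p ^ Suc k))) - int (card (periodic_indep d (p ^ k)))"
proof -
  let ?I = "periodic_indep d (p ^ Suc k)" and ?J = "periodic_indep d (p ^ k)"
  define fix_at where "fix_at j B \<longleftrightarrow> (\<forall>x. bump j (int (p ^ k)) x \<in> B \<longleftrightarrow> x \<in> B)" for j B
  have ge2: "p ^ Suc k \<ge> 2"
    using prime_ge_2_nat[OF p] one_le_power[of p k] by (simp add: mult_le_mono[of 2 p 1 "p ^ k", simplified])
  have fin: "finite ?I" using indep_count_periodic[OF ge2] by blast
  have sub: "?J \<subseteq> ?I" using periodic_indep_mult[of _ d "p ^ k" p] by (auto simp: mult.commute)
  define S where "S i = {B \<in> ?I. \<not> fix_at i B \<and> (\<forall>j<i. fix_at j B)}" for i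
  have decomp: "?I - ?J = (\<Union>i\<in>{..<d}. S i)"
  proof -
    have "B \<in> ?J \<longleftrightarrow> (\<forall>i<d. fix_at i B)" if "B \<in> ?I" for B
      using that by (simp add: periodic_indep_def fix_at_def)
    moreover have "(\<exists>i<d. \<not> fix_at i B) \<longleftrightarrow> (\<exists>i<d. \<not> fix_at i B \<and> (\<forall>j<i. fix_at j B))" for B
    proof
      assume "\<exists>i<d. \<not> fix_at i B"
      then obtain i where i: "i < d" "\<not> fix_at i B" by blast
      then show "\<exists>i<d. \<not> fix_at i B \<and> (\<forall>j<i. fix_at j B)"
        using LeastI[of "\<lambda>i. \<not> fix_at i B" i] Least_le[of "\<lambda>i. \<not> fix_at i B" i]
          not_less_Least[of _ "\<lambda>i. \<not> fix_at i B"] by (meson le_less_trans)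
    qed blast
    ultimately show ?thesis unfolding S_def by blast
  qed
  have "p ^ Suc k dvd card (S i)" if i: "i < d" for i
  proof (rule prime_power_dvd_card_if_period[OF p, where f = "translate d i"])
    show "finite (S i)" using fin by (auto simp: S_def)
    have ext: "B \<subseteq> extensional {..<d}" if "B \<in> S i" for B
      using that by (auto simp: S_def periodic_indep_def)
    show "(translate d i ^^ p ^ Suc k) B = B" if "B \<in> S i" for B
      using that i by (subst translate_fixed_iff[OF ext[OF that] i]) (simp add: S_def periodic_indep_def)
    show "(translate d i ^^ p ^ k) B \<noteq> B" if "B \<in> S i" for B
      using that by (subst translate_fixed_iff[OF ext[OF that] i]) (simp add: S_def fix_at_def)
    show "translate d i B \<in> S i" if B: "B \<in> S i" for B
    proof -
      have "fix_at j (translate d i B)" if "fix_at j B" "j \<le> i" for j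
        using that bump_extensional[of j d] i bump_commute[of i 1 j] by (auto simp: fix_at_def translate_def)
      \<comment> \<open>\<open>S i\<close> demands that periodicity in coordinate \<open>i\<close>
        fail, and this failure must survive translation. So periodicity of the translate is moved
        back to \<open>B\<close> by \<open>bump i (-1)\<close>.\<close>
      moreover have "fix_at i B" if F: "fix_at i (translate d i B)"
      proof -
        have "bump i (int (p ^ k)) x \<in> B \<longleftrightarrow> x \<in> B" for x
        proof -
          have "bump i (int (p ^ k)) (bump i (-1) x) \<in> translate d i B \<longleftrightarrow> bump i (-1) x \<in> translate d i B"
            using F unfolding fix_at_def by blast
          then show ?thesis using ext[OF B] i by (auto simp: translate_def)
        qed
        then show ?thesis by (simp add: fix_at_def)
      qed
      ultimately show ?thesis using B translate_periodic[OF _ i] by (auto simp: S_def)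
    qed
  qed
  moreover have "card (?I - ?J) = (\<Sum>i<d. card (S i))"
    unfolding decomp
  proof (rule card_UN_disjoint)
    show "\<forall>i\<in>{..<d}. finite (S i)" using fin by (auto simp: S_def)
    show "\<forall>i\<in>{..<d}. \<forall>j\<in>{..<d}. i \<noteq> j \<longrightarrow> S i \<inter> S j = {}"
      unfolding S_def by (auto; metis linorder_neqE_nat)
  qed simp
  ultimately have "p ^ Suc k dvd card (?I - ?J)" by (auto intro: dvd_sum)
  then have "int (p ^ Suc k) dvd int (card (?I - ?J))" by (simp only: of_nat_dvd_iff)
  moreover have "int (card (?I - ?J)) = int (card ?I) - int (card ?J)"
    using fin sub by (simp add: card_Diff_subset finite_subset card_mono of_nat_diff)
  ultimately show ?thesis by simp
qed

lemma indep_count_prime_power_cong: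
  assumes p: "prime p" and d: "d \<ge> 1" and k: "k \<ge> 1"
  shows "int (p ^ Suc k) dvd int (indep_count d (p ^ Suc k)) - int (indep_count d (p ^ k))"
proof -
  have "p ^ m \<ge> 2" if "m \<ge> 1" for m
    using prime_ge_2_nat[OF p] that self_le_power[of p m] by linarith
  then show ?thesis
    using card_periodic_indep_cong[OF p d, of k] k indep_count_periodic(1)[of "p ^ k" d]
      indep_count_periodic(1)[of "p ^ Suc k" d] by (metis le_SucI)
qed

text \<open>The level k = 0 of the congruence, where the family \<open>{{}}\<close> contributes the
  residue 1.\<close>

lemma indep_count_prime_cong:
  assumes p: "prime p" and d: "d \<ge> 1"
  shows "int p dvd int (indep_count d p) - 1"
  using card_periodic_indep_cong[OF p d, of 0] periodic_indep_1[OF d] prime_ge_2_nat[OF p]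
  by (simp add: indep_count_periodic)

text \<open>Makes a_d(p) - 1 nonzero, so that r_p is finite. The singleton of the neutral element is
  independent because the steps exclude the neutral element.\<close>

lemma indep_count_gt_1:
  assumes "n \<ge> 2" and "d \<ge> 1"
  shows "indep_count d n > 1"
proof -
  let ?G = "torus_group d n"
  interpret group ?G by (rule group_torus)
  have "\<not> torus_adj d n \<one>\<^bsub>?G\<^esub> \<one>\<^bsub>?G\<^esub>"
  proof
    assume "torus_adj d n \<one>\<^bsub>?G\<^esub> \<one>\<^bsub>?G\<^esub>"
    then obtain s where s: "s \<in> torus_steps d n" "\<one>\<^bsub>?G\<^esub> = \<one>\<^bsub>?G\<^esub> \<otimes>\<^bsub>?G\<^esub> s"
      by (auto simp: torus_adj_def cayley_adj_def)
    have "std_basis d n i \<in> carrier ?G" for i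
      using assms by (auto simp: carrier_torus std_basis_def)
    then have "s \<in> carrier ?G" using s by (auto simp: torus_steps_def)
    then show False using s by (auto simp: torus_steps_def)
  qed
  then have sub: "{{}, {\<one>\<^bsub>?G\<^esub>}} \<subseteq> indep_sets (carrier ?G) (torus_adj d n)"
    by (auto simp: indep_sets_def)
  have "finite (indep_sets (carrier ?G) (torus_adj d n))"
    using indep_count_periodic(2)[OF assms(1)] bij_betw_finite[OF bij_betw_indep_sets_periodic[OF assms(1)]] by blast
  from card_mono[OF this sub] show ?thesis by (simp add: indep_count_def)
qed


section \<open>Algebraic numbers\<close>

lemma vector_space_rat_real: "vector_space (\<lambda>(q::rat) (x::real). of_rat q * x)"
  by unfold_locales (simp_all add: algebra_simps of_rat_add of_rat_mult)

text \<open>Expresses finiteness of the degree of Q(\<theta>) through integer relations. The bound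
  \<open>m\<close> is the degree of some nonzero integer polynomial with root \<theta>: the rational
  span of the powers of \<theta> below \<open>m\<close> is closed under products and inverses, so it
  contains the generated field.\<close>

lemma algebraic_generate_field_dependent:
  assumes "algebraic \<theta>"
  obtains m :: nat where
    "\<And>f. (\<And>i. i \<le> m \<Longrightarrow> f i \<in> generate_field real_ring {\<theta>}) \<Longrightarrow>
       \<exists>c :: nat \<Rightarrow> int. (\<exists>i\<le>m. c i \<noteq> 0) \<and> (\<Sum>i\<le>m. of_int (c i) * f i) = 0"
proof -
  interpret V: vector_space "\<lambda>(q::rat) (x::real). of_rat q * x" by (rule vector_space_rat_real)
  obtain f where f: "\<And>i. coeff f i \<in> \<int>" "f \<noteq> 0" "poly f \<theta> = 0"
    using assms by (auto simp: algebraic_def)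
  define m where "m = degree f"
  have m: "m > 0"
    using f by (auto simp: m_def dest!: degree0_coeffs[OF sym] elim!: degree_eq_zeroE intro!: Nat.gr0I)
  define B where "B = (\<lambda>i. \<theta> ^ i) ` {..<m}"
  define W where "W = V.span B"
  have W_add: "x + y \<in> W" if "x \<in> W" "y \<in> W" for x y
    using that V.span_add unfolding W_def by blast
  have W_scale: "of_rat q * x \<in> W" if "x \<in> W" for q x
    using that V.span_scale unfolding W_def by blast
  have W_base: "\<theta> ^ i \<in> W" if "i < m" for i
    using that unfolding W_def B_def by (intro V.span_base) auto
  have W_sum: "sum g S \<in> W" if "\<And>i. i \<in> S \<Longrightarrow> g i \<in> W" for g :: "nat \<Rightarrow> real" and S
    using V.span_sum that unfolding W_def by blast
  have Wm: "\<theta> ^ m \<in> W"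
  proof -
    have "(\<Sum>i<m. coeff f i * \<theta> ^ i) + coeff f m * \<theta> ^ m = 0"
      using f(3) by (simp add: poly_altdef m_def lessThan_Suc_atMost[symmetric])
    moreover have lc: "coeff f m \<noteq> 0" using f by (simp add: m_def)
    ultimately have "\<theta> ^ m = (\<Sum>i<m. (- coeff f i / coeff f m) * \<theta> ^ i)"
      by (simp add: field_simps sum_negf sum_divide_distrib[symmetric] sum_distrib_left[symmetric] eq_neg_iff_add_eq_0)
    moreover have "\<exists>q. - coeff f i / coeff f m = of_rat q" for i
    proof -
      have "- coeff f i / coeff f m \<in> \<rat>"
        using f(1) Ints_subset_Rats by (intro Rats_divide Rats_minus_iff[THEN iffD2]) auto
      then show ?thesis by (metis Rats_cases)
    qed
    then have "(- coeff f i / coeff f m) * \<theta> ^ i \<in> W" if "i < m" for i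
      using W_scale[OF W_base[OF that]] by metis
    ultimately show ?thesis using W_sum[of "{..<m}" "\<lambda>i. (- coeff f i / coeff f m) * \<theta> ^ i"] by (metis lessThan_iff)
  qed
  have W_theta: "\<theta> * x \<in> W" if "x \<in> W" for x
    using that[unfolded W_def]
  proof (induction rule: V.span_induct_alt)
    case base show ?case using V.span_zero by (simp add: W_def)
  next
    case (step q x y)
    then obtain i where i: "i < m" "x = \<theta> ^ i" by (auto simp: B_def)
    have "\<theta> ^ Suc i \<in> W" using i W_base[of "Suc i"] Wm by (metis Suc_lessI)
    then show ?case
      using W_add[OF W_scale[of "\<theta> ^ Suc i" q] step(2)] i by (simp add: algebra_simps)
  qed
  have W_pow: "\<theta> ^ i * x \<in> W" if "x \<in> W" for i x
    by (induction i) (use that W_theta in \<open>auto simp: mult.assoc\<close>)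
  have W_mult: "x * y \<in> W" if "x \<in> W" "y \<in> W" for x y
    using that(1)[unfolded W_def]
  proof (induction rule: V.span_induct_alt)
    case base show ?case using V.span_zero by (simp add: W_def)
  next
    case (step q z x)
    then obtain i where i: "z = \<theta> ^ i" by (auto simp: B_def)
    show ?case
      using W_add[OF W_scale[OF W_pow[OF that(2), of i], of q] step(2)] i by (simp add: algebra_simps)
  qed
  have W_1: "1 \<in> W" using W_base[OF m] by simp
  have W_0: "0 \<in> W" using V.span_zero by (simp add: W_def)
  have card_B: "finite B" "card B \<le> m" by (auto simp: B_def intro: card_image_le[of "{..<m}", simplified])
  have dep: "\<exists>c :: nat \<Rightarrow> int. (\<exists>i\<le>m. c i \<noteq> 0) \<and> (\<Sum>i\<le>m. of_int (c i) * f i) = 0"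
    if f: "\<And>i. i \<le> m \<Longrightarrow> f i \<in> W" for f
  \<comment> \<open>\<open>V.dependent\<close> speaks of a set of vectors, so repeated values are
    treated apart and give the coefficients 1 and -1. If the values are distinct, there are more of
    them than elements of the spanning set \<open>B\<close>.\<close>
  proof (cases "inj_on f {..m}")
    case False
    then obtain i j where ij: "i \<le> m" "j \<le> m" "i \<noteq> j" "f i = f j" by (auto simp: inj_on_def)
    let ?c = "\<lambda>k. if k = i then 1 else if k = j then - 1 else (0::int)"
    have "(\<Sum>k\<le>m. of_int (?c k) * f k) = (\<Sum>k\<in>{i, j}. of_int (?c k) * f k)"
      using ij by (intro sum.mono_neutral_right) auto
    also have "\<dots> = 0" using ij by simp
    finally show ?thesis using ij by (intro exI[of _ ?c]) auto
  next
    case True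
    have "V.dependent (f ` {..m})"
    proof (rule ccontr)
      assume "V.independent (f ` {..m})"
      moreover have "f ` {..m} \<subseteq> V.span B" using f W_def by auto
      ultimately have "card (f ` {..m}) \<le> card B" using V.independent_span_bound card_B by blast
      then show False using card_B(2) card_image[OF True] by simp
    qed
    then obtain u v where uv: "v \<in> f ` {..m}" "u v \<noteq> 0" "(\<Sum>w\<in>f ` {..m}. of_rat (u w) * w) = 0"
      unfolding V.dependent_finite[of "f ` {..m}", simplified] by auto
    define den where "den i = snd (quotient_of (u (f i)))" for i
    define num where "num i = fst (quotient_of (u (f i)))" for i
    have den: "den i > 0" for i by (simp add: den_def quotient_of_denom_pos')
    have den_ne: "den i \<noteq> 0" for i using den[of i] by simp
    have u: "u (f i) = of_int (num i) / of_int (den i)" for i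
      using quotient_of_div[of "u (f i)" "num i" "den i"] by (simp add: num_def den_def)
    \<comment> \<open>Multiplying the rational relation by the product of all denominators makes it
      integral; in \<open>c i\<close> the denominator of the i-th coefficient has been
      cancelled.\<close>
    define c where "c i = num i * (\<Prod>j\<in>{..m} - {i}. den j)" for i
    have c: "of_int (c i) = (of_rat (u (f i)) :: real) * of_int (\<Prod>j\<le>m. den j)" if "i \<le> m" for i
    proof -
      have "(\<Prod>j\<le>m. den j) = den i * (\<Prod>j\<in>{..m} - {i}. den j)" using that by (simp add: prod.remove)
      then show ?thesis using den[of i] by (simp add: c_def u of_rat_divide)
    qed
    have "(\<Sum>i\<le>m. of_int (c i) * f i) = (\<Sum>i\<le>m. of_rat (u (f i)) * f i) * of_int (\<Prod>j\<le>m. den j)"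
      by (subst sum_distrib_right, rule sum.cong) (auto simp: c simp del: of_int_prod)
    also have "(\<Sum>i\<le>m. of_rat (u (f i)) * f i) = 0"
      using uv(3) sum.reindex[OF True, of "\<lambda>w. of_rat (u w) * w"] by simp
    finally have "(\<Sum>i\<le>m. of_int (c i) * f i) = 0" by simp
    moreover obtain i where i: "i \<le> m" "v = f i" using uv by auto
    have "(\<Prod>j\<le>m. den j) > 0" using den by (simp add: prod_pos)
    then have "of_int (c i) \<noteq> (0::real)" using i uv c[of i] den_ne by (simp del: of_int_prod)
    ultimately show ?thesis using i by auto
  qed
  have W_inv: "inverse x \<in> W" if x: "x \<in> W" "x \<noteq> 0" for x
  proof -
    have pow: "x ^ i \<in> W" for i by (induction i) (simp_all add: W_1 W_mult x(1))
    obtain c :: "nat \<Rightarrow> int" where c: "(\<exists>i\<le>m. c i \<noteq> 0) \<and> (\<Sum>i\<le>m. of_int (c i) * x ^ i) = 0"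
      using dep[of "\<lambda>i. x ^ i", OF pow] by (elim exE)
    from c obtain i1 where i1: "i1 \<le> m" "c i1 \<noteq> 0" by (elim conjE exE)
    \<comment> \<open>The lowest power x^i0 that occurs in the relation is divided out. The nonzero
      constant term \<open>c i0\<close> is then a multiple of \<open>x\<close>, and the cofactor
      yields the inverse inside \<open>W\<close>.\<close>
    define i0 where "i0 = (LEAST i. c i \<noteq> 0)"
    have i0: "c i0 \<noteq> 0" "i0 \<le> m" "\<And>i. i < i0 \<Longrightarrow> c i = 0"
      unfolding i0_def
      subgoal using i1(2) by (rule LeastI)
      subgoal using Least_le[of "\<lambda>i. c i \<noteq> 0", OF i1(2)] i1(1) by (rule le_trans)
      subgoal using not_less_Least[of _ "\<lambda>i. c i \<noteq> 0"] by blast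
      done
    have "(\<Sum>i\<le>m. of_int (c i) * x ^ i) = (\<Sum>i=i0..m. of_int (c i) * x ^ i)"
      using i0 by (intro sum.mono_neutral_right) auto
    also have "\<dots> = of_int (c i0) * x ^ i0 + (\<Sum>i=Suc i0..m. of_int (c i) * x ^ i)"
      using i0(2) by (simp add: sum.atLeast_Suc_atMost)
    also have "(\<Sum>i=Suc i0..m. of_int (c i) * x ^ i) = x ^ i0 * x * (\<Sum>i=Suc i0..m. of_int (c i) * x ^ (i - Suc i0))"
      unfolding sum_distrib_left
    proof (rule sum.cong)
      fix i assume "i \<in> {Suc i0..m}"
      then have "i = Suc i0 + (i - Suc i0)" by simp
      then have "x ^ i = x ^ i0 * x * x ^ (i - Suc i0)" by (metis power_add power_Suc2)
      then show "of_int (c i) * x ^ i = x ^ i0 * x * (of_int (c i) * x ^ (i - Suc i0))" by simp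
    qed simp
    finally have "x ^ i0 * (of_int (c i0) + x * (\<Sum>i=Suc i0..m. of_int (c i) * x ^ (i - Suc i0))) = 0"
      using c by (simp add: algebra_simps)
    then have eq: "of_int (c i0) + x * (\<Sum>i=Suc i0..m. of_int (c i) * x ^ (i - Suc i0)) = 0"
      using x by simp
    define y where "y = (\<Sum>i=Suc i0..m. of_int (c i) * x ^ (i - Suc i0))"
    have "y \<in> W" unfolding y_def
      using W_scale[OF pow, of "of_int _"] by (intro W_sum) simp
    moreover have "inverse x = of_rat (- 1 / of_int (c i0)) * y"
      using eq x i0(1) by (simp add: y_def[symmetric] of_rat_divide of_rat_minus field_simps eq_neg_iff_add_eq_0)
    ultimately show ?thesis using W_scale by metis
  qed
  have W_gen: "x \<in> W" if "x \<in> generate_field real_ring {\<theta>}" for x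
    using that
  proof (induction rule: generate_field.induct)
    case (incl h)
    then show ?case using W_theta[OF W_1] by simp
  next
    case (a_inv h)
    interpret R: field real_ring by (rule field_from_type_algebra)
    have "\<ominus>\<^bsub>real_ring\<^esub> h = - h"
      by (rule R.minus_equality) (auto simp: ring_of_type_algebra_def)
    then show ?case using W_scale[OF a_inv.IH, of "-1"] by (simp add: of_rat_minus)
  next
    case (m_inv h)
    interpret R: field real_ring by (rule field_from_type_algebra)
    have "inv\<^bsub>real_ring\<^esub> h = inverse h"
      using m_inv by (intro R.comm_inv_char) (auto simp: ring_of_type_algebra_def)
    then show ?case using m_inv W_inv by (simp add: ring_of_type_algebra_def)
  qed (use W_1 W_add W_mult in \<open>auto simp: ring_of_type_algebra_def\<close>)
  show ?thesis
  proof (rule that)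
    fix f assume "\<And>i. i \<le> m \<Longrightarrow> f i \<in> generate_field real_ring {\<theta>}"
    then show "\<exists>c :: nat \<Rightarrow> int. (\<exists>i\<le>m. c i \<noteq> 0) \<and> (\<Sum>i\<le>m. of_int (c i) * f i) = 0"
      by (intro dep W_gen)
  qed
qed

text \<open>Allows a relation to be reduced modulo q without becoming trivial. If all relations had
  only coefficients divisible by q, they could be divided by q forever, and \<open>c i0\<close>
  would be divisible by every power of q.\<close>

lemma primitive_relation:
  fixes f :: "nat \<Rightarrow> real" and c :: "nat \<Rightarrow> int"
  assumes q: "q > 1" and rel: "(\<Sum>i\<le>m. of_int (c i) * f i) = 0" and nz: "i0 \<le> m" "c i0 \<noteq> 0"
  obtains c' :: "nat \<Rightarrow> int" where "(\<Sum>i\<le>m. of_int (c' i) * f i) = 0" "\<exists>i\<le>m. \<not> int q dvd c' i"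
proof (rule ccontr)
  assume neg: "\<not> thesis"
  have all: "int q dvd c' i" if "(\<Sum>i\<le>m. of_int (c' i) * f i) = 0" "i \<le> m" for c' i
    using neg that \<open>\<And>c'. \<lbrakk>(\<Sum>i\<le>m. of_int (c' i) * f i) = 0; \<exists>i\<le>m. \<not> int q dvd c' i\<rbrakk> \<Longrightarrow> thesis\<close> by blast
  have pow: "int q ^ j dvd c' i0" if "(\<Sum>i\<le>m. of_int (c' i) * f i) = 0" for c' j
    using that
  proof (induction j arbitrary: c')
    case (Suc j)
    have c': "c' i = int q * (c' i div int q)" if "i \<le> m" for i
      using all[OF Suc.prems that] by simp
    have "(\<Sum>i\<le>m. of_int (c' i) * f i) = of_nat q * (\<Sum>i\<le>m. of_int (c' i div int q) * f i)"
      unfolding sum_distrib_left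
    proof (rule sum.cong)
      fix i assume "i \<in> {..m}"
      then have "real_of_int (c' i) = of_nat q * of_int (c' i div int q)"
        using c'[of i] by (metis atMost_iff of_int_mult of_int_of_nat_eq)
      then show "of_int (c' i) * f i = of_nat q * (of_int (c' i div int q) * f i)" by simp
    qed simp
    then have "(\<Sum>i\<le>m. of_int (c' i div int q) * f i) = 0" using Suc.prems q by simp
    from Suc.IH[OF this] show ?case using c'[OF nz(1)] by (metis mult_dvd_mono dvd_refl power_Suc)
  qed simp
  \<comment> \<open>The absolute value of \<open>c i0\<close> is itself a sufficient exponent, since
    q^n > n.\<close>
  have "nat \<bar>c i0\<bar> < q ^ nat \<bar>c i0\<bar>" using q by (simp add: less_exp power_gt_expt)
  then have "\<bar>c i0\<bar> < int q ^ nat \<bar>c i0\<bar>" by (simp flip: of_nat_power)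
  moreover have "int q ^ nat \<bar>c i0\<bar> \<le> \<bar>c i0\<bar>"
    using dvd_imp_le_int[OF nz(2) pow[OF rel, of "nat \<bar>c i0\<bar>"]] by simp
  ultimately show False by simp
qed

text \<open>Composing a monic integer polynomial that vanishes at x^j - x^i with X^j - X^i gives one
  that vanishes at x; it stays monic because i < j. A collision between powers of x thus yields
  integrality.\<close>

lemma algebraic_int_trinomial:
  fixes x :: real
  assumes "algebraic_int (x ^ j - x ^ i)" and ij: "i < j"
  shows "algebraic_int x"
proof -
  obtain f where f: "poly (map_poly of_int f) (x ^ j - x ^ i) = 0" "lead_coeff f = 1"
    using assms algebraic_int_altdef_ipoly by blast
  let ?q = "monom 1 j - monom 1 i :: real poly"
  have deg: "degree ?q = j" 
    using degree_add_eq_left[of "- monom 1 i" "monom 1 j :: real poly"] ij by (simp add: degree_monom_eq)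
  let ?f = "map_poly of_int f :: real poly"
  show ?thesis
  proof (rule algebraic_int.intros)
    show "poly (pcompose ?f ?q) x = 0" using f by (simp add: poly_pcompose poly_monom)
    have "lead_coeff ?q = 1" using deg ij by simp
    moreover have "lead_coeff ?f = 1" using f(2) by (simp add: degree_map_poly coeff_map_poly)
    ultimately show "lead_coeff (pcompose ?f ?q) = 1"
      using deg ij by (simp add: lead_coeff_comp)
    have ints_mult: "\<forall>n. coeff (p * r) n \<in> \<int>" if "\<forall>n. coeff p n \<in> \<int>" "\<forall>n. coeff r n \<in> \<int>" for p r :: "real poly"
      using that by (auto simp: coeff_mult intro!: Ints_sum Ints_mult)
    have "\<forall>n. coeff (pcompose (map_poly of_int g) ?q) n \<in> \<int>" for g :: "int poly"
    proof (induction g)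
      case (pCons a g)
      have "\<forall>n. coeff (?q * pcompose (map_poly of_int g) ?q) n \<in> \<int>"
        using pCons by (intro ints_mult) simp_all
      then show ?case using pCons
        by (auto simp: map_poly_pCons pcompose_pCons coeff_pCons split: nat.split)
    qed simp
    then show "\<forall>n. coeff (pcompose ?f ?q) n \<in> \<int>" by blast
  qed
qed

text \<open>With c the leading coefficient and n the degree, c^(n-1) f(x) = 0 is a monic integer
  relation for c x.\<close>

lemma algebraic_int_lead_coeff_mult:
  fixes x :: real and f :: "int poly"
  assumes root: "poly (map_poly of_int f) x = 0" and nz: "f \<noteq> 0"
  shows "algebraic_int (of_int (lead_coeff f) * x)"
proof -
  define n where "n = degree f"
  define c where "c = lead_coeff f"
  have n: "n > 0"
  proof (rule ccontr)
    assume "\<not> n > 0"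
    then obtain a where "f = [:a:]" using degree_eq_zeroE n_def by auto
    then show False using root nz by (simp add: map_poly_pCons)
  qed
  \<comment> \<open>The terms below the leading one, rewritten by c^(n-1) a x^i = a c^(n-1-i) (c
    x)^i.\<close>
  define g where "g = (\<Sum>i<n. monom (coeff f i * c ^ (n - 1 - i)) i)"
  have degg: "degree g < n" unfolding g_def
    using n by (intro degree_sum_less) (auto intro: le_less_trans[OF degree_monom_le])
  have ipoly: "poly (map_poly of_int h) y = (\<Sum>i\<le>degree h. of_int (coeff h i) * y ^ i)" for h and y :: real
    by (simp add: poly_altdef degree_map_poly coeff_map_poly)
  have pg: "poly (map_poly of_int g) y = (\<Sum>i<n. of_int (coeff f i * c ^ (n - 1 - i)) * y ^ i)" for y :: real
  proof -
    have "map_poly of_int g = (\<Sum>i<n. monom (of_int (coeff f i * c ^ (n - 1 - i))) i :: real poly)"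
      unfolding g_def
      by (rule poly_eqI) (simp add: coeff_map_poly coeff_sum)
    then show ?thesis by (simp add: poly_sum poly_monom)
  qed
  let ?h = "monom 1 n + g"
  have "degree ?h = n" "lead_coeff ?h = 1"
    using degg by (simp_all add: degree_add_eq_left degree_monom_eq coeff_eq_0)
  moreover have "poly (map_poly of_int ?h) (of_int c * x) = 0"
  proof -
    have "map_poly of_int ?h = (monom 1 n + map_poly of_int g :: real poly)"
      by (rule poly_eqI) (simp add: coeff_map_poly)
    then have "poly (map_poly of_int ?h) (of_int c * x) = (of_int c * x) ^ n + (\<Sum>i<n. of_int (coeff f i * c ^ (n - 1 - i)) * (of_int c * x) ^ i)"
      by (simp add: poly_monom pg)
    also have "(of_int c * x) ^ n = of_int c ^ (n - 1) * (of_int (coeff f n) * x ^ n)"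
      using n by (cases n) (simp_all add: c_def n_def power_mult_distrib)
    also have "(\<Sum>i<n. of_int (coeff f i * c ^ (n - 1 - i)) * (of_int c * x) ^ i)
        = of_int c ^ (n - 1) * (\<Sum>i<n. of_int (coeff f i) * x ^ i)"
      unfolding sum_distrib_left
    proof (rule sum.cong)
      fix i assume "i \<in> {..<n}"
      then have "n - 1 = (n - 1 - i) + i" by simp
      then have "real_of_int c ^ (n - 1) = of_int c ^ (n - 1 - i) * of_int c ^ i" by (metis power_add)
      then show "of_int (coeff f i * c ^ (n - 1 - i)) * (of_int c * x) ^ i = of_int c ^ (n - 1) * (of_int (coeff f i) * x ^ i)"
        by (simp add: power_mult_distrib)
    qed simp
    also have "of_int c ^ (n - 1) * (of_int (coeff f n) * x ^ n) + \<dots> = of_int c ^ (n - 1) * poly (map_poly of_int f) x"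
      by (simp add: ipoly n_def[symmetric] lessThan_Suc_atMost[symmetric] algebra_simps)
    finally show ?thesis using root by simp
  qed
  ultimately show ?thesis unfolding c_def[symmetric] using algebraic_int_altdef_ipoly by blast
qed


section \<open>Prime ideals of the ring of integers\<close>

text \<open>\<open>F\<close> is the number field, \<open>A\<close> its ring of integers and
  \<open>P\<close> the prime above \<open>p\<close>, all as sets of reals. Finiteness of the degree
  enters through \<open>dependent\<close>; closure of \<open>A\<close> under sums and products is
  part of the data.\<close>

locale number_ring_prime =
  fixes F A P :: "real set" and p m :: nat
  assumes dependent: "\<And>f. (\<And>i. i \<le> m \<Longrightarrow> f i \<in> F) \<Longrightarrow>
       \<exists>c :: nat \<Rightarrow> int. (\<exists>i\<le>m. c i \<noteq> 0) \<and> (\<Sum>i\<le>m. of_int (c i) * f i) = 0"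
    and F_1: "1 \<in> F" and F_add: "\<And>x y. x \<in> F \<Longrightarrow> y \<in> F \<Longrightarrow> x + y \<in> F"
    and F_minus: "\<And>x. x \<in> F \<Longrightarrow> - x \<in> F"
    and F_mult: "\<And>x y. x \<in> F \<Longrightarrow> y \<in> F \<Longrightarrow> x * y \<in> F"
    and F_inverse: "\<And>x. x \<in> F \<Longrightarrow> inverse x \<in> F"
    and A_eq: "A = {x \<in> F. algebraic_int x}"
    and A_add: "\<And>x y. x \<in> A \<Longrightarrow> y \<in> A \<Longrightarrow> x + y \<in> A"
    and A_mult: "\<And>x y. x \<in> A \<Longrightarrow> y \<in> A \<Longrightarrow> x * y \<in> A"
    and P_sub: "P \<subseteq> A" and P_add: "\<And>x y. x \<in> P \<Longrightarrow> y \<in> P \<Longrightarrow> x + y \<in> P"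
    and P_mult: "\<And>x y. x \<in> A \<Longrightarrow> y \<in> P \<Longrightarrow> x * y \<in> P"
    and P_1: "1 \<notin> P"
    and P_prime: "\<And>x y. x \<in> A \<Longrightarrow> y \<in> A \<Longrightarrow> x * y \<in> P \<Longrightarrow> x \<in> P \<or> y \<in> P"
    and p: "prime p" and p_in: "real p \<in> P"
begin

lemma A_int: "of_int k \<in> A"
proof -
  have F_0: "0 \<in> F" using F_add[OF F_1 F_minus[OF F_1]] by simp
  have nat: "real n \<in> F" for n
    by (induction n) (simp_all add: F_0 F_1 F_add)
  obtain n where "k = int n \<or> k = - int n" by (metis int_cases2)
  then have "real_of_int k \<in> F" using nat[of n] F_minus[OF nat[of n]] by auto
  then show ?thesis by (simp add: A_eq)
qed

lemma A_nat: "of_nat k \<in> A"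
  using A_int[of "int k"] by simp

lemma A_0: "0 \<in> A" and A_1: "1 \<in> A"
  using A_int[of 0] A_int[of 1] by auto

lemma A_F: "x \<in> A \<Longrightarrow> x \<in> F"
  by (simp add: A_eq)

lemma A_minus: "x \<in> A \<Longrightarrow> - x \<in> A"
  using F_minus by (auto simp: A_eq)

lemma A_diff: "x \<in> A \<Longrightarrow> y \<in> A \<Longrightarrow> x - y \<in> A"
  using A_add[of x "- y"] A_minus by simp

lemma A_power: "x \<in> A \<Longrightarrow> x ^ n \<in> A"
  by (induction n) (auto simp: A_1 A_mult)

lemma A_sum: "(\<And>i. i \<in> S \<Longrightarrow> g i \<in> A) \<Longrightarrow> sum g S \<in> A"
  by (induction S rule: infinite_finite_induct) (auto simp: A_0 A_add)

lemma F_div: "x \<in> F \<Longrightarrow> y \<in> F \<Longrightarrow> x / y \<in> F"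
  by (simp add: divide_inverse F_mult F_inverse)

lemma F_power: "x \<in> F \<Longrightarrow> x ^ n \<in> F"
  by (induction n) (auto simp: F_1 F_mult)

lemma P_minus: "x \<in> P \<Longrightarrow> - x \<in> P"
  using P_mult[OF A_minus[OF A_1]] by fastforce

text \<open>\<open>P\<close> contains p but not 1, so by Bezout it contains no integer prime to
  p.\<close>

lemma P_int: "of_int k \<in> P \<longleftrightarrow> int p dvd k"
proof
  assume k: "of_int k \<in> P"
  show "int p dvd k"
  proof (rule ccontr)
    assume "\<not> int p dvd k"
    then have "coprime (int p) k" using p by (simp add: prime_imp_coprime)
    then obtain a b where "a * int p + b * k = 1"
      by (metis coprime_iff_gcd_eq_1 bezout_int)
    then have "(1::real) = of_int a * real p + of_int b * of_int k"
      by (metis of_int_1 of_int_add of_int_mult of_int_of_nat_eq)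
    then show False using P_add[OF P_mult[OF A_int p_in] P_mult[OF A_int k]] P_1 by metis
  qed
next
  assume "int p dvd k"
  then obtain l where "k = l * int p" by (metis dvdE mult.commute)
  then show "of_int k \<in> P" using P_mult[OF A_int[of l] p_in] by simp
qed

lemma relation_power:
  assumes "x \<in> F"
  obtains f :: "int poly" where "f \<noteq> 0" "poly (map_poly of_int f) x = 0"
proof -
  have "\<exists>c :: nat \<Rightarrow> int. (\<exists>i\<le>m. c i \<noteq> 0) \<and> (\<Sum>i\<le>m. of_int (c i) * x ^ i) = 0"
    by (rule dependent) (intro F_power assms)
  then obtain c :: "nat \<Rightarrow> int" where c0: "(\<exists>i\<le>m. c i \<noteq> 0) \<and> (\<Sum>i\<le>m. of_int (c i) * x ^ i) = 0"
    by (elim exE)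
  note c = conjunct1[OF c0] conjunct2[OF c0]
  let ?f = "\<Sum>i\<le>m. monom (c i) i"
  have co: "coeff ?f j = (if j \<le> m then c j else 0)" for j
    by (simp add: coeff_sum)
  have "map_poly of_int ?f = (\<Sum>i\<le>m. monom (of_int (c i)) i :: real poly)"
    by (rule poly_eqI) (simp add: coeff_map_poly coeff_sum)
  then have "poly (map_poly of_int ?f) x = 0" using c(2) by (simp add: poly_sum poly_monom)
  moreover obtain i where "i \<le> m" "c i \<noteq> 0" using c(1) by (elim exE conjE)
  then have "?f \<noteq> 0" using co[of i] by auto
  ultimately show ?thesis using that by blast
qed

lemma integral_multiple:
  assumes "x \<in> F"
  obtains c :: int where "c \<noteq> 0" "of_int c * x \<in> A"
proof -
  obtain f :: "int poly" where "f \<noteq> 0" "poly (map_poly of_int f) x = 0" by (rule relation_power[OF assms])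
  then show ?thesis
    using that[of "lead_coeff f"] algebraic_int_lead_coeff_mult[of f x] F_mult[OF A_F[OF A_int] assms]
    by (simp add: A_eq)
qed

lemma A_poly: "x \<in> A \<Longrightarrow> poly (map_poly of_int f) x \<in> A"
  by (induction f) (auto simp: map_poly_pCons A_0 A_int A_add A_mult)

text \<open>Factors x are cancelled from an integer relation of x until the constant term is
  nonzero; that term is then a multiple of x.\<close>

lemma integer_multiple:
  assumes x: "x \<in> A" "x \<noteq> 0"
  obtains y k where "y \<in> A" "k \<noteq> 0" "x * y = of_int k"
proof -
  obtain f :: "int poly" where f: "f \<noteq> 0" "poly (map_poly of_int f) x = 0"
    by (rule relation_power[OF A_F[OF x(1)]])
  have "\<exists>y\<in>A. \<exists>k. k \<noteq> 0 \<and> x * y = of_int k"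
    using f
  proof (induction f)
    case (pCons a f)
    show ?case
    proof (cases "a = 0")
      case True
      then have "poly (map_poly of_int f) x = 0" using pCons.prems x by (simp add: map_poly_pCons)
      then show ?thesis using pCons True by auto
    next
      case False
      have "x * poly (map_poly of_int f) x = of_int (- a)"
        using pCons.prems by (simp add: map_poly_pCons eq_neg_iff_add_eq_0 add.commute)
      then show ?thesis using A_poly[OF x(1), of f] False by (metis neg_equal_0_iff_equal)
    qed
  qed simp
  then show ?thesis using that by blast
qed

text \<open>A / q A is a vector space over the field with q elements, of dimension at most m + 1 - 1
  = m. A maximal independent family spans it, and combinations with coefficients below q represent
  all classes.\<close>

lemma finite_residues_prime:
  assumes q: "prime q"
  shows "\<exists>R. finite R \<and> (\<forall>x\<in>A. \<exists>r\<in>R. \<exists>y\<in>A. x = r + real q * y)"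
proof -
  define indep where "indep n f \<longleftrightarrow> (\<forall>i<n. f i \<in> A) \<and>
    (\<forall>(c::nat \<Rightarrow> int). \<forall>y\<in>A. (\<Sum>i<n. of_int (c i) * f i) = real q * y \<longrightarrow> (\<forall>i<n. int q dvd c i))" for n f
  have indepD: "\<forall>i<n. int q dvd c i" if "indep n f" "y \<in> A" "(\<Sum>i<n. of_int (c i) * f i) = real q * y" for n f c y
    using that(1)[unfolded indep_def, THEN conjunct2, THEN spec, THEN bspec, OF that(2), THEN mp, OF that(3)] .
  have bound: "n \<le> m" if "indep n f" for n f
  proof (rule ccontr)
    assume n: "\<not> n \<le> m"
    have fA: "f i \<in> A" if "i \<le> m" for i using \<open>indep n f\<close> n that by (simp add: indep_def)
    have "\<exists>c :: nat \<Rightarrow> int. (\<exists>i\<le>m. c i \<noteq> 0) \<and> (\<Sum>i\<le>m. of_int (c i) * f i) = 0"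
      by (rule dependent) (intro A_F fA)
    then obtain c :: "nat \<Rightarrow> int" where c0: "(\<exists>i\<le>m. c i \<noteq> 0) \<and> (\<Sum>i\<le>m. of_int (c i) * f i) = 0"
      by (elim exE)
    from conjunct1[OF c0] obtain i0 where i0: "i0 \<le> m \<and> c i0 \<noteq> 0" by (rule exE)
    note c = conjunct1[OF i0] conjunct2[OF i0] conjunct2[OF c0]
    \<comment> \<open>The integer relation among m + 1 members might vanish modulo q; made
      primitive, it contradicts independence.\<close>
    obtain c' :: "nat \<Rightarrow> int" where c': "(\<Sum>i\<le>m. of_int (c' i) * f i) = 0" "\<exists>i\<le>m. \<not> int q dvd c' i"
      using primitive_relation[OF prime_gt_1_nat[OF q] c(3,1,2)] by blast
    have "(\<Sum>i<n. of_int (if i \<le> m then c' i else 0) * f i) = (\<Sum>i\<le>m. of_int (c' i) * f i)"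
      using n by (intro sum.mono_neutral_cong_right) auto
    then have "(\<Sum>i<n. of_int (if i \<le> m then c' i else 0) * f i) = real q * 0" using c' by simp
    then have "\<forall>i<n. int q dvd (if i \<le> m then c' i else 0)" by (rule indepD[OF \<open>indep n f\<close> A_0])
    moreover obtain i where i: "i \<le> m" "\<not> int q dvd c' i" using c'(2) by blast
    moreover have "i < n" using i n by simp
    ultimately show False by (auto dest!: spec[of _ i])
  qed
  have ex0: "\<exists>f. indep 0 f" by (simp add: indep_def)
  have bound': "k \<le> m" if "\<exists>f. indep k f" for k using that bound by (elim exE)
  define n where "n = (GREATEST n. \<exists>f. indep n f)"
  have "\<exists>f. indep n f" unfolding n_def
    by (rule GreatestI_nat[of "\<lambda>n. \<exists>f. indep n f", OF ex0 bound'])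
  then obtain f where f: "indep n f" by (rule exE)
  have n: "k \<le> n" if "indep k f" for k f
    unfolding n_def using bound' that by (intro Greatest_le_nat[of "\<lambda>n. \<exists>f. indep n f"]) blast+
  have fA: "\<And>i. i < n \<Longrightarrow> f i \<in> A" using f by (simp add: indep_def)
  define R where "R = (\<lambda>a. \<Sum>i<n. of_int (a i) * f i) ` ({..<n} \<rightarrow>\<^sub>E {0..<int q})"
  have "finite R" unfolding R_def by (intro finite_imageI finite_PiE) auto
  moreover have "\<exists>r\<in>R. \<exists>y\<in>A. x = r + real q * y" if x: "x \<in> A" for x
  proof -
    have "\<not> indep (Suc n) (f(n := x))" using n[of "Suc n"] by (metis Suc_n_not_le_n)
    then obtain c :: "nat \<Rightarrow> int" and y j where c: "y \<in> A" "(\<Sum>i<n. of_int (c i) * f i) + of_int (c n) * x = real q * y"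
      "j < Suc n" "\<not> int q dvd c j"
      using x fA by (auto simp: indep_def less_Suc_eq)
    \<comment> \<open>The new element must occur with a coefficient invertible modulo q; otherwise
      its term could be moved into q A and the family \<open>f\<close> alone would be
      dependent.\<close>
    have "\<not> int q dvd c n"
    proof
      assume "int q dvd c n"
      then obtain l where l: "c n = int q * l" by blast
      have "(\<Sum>i<n. of_int (c i) * f i) = real q * (y - of_int l * x)"
        using c(2) by (simp add: l algebra_simps)
      then have "\<forall>i<n. int q dvd c i" by (rule indepD[OF f A_diff[OF c(1) A_mult[OF A_int x, of l]]])
      then show False using c \<open>int q dvd c n\<close> by (auto simp: less_Suc_eq)
    qed
    then have "coprime (int q) (c n)" using q by (simp add: prime_imp_coprime)
    then obtain s t where st: "s * int q + t * c n = 1"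
      by (metis coprime_iff_gcd_eq_1 bezout_int)
    then have "real_of_int s * real q + of_int t * of_int (c n) = 1"
      by (metis of_int_1 of_int_add of_int_mult of_int_of_nat_eq)
    then have "x = (of_int s * real q + of_int t * of_int (c n)) * x" by simp
    also have "\<dots> = real q * (of_int s * x) + of_int t * (of_int (c n) * x)" by (simp add: algebra_simps)
    also have "of_int (c n) * x = real q * y - (\<Sum>i<n. of_int (c i) * f i)" using c(2) by simp
    finally have x_eq: "x = (\<Sum>i<n. of_int (- t * c i) * f i) + real q * (of_int s * x + of_int t * y)"
      by (simp add: algebra_simps sum_distrib_left sum_negf)
    \<comment> \<open>The coefficients are reduced to the range below q, and the quotients
      \<open>b i\<close> go into the summand from q A.\<close>
    define a where "a i = (- t * c i) mod int q" for i
    define b where "b i = (- t * c i) div int q" for i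
    have ab: "real_of_int (- t * c i) = of_int (a i) + real q * of_int (b i)" for i
      unfolding a_def b_def by (metis mod_mult_div_eq of_int_add of_int_mult of_int_of_nat_eq)
    have "(\<Sum>i<n. of_int (- t * c i) * f i) = (\<Sum>i<n. of_int (a i) * f i) + real q * (\<Sum>i<n. of_int (b i) * f i)"
      by (simp only: ab) (simp add: algebra_simps sum.distrib sum_distrib_left)
    also have "(\<Sum>i<n. of_int (a i) * f i) = (\<Sum>i<n. of_int (restrict a {..<n} i) * f i)" by simp
    finally have "x = (\<Sum>i<n. of_int (restrict a {..<n} i) * f i) + real q * ((\<Sum>i<n. of_int (b i) * f i) + (of_int s * x + of_int t * y))"
      using x_eq by (simp add: algebra_simps)
    moreover have "restrict a {..<n} \<in> {..<n} \<rightarrow>\<^sub>E {0..<int q}" using prime_gt_0_nat[OF q] by (auto simp: a_def)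
    then have "(\<Sum>i<n. of_int (restrict a {..<n} i) * f i) \<in> R" unfolding R_def by (rule imageI)
    moreover have "(\<Sum>i<n. of_int (b i) * f i) + (of_int s * x + of_int t * y) \<in> A"
      using fA x c(1) by (intro A_add A_sum A_mult A_int) auto
    ultimately show ?thesis by blast
  qed
  ultimately show ?thesis by blast
qed

text \<open>A residue modulo q N is a two-digit expansion: a residue modulo q plus q times a residue
  modulo N. So the prime case carries over along the factorisation of N.\<close>

lemma finite_residues:
  assumes "N > 0"
  shows "\<exists>R. finite R \<and> (\<forall>x\<in>A. \<exists>r\<in>R. \<exists>y\<in>A. x = r + real N * y)"
  using assms
proof (induction N rule: prime_divisors_induct)
  case (unit x)
  have "\<forall>y\<in>A. \<exists>r\<in>{0}. \<exists>z\<in>A. y = r + real x * z" using unit by auto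
  then show ?case by blast
next
  case (factor q N)
  then obtain R' where R': "finite R'" "\<forall>x\<in>A. \<exists>r\<in>R'. \<exists>y\<in>A. x = r + real N * y" by auto
  obtain R where R: "finite R" "\<forall>x\<in>A. \<exists>r\<in>R. \<exists>y\<in>A. x = r + real q * y"
    using finite_residues_prime[OF factor(1)] by blast
  let ?R = "(\<lambda>(r, r'). r + real q * r') ` (R \<times> R')"
  have "\<exists>r\<in>?R. \<exists>y\<in>A. x = r + real (q * N) * y" if x: "x \<in> A" for x
  proof -
    obtain r y where 1: "r \<in> R" "y \<in> A" "x = r + real q * y" using R x by blast
    obtain r' z where 2: "r' \<in> R'" "z \<in> A" "y = r' + real N * z" using R' 1 by blast
    have "x = (\<lambda>(r, r'). r + real q * r') (r, r') + real (q * N) * z" using 1 2 by (simp add: algebra_simps)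
    then show ?thesis using 1 2 by blast
  qed
  then have "\<forall>x\<in>A. \<exists>r\<in>?R. \<exists>y\<in>A. x = r + real (q * N) * y" by (rule ballI)
  moreover have "finite ?R" using R(1) R'(1) by simp
  ultimately show ?case by (intro exI[of _ ?R] conjI)
qed simp

text \<open>By pigeonhole modulo \<open>N\<^sup>2\<close>, some difference \<open>x ^ j - x ^ i\<close> is integral.\<close>

lemma almost_integral:
  assumes x: "x \<in> F" and N: "N > 0" and int: "\<And>i. real N * x ^ i \<in> A"
  shows "x \<in> A"
proof -
  obtain R where R: "finite R" "\<forall>x\<in>A. \<exists>r\<in>R. \<exists>y\<in>A. x = r + real (N * N) * y"
    using finite_residues[of "N * N"] N by auto
  then have "\<forall>i. \<exists>r. r \<in> R \<and> (\<exists>y\<in>A. real N * x ^ i = r + real (N * N) * y)" using int by blast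
  then obtain r where r: "\<And>i. r i \<in> R" "\<And>i. \<exists>y\<in>A. real N * x ^ i = r i + real (N * N) * y" by metis
  have "finite (range r)" by (rule finite_subset[OF _ R(1)]) (use r(1) in blast)
  then have "\<not> inj r" using finite_imageD[of r UNIV] infinite_UNIV_nat by blast
  then obtain i j where ij: "i < j" "r i = r j" by (metis injI linorder_neqE_nat)
  obtain y where y: "y \<in> A" "real N * x ^ i = r i + real (N * N) * y" using r(2)[of i] by (elim bexE)
  obtain z where z: "z \<in> A" "real N * x ^ j = r j + real (N * N) * z" using r(2)[of j] by (elim bexE)
  \<comment> \<open>This is why the modulus is N^2: one factor N cancels the multiplier of the
    powers, and the other keeps the difference inside \<open>A\<close>.\<close>
  have "real N * (x ^ j - x ^ i) = real N * (real N * (z - y))"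
    using y z ij by (simp add: algebra_simps)
  then have "x ^ j - x ^ i = real N * (z - y)" using N by simp
  then have "x ^ j - x ^ i \<in> A" using A_mult[OF A_nat A_diff] y z by simp
  then show ?thesis using algebraic_int_trinomial[of x j i] ij x by (simp add: A_eq)
qed

end

section \<open>An element g with g P inside A but not inside P\<close>

context number_ring_prime
begin

text \<open>Among the elements whose annihilator modulo p A lies in \<open>P\<close>, one with the
  largest annihilator is taken; that annihilator must be all of \<open>P\<close>. The element 1,
  with annihilator p A, shows that candidates exist.\<close>

lemma annihilator_P:
  obtains b where "b \<in> A" "b / real p \<notin> A" "\<And>x. x \<in> P \<Longrightarrow> x * b / real p \<in> A"
proof -
  define ann where "ann b = {x \<in> A. x * b / real p \<in> A}" for b
  have p0: "real p \<noteq> 0" using p by (simp add: prime_gt_0_nat)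
  obtain R where R: "finite R" "\<forall>x\<in>A. \<exists>r\<in>R. \<exists>y\<in>A. x = r + real p * y"
    using finite_residues_prime[OF p] by blast
  define good where "good b \<longleftrightarrow> b \<in> A \<and> ann b \<subseteq> P" for b
  define B where "B = {b. good b}"
  have good1: "good 1"
  proof -
    have "x \<in> P" if "x \<in> ann 1" for x
    proof -
      have "x / real p * real p \<in> P" using that by (intro P_mult p_in) (simp add: ann_def)
      then show ?thesis using p0 by simp
    qed
    then show ?thesis by (auto simp: good_def A_1)
  qed
  \<comment> \<open>An annihilator is a union of classes modulo p A, so its trace on the finite set
    \<open>R\<close> of representatives determines it and measures its size.\<close>
  define M where "M = Max ((\<lambda>b. card (ann b \<inter> R)) ` B)"
  have fin: "finite ((\<lambda>b. card (ann b \<inter> R)) ` B)"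
    by (rule finite_subset[of _ "{..card R}"]) (use R(1) in \<open>auto intro: card_mono\<close>)
  have "M \<in> (\<lambda>b. card (ann b \<inter> R)) ` B"
    unfolding M_def using fin good1 by (intro Max_in) (auto simp: B_def)
  then obtain b where b: "good b" "card (ann b \<inter> R) = M" by (auto simp: B_def)
  have bA: "b \<in> A" using b by (simp add: good_def)
  have maximal: "ann b' \<subseteq> ann b" if b': "good b'" "ann b \<subseteq> ann b'" for b'
  proof
    fix x assume x: "x \<in> ann b'"
    have "card (ann b' \<inter> R) \<le> M" unfolding M_def using fin b'(1) by (intro Max_ge) (auto simp: B_def)
    then have eq: "ann b \<inter> R = ann b' \<inter> R"
      using b(2) b'(2) R(1) by (intro card_seteq) auto
    obtain r y where ry: "r \<in> R" "y \<in> A" "x = r + real p * y" using R(2) x by (auto simp: ann_def)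
    have r: "r = x - real p * y" using ry by simp
    have iff: "r \<in> ann c \<longleftrightarrow> x \<in> ann c" if c: "c \<in> A" for c
    proof -
      have xA: "x \<in> A" using x by (simp add: ann_def)
      have rA: "r \<in> A" unfolding r by (intro A_diff A_mult A_nat xA ry)
      have yc: "y * c \<in> A" using ry c by (simp add: A_mult)
      have 1: "x * c / real p = r * c / real p + y * c"
        using p0 by (simp add: r field_simps)
      then have 2: "r * c / real p = x * c / real p - y * c" by simp
      have "r * c / real p \<in> A \<longleftrightarrow> x * c / real p \<in> A"
      proof
        assume "r * c / real p \<in> A"
        then show "x * c / real p \<in> A" unfolding 1 using yc by (rule A_add)
      next
        assume "x * c / real p \<in> A"
        then show "r * c / real p \<in> A" unfolding 2 using yc by (rule A_diff)
      qed
      then show ?thesis using rA xA by (simp add: ann_def)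
    qed
    show "x \<in> ann b" using iff[OF bA] iff[of b'] b'(1) x ry(1) eq by (auto simp: good_def)
  qed
  have "x \<in> ann b" if x: "x \<in> P" for x
  proof (rule ccontr)
    assume nx: "x \<notin> ann b"
    have xA: "x \<in> A" using x P_sub by blast
    have sub: "ann c \<subseteq> ann (w * c)" if "w \<in> A" for w c
      using A_mult[OF that] by (auto simp: ann_def) (metis mult.left_commute times_divide_eq_right)
    show False
    \<comment> \<open>If \<open>x * b\<close> is still a candidate, maximality makes multiplication
      by \<open>x\<close> injective modulo \<open>ann b\<close>, which the monic equation of
      \<open>x\<close> refutes. Otherwise some \<open>w\<close> outside \<open>P\<close> kills
      \<open>x * b\<close>; then \<open>w * b\<close> is a candidate whose annihilator contains
      \<open>x\<close>.\<close>
    proof (cases "ann (x * b) \<subseteq> P")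
      case True
      then have "good (x * b)" using xA bA by (simp add: good_def A_mult)
      then have xb: "ann (x * b) \<subseteq> ann b" using maximal sub[OF xA] by blast
      \<comment> \<open>The constant term lies in \<open>P\<close>, so p divides it and it
        annihilates \<open>b\<close>. Hence x times the remaining value lies in
        \<open>ann b\<close>, and by injectivity so does the remaining value. The leading
        coefficient 1 of the equation of \<open>x\<close> gives the contradiction.\<close>
      have "\<forall>i. int p dvd coeff f i" if "poly (map_poly of_int f) x \<in> ann b" for f
        using that
      proof (induction f)
        case (pCons a f)
        let ?y = "poly (map_poly of_int f) x"
        have yA: "?y \<in> A" using A_poly[OF xA] .
        have mem: "of_int a + x * ?y \<in> ann b" using pCons by (simp add: map_poly_pCons)
        then have "of_int a + x * ?y \<in> P" using b(1) by (auto simp: good_def)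
        moreover have "x * ?y \<in> P" using P_mult[OF yA x] by (simp add: mult.commute)
        ultimately have "of_int a \<in> P" using P_add[of "of_int a + x * ?y" "- (x * ?y)"] P_minus by simp
        then have pa: "int p dvd a" by (simp add: P_int)
        then obtain l where l: "a = int p * l" by (rule dvdE)
        have "?y * (x * b) / real p = (of_int a + x * ?y) * b / real p - of_int l * b"
          using p0 by (simp add: l field_simps)
        also have "\<dots> \<in> A" using mem bA by (intro A_diff A_mult A_int) (simp_all add: ann_def)
        finally have "?y \<in> ann (x * b)" using yA by (simp add: ann_def)
        then have "?y \<in> ann b" using xb by (rule subsetD[rotated])
        then show ?case using pCons.IH pa by (auto simp: coeff_pCons split: nat.split)
      qed simp
      moreover obtain f where f: "poly (map_poly of_int f) x = 0" "lead_coeff f = 1"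
        using xA by (auto simp: A_eq algebraic_int_altdef_ipoly)
      moreover have "0 \<in> ann b" by (simp add: ann_def A_0)
      ultimately have "int p dvd 1" by metis
      then show False using p by (simp add: not_prime_1)
    next
      case False
      then obtain w where w: "w \<in> ann (x * b)" "w \<notin> P" by blast
      have wA: "w \<in> A" using w by (simp add: ann_def)
      have "y \<in> P" if y: "y \<in> ann (w * b)" for y
      proof -
        have yA: "y \<in> A" using y by (simp add: ann_def)
        have "y * w \<in> ann b" using y A_mult[OF yA wA] by (simp add: ann_def mult.assoc)
        then have "y * w \<in> P" using b(1) by (auto simp: good_def)
        then show ?thesis using P_prime[OF yA wA] w(2) by blast
      qed
      then have "good (w * b)" using wA bA by (auto simp: good_def A_mult)
      then have "ann (w * b) \<subseteq> ann b" using maximal sub[OF wA] by blast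
      moreover have "x \<in> ann (w * b)" using w(1) xA by (simp add: ann_def algebra_simps)
      ultimately show False using nx by blast
    qed
  qed
  moreover have "b / real p \<notin> A"
  proof
    assume "b / real p \<in> A"
    then have "1 \<in> ann b" by (simp add: ann_def A_1)
    then show False using b(1) P_1 by (auto simp: good_def)
  qed
  ultimately show ?thesis using that[OF bA] by (auto simp: ann_def)
qed

text \<open>If g P were inside \<open>P\<close>, then p g^i would lie in \<open>P\<close> for every
  i by induction, and \<open>almost_integral\<close> would put g = b / p into
  \<open>A\<close>.\<close>

lemma uniformizer_exists:
  "\<exists>g \<pi>. g \<in> F \<and> g \<notin> A \<and> (\<forall>x\<in>P. g * x \<in> A) \<and> \<pi> \<in> P \<and> g * \<pi> \<notin> P"
proof -
  obtain b where b: "b \<in> A" "b / real p \<notin> A" "\<And>x. x \<in> P \<Longrightarrow> x * b / real p \<in> A"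
    by (rule annihilator_P) (rule that)
  let ?g = "b / real p"
  have gF: "?g \<in> F" using F_div[OF A_F[OF b(1)] A_F[OF A_nat]] .
  have gP: "?g * x \<in> A" if "x \<in> P" for x using b(3)[OF that] by (simp add: mult.commute)
  have "\<exists>\<pi>\<in>P. ?g * \<pi> \<notin> P"
  proof (rule ccontr)
    assume neg: "\<not> ?thesis"
    have "real p * ?g ^ i \<in> P" for i
    proof (induction i)
      case (Suc i)
      then have "?g * (real p * ?g ^ i) \<in> P" using neg by blast
      then show ?case by (simp add: mult.left_commute)
    qed (simp add: p_in)
    then have "real p * ?g ^ i \<in> A" for i using P_sub by blast
    from almost_integral[OF gF _ this] show False using b(2) p by (simp add: prime_gt_0_nat)
  qed
  then show ?thesis using gF b(2) gP by blast
qed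

definition g where "g = (SOME g. g \<in> F \<and> g \<notin> A \<and> (\<forall>x\<in>P. g * x \<in> A) \<and> (\<exists>\<pi>. \<pi> \<in> P \<and> g * \<pi> \<notin> P))"

text \<open>A local generator of \<open>P\<close>: since \<open>g * \<pi>\<close> lies in
  \<open>A\<close> but not in \<open>P\<close>, \<open>g\<close> acts as an inverse of \<pi> up to a
  unit at \<open>P\<close>.\<close>

definition \<pi> where "\<pi> = (SOME \<pi>. \<pi> \<in> P \<and> g * \<pi> \<notin> P)"

lemma g: "g \<in> F" "g \<notin> A" "x \<in> P \<Longrightarrow> g * x \<in> A"
  and \<pi>: "\<pi> \<in> P" "g * \<pi> \<notin> P"
proof -
  have 1: "g \<in> F \<and> g \<notin> A \<and> (\<forall>x\<in>P. g * x \<in> A) \<and> (\<exists>\<pi>. \<pi> \<in> P \<and> g * \<pi> \<notin> P)"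
    unfolding g_def by (rule someI_ex) (use uniformizer_exists in blast)
  have "\<pi> \<in> P \<and> g * \<pi> \<notin> P"
    unfolding \<pi>_def by (rule someI_ex) (use 1 in blast)
  with 1 show "g \<in> F" "g \<notin> A" "x \<in> P \<Longrightarrow> g * x \<in> A" "\<pi> \<in> P" "g * \<pi> \<notin> P" by blast+
qed

lemma \<pi>_A: "\<pi> \<in> A" using \<pi> P_sub by blast

lemma \<pi>_nonzero: "\<pi> \<noteq> 0"
proof
  assume "\<pi> = 0"
  moreover have "0 \<in> P" using P_mult[OF A_0 p_in] by simp
  ultimately show False using \<pi>(2) by (metis mult_zero_right)
qed

section \<open>Powers of P and the exponent at P\<close>

definition power_P :: "nat \<Rightarrow> real set" where
  "power_P n = P [^]\<^bsub>ideals_set (ring_of_type_algebra\<lparr>carrier := A\<rparr>)\<^esub> n"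

lemma power_P_0: "power_P 0 = A"
  by (simp add: power_P_def ideals_set_def)

lemma power_P_Suc: "power_P (Suc n) = ideal_prod (ring_of_type_algebra\<lparr>carrier := A\<rparr>) (power_P n) P"
  by (simp add: power_P_def ideals_set_def)

lemma power_P_prod: "x \<in> power_P n \<Longrightarrow> y \<in> P \<Longrightarrow> x * y \<in> power_P (Suc n)"
  using ideal_prod.prod[of x "power_P n" y P "ring_of_type_algebra\<lparr>carrier := A\<rparr>"]
  unfolding power_P_Suc by (simp add: ring_of_type_algebra_def)

lemma power_P_induct [consumes 1, case_names prod sum]:
  assumes "x \<in> power_P (Suc n)"
    and "\<And>x y. x \<in> power_P n \<Longrightarrow> y \<in> P \<Longrightarrow> Q (x * y)"
    and "\<And>x y. Q x \<Longrightarrow> Q y \<Longrightarrow> Q (x + y)"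
  shows "Q x"
  using assms(1)[unfolded power_P_Suc]
  by induction (use assms(2,3) in \<open>auto simp: ring_of_type_algebra_def\<close>)

lemma power_P_mult: "x \<in> power_P n \<Longrightarrow> a \<in> A \<Longrightarrow> a * x \<in> power_P n"
proof (induction n arbitrary: x)
  case (Suc n)
  show ?case using Suc.prems(1)
  proof (induction rule: power_P_induct)
    case (prod x y)
    have "(a * x) * y \<in> power_P (Suc n)"
      using Suc.IH[OF prod(1) Suc.prems(2)] prod(2) by (rule power_P_prod)
    then show ?case by (simp add: mult.assoc)
  next
    case (sum x y)
    then have "a * x + a * y \<in> power_P (Suc n)"
      using ideal_prod.sum[of "a * x" "ring_of_type_algebra\<lparr>carrier := A\<rparr>" "power_P n" P "a * y"]
      unfolding power_P_Suc by (simp add: ring_of_type_algebra_def)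
    then show ?case by (simp add: algebra_simps)
  qed
qed (simp add: power_P_0 A_mult)

lemma power_P_add: "x \<in> power_P n \<Longrightarrow> y \<in> power_P n \<Longrightarrow> x + y \<in> power_P n"
  using ideal_prod.sum[of x "ring_of_type_algebra\<lparr>carrier := A\<rparr>" "power_P _" P y]
  by (cases n) (simp_all add: power_P_0 power_P_Suc A_add ring_of_type_algebra_def)

lemma power_P_sub: "power_P n \<subseteq> A"
proof (induction n)
  case (Suc n)
  show ?case
  proof
    fix x assume "x \<in> power_P (Suc n)"
    then show "x \<in> A"
    proof (induction rule: power_P_induct)
      case (prod x y)
      then show ?case using Suc P_sub by (intro A_mult) auto
    qed (rule A_add)
  qed
qed (simp add: power_P_0)

text \<open>Each of the n factors from \<open>P\<close> absorbs one \<open>g\<close>. This is what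
  limits membership in powers of \<open>P\<close>.\<close>

lemma power_P_g: "x \<in> power_P n \<Longrightarrow> g ^ n * x \<in> A"
proof (induction n arbitrary: x)
  case (Suc n)
  show ?case using Suc.prems
  proof (induction rule: power_P_induct)
    case (prod x y)
    have "(g ^ n * x) * (g * y) \<in> A" using Suc.IH[OF prod(1)] g(3)[OF prod(2)] by (rule A_mult)
    then show ?case by (simp add: algebra_simps)
  next
    case (sum x y)
    then show ?case using A_add by (simp add: algebra_simps)
  qed
qed (simp add: power_P_0)

text \<open>A / P is a field. In the monic equation of \<open>w\<close>, constant terms divisible by
  p are dropped and \<open>w\<close> is cancelled, as \<open>P\<close> is prime. The first constant
  term prime to p is a multiple of \<open>w\<close> modulo \<open>P\<close>, and Bezout turns it
  into 1.\<close>

lemma unit_mod_P: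
  assumes w: "w \<in> A" "w \<notin> P"
  shows "\<exists>a\<in>A. \<exists>q\<in>P. w * a + q = 1"
proof -
  obtain f where f: "poly (map_poly of_int f) w = 0" "lead_coeff f = 1"
    using w by (auto simp: A_eq algebraic_int_altdef_ipoly)
  have zero_P: "0 \<in> P" using P_mult[OF A_0 p_in] by simp
  have "lead_coeff f = 1 \<Longrightarrow> poly (map_poly of_int f) w \<in> P \<Longrightarrow> ?thesis" for f :: "int poly"
  proof (induction f)
    case (pCons c f)
    let ?y = "poly (map_poly of_int f) w"
    have yA: "?y \<in> A" using A_poly[OF w(1)] .
    have mem: "of_int c + w * ?y \<in> P" using pCons.prems by (simp add: map_poly_pCons)
    show ?case
    proof (cases "int p dvd c")
      case True
      have "f \<noteq> 0"
      proof
        assume "f = 0"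
        then have "c = 1" using pCons.prems by simp
        then show False using True p by (metis not_prime_1 int_dvd_int_iff of_nat_1 nat_dvd_1_iff_1)
      qed
      have "of_int c \<in> P" using True by (simp add: P_int)
      then have "w * ?y \<in> P" using P_add[OF mem P_minus[of "of_int c"]] by simp
      then have "?y \<in> P" using P_prime[OF w(1) yA] w(2) by blast
      then show ?thesis using pCons \<open>f \<noteq> 0\<close> by simp
    next
      case False
      then have "coprime (int p) c" using p by (simp add: prime_imp_coprime)
      then obtain s t where "s * int p + t * c = 1" by (metis coprime_iff_gcd_eq_1 bezout_int)
      then have st: "real_of_int s * real p + of_int t * of_int c = 1"
        by (metis of_int_1 of_int_add of_int_mult of_int_of_nat_eq)
      have "w * (- of_int t * ?y) + (of_int s * real p + of_int t * (of_int c + w * ?y)) = 1"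
        using st by (simp add: algebra_simps)
      moreover have "- of_int t * ?y \<in> A" using A_mult[OF A_minus[OF A_int] yA] .
      moreover have "of_int s * real p + of_int t * (of_int c + w * ?y) \<in> P"
        using P_add[OF P_mult[OF A_int p_in] P_mult[OF A_int mem]] .
      ultimately show ?thesis by blast
    qed
  qed simp
  then show ?thesis using f zero_P by metis
qed

text \<open>In the product (w a + q) (w b + r) = 1 of the relations modulo P^n and modulo P, the
  only term without the factor w is q r, which lies in P^(n+1).\<close>

lemma unit_mod_power_P:
  assumes w: "w \<in> A" "w \<notin> P"
  shows "\<exists>a\<in>A. \<exists>q\<in>power_P n. w * a + q = 1"
proof (induction n)
  case 0
  show ?case by (rule bexI[of _ 0], rule bexI[of _ 1]) (simp_all add: power_P_0 A_0 A_1)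
next
  case (Suc n)
  then obtain a q where aq: "a \<in> A" "q \<in> power_P n" "w * a + q = 1" by blast
  obtain b r where br: "b \<in> A" "r \<in> P" "w * b + r = 1" using unit_mod_P[OF w] by blast
  have "(w * a + q) * (w * b + r) = 1" using aq br by simp
  then have "w * (a * (w * b + r) + q * b) + q * r = 1" by (simp add: algebra_simps)
  moreover have "q \<in> A" "r \<in> A" using aq br power_P_sub P_sub by blast+
  then have "a * (w * b + r) + q * b \<in> A" using aq br w by (intro A_add A_mult) auto
  ultimately show ?case using power_P_prod[OF aq(2) br(2)] by blast
qed

lemma \<pi>_power: "\<pi> ^ n \<in> power_P n"
proof (induction n)
  case (Suc n)
  then show ?case using power_P_prod[OF Suc \<pi>(1)] by (simp add: mult.commute)
qed (simp add: power_P_0 A_1)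

lemma A_P_mult: "x \<in> A - P \<Longrightarrow> y \<in> A - P \<Longrightarrow> x * y \<in> A - P"
  using P_prime A_mult by blast

text \<open>Localised at \<open>P\<close>, the ideal \<open>P ^ n\<close> is generated by \<open>\<pi> ^ n\<close>.\<close>

lemma mem_power_P_iff:
  assumes x: "x \<in> A"
  shows "x \<in> power_P n \<longleftrightarrow> (\<exists>w\<in>A - P. \<exists>y\<in>A. w * x = \<pi> ^ n * y)"
proof
  assume mem: "x \<in> power_P n"
  have u: "g * \<pi> \<in> A - P" using g \<pi> by blast
  \<comment> \<open>The witnesses are (g \<pi>)^n, a unit at \<open>P\<close>, and g^n x, which is
    integral by \<open>power_P_g\<close>.\<close>
  have "(g * \<pi>) ^ n \<in> A - P"
  proof (induction n)
    case (Suc n)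
    then show ?case using A_P_mult[OF u Suc] by simp
  qed (simp add: A_1 P_1)
  moreover have "(g * \<pi>) ^ n * x = \<pi> ^ n * (g ^ n * x)" by (simp add: power_mult_distrib)
  ultimately show "\<exists>w\<in>A - P. \<exists>y\<in>A. w * x = \<pi> ^ n * y" using power_P_g[OF mem] by blast
next
  assume "\<exists>w\<in>A - P. \<exists>y\<in>A. w * x = \<pi> ^ n * y"
  then obtain w y where wy: "w \<in> A" "w \<notin> P" "y \<in> A" "w * x = \<pi> ^ n * y" by blast
  \<comment> \<open>As \<open>w\<close> is invertible modulo P^n, \<open>x\<close> is
    \<open>a * w * x\<close>, a multiple of \<pi>^n, plus a multiple of some \<open>q\<close> in
    P^n.\<close>
  obtain a q where aq: "a \<in> A" "q \<in> power_P n" "w * a + q = 1" using unit_mod_power_P[OF wy(1,2)] by blast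
  have "x = (w * a + q) * x" using aq by simp
  also have "\<dots> = (a * y) * \<pi> ^ n + x * q" using wy(4) by (simp add: algebra_simps)
  also have "\<dots> \<in> power_P n"
    using power_P_add[OF power_P_mult[OF \<pi>_power A_mult[OF aq(1) wy(3)]] power_P_mult[OF aq(2) x]] .
  finally show "x \<in> power_P n" .
qed

text \<open>If x were in every P^n, all g^n x would be integral. A cofactor turning x into a nonzero
  integer k then makes all k g^n integral, so \<open>g\<close> would be in \<open>A\<close>.\<close>

lemma power_P_bounded:
  assumes x: "x \<in> A" "x \<noteq> 0"
  shows "\<exists>n. x \<notin> power_P n"
proof (rule ccontr)
  assume "\<not> ?thesis"
  then have xg: "g ^ n * x \<in> A" for n using power_P_g by blast
  obtain y k where yk: "y \<in> A" "k \<noteq> 0" "x * y = of_int k" by (rule integer_multiple[OF x])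
  have "real (nat \<bar>k\<bar>) * g ^ n \<in> A" for n
  proof -
    have "g ^ n * x * y \<in> A" using A_mult[OF xg yk(1)] .
    then have "of_int k * g ^ n \<in> A" by (simp add: yk(3)[symmetric] ac_simps)
    then show ?thesis using A_minus[of "of_int k * g ^ n"] by (cases "k \<ge> 0") (auto simp: of_nat_nat)
  qed
  from almost_integral[OF g(1) _ this] show False using yk g(2) by simp
qed

text \<open>Let P^k be the power just before the first one that misses x. If the cofactor
  \<open>y\<close> were in \<open>P\<close>, multiplying by g \<pi> would trade \<open>y\<close> for
  \<open>g * y\<close> and gain a factor \<pi>, putting x into P^(k+1).\<close>

lemma exponent_exists:
  assumes x: "x \<in> A" "x \<noteq> 0"
  shows "\<exists>n. \<exists>w\<in>A - P. \<exists>y\<in>A - P. w * x = \<pi> ^ n * y"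
proof -
  define n where "n = (LEAST n. x \<notin> power_P n)"
  have n: "x \<notin> power_P n" unfolding n_def using power_P_bounded[OF x] by (rule LeastI_ex)
  have "n \<noteq> 0"
  proof
    assume "n = 0"
    then show False using n x by (simp add: power_P_0)
  qed
  then obtain k where k: "n = Suc k" using not0_implies_Suc by blast
  have "x \<in> power_P k" using not_less_Least[of k "\<lambda>n. x \<notin> power_P n"] k n_def by simp
  then obtain w y where wy: "w \<in> A - P" "y \<in> A" "w * x = \<pi> ^ k * y" using mem_power_P_iff[OF x(1)] by blast
  have "y \<notin> P"
  proof
    assume y: "y \<in> P"
    have u: "g * \<pi> \<in> A - P" using g \<pi> by blast
    have "(g * \<pi> * w) * x = \<pi> ^ Suc k * (g * y)" using wy(3) by (simp add: algebra_simps)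
    then have "x \<in> power_P n" using mem_power_P_iff[OF x(1)] A_P_mult[OF u wy(1)] g(3)[OF y] k by blast
    then show False using n by simp
  qed
  then show ?thesis using wy by blast
qed

text \<open>Two local expressions of \<open>x\<close> are compared and \<pi>^n is cancelled: for k >
  n the unit \<open>w' * y\<close> would be a multiple of \<pi> and so lie in
  \<open>P\<close>.\<close>

lemma mem_power_P_le:
  assumes w: "w \<in> A - P" and y: "y \<in> A - P" and x: "x \<in> A" and eq: "w * x = \<pi> ^ n * y"
    and mem: "x \<in> power_P k"
  shows "k \<le> n"
proof (rule ccontr)
  assume "\<not> k \<le> n"
  then have k: "k = n + Suc (k - Suc n)" by simp
  obtain w' y' where wy: "w' \<in> A - P" "y' \<in> A" "w' * x = \<pi> ^ k * y'"
    using mem mem_power_P_iff[OF x] by blast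
  have pk: "\<pi> ^ k = \<pi> ^ n * (\<pi> ^ (k - Suc n) * \<pi>)" by (subst k) (simp add: power_add)
  have "\<pi> ^ n * (w' * y) = w' * (w * x)" by (simp add: eq)
  also have "\<dots> = w * (w' * x)" by simp
  also have "\<dots> = \<pi> ^ n * (w * y' * \<pi> ^ (k - Suc n) * \<pi>)" by (simp add: wy(3) pk)
  finally have "w' * y = w * y' * \<pi> ^ (k - Suc n) * \<pi>" using \<pi>_nonzero by simp
  moreover have "w * y' * \<pi> ^ (k - Suc n) * \<pi> \<in> P"
    using w wy \<pi>_A by (intro P_mult \<pi>(1) A_mult A_power) auto
  ultimately show False using A_P_mult[OF wy(1) y] by simp
qed

lemma exponent_eqI:
  assumes w: "w \<in> A - P" and y: "y \<in> A - P" and x: "x \<in> A" and eq: "w * x = \<pi> ^ n * y"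
  shows "(GREATEST n. x \<in> power_P n) = n"
  using mem_power_P_iff[OF x] w y eq mem_power_P_le[OF assms] by (intro Greatest_equality) blast+

definition exponent :: "real \<Rightarrow> nat" where
  "exponent x = (GREATEST n. x \<in> power_P n)"

lemma exponentE:
  assumes "x \<in> A" "x \<noteq> 0"
  obtains w y where "w \<in> A - P" "y \<in> A - P" "w * x = \<pi> ^ exponent x * y"
  using exponent_exists[OF assms] exponent_eqI[OF _ _ assms(1)] unfolding exponent_def by blast

lemma exponent_mult:
  assumes x: "x \<in> A" "x \<noteq> 0" and y: "y \<in> A" "y \<noteq> 0"
  shows "exponent (x * y) = exponent x + exponent y"
proof -
  obtain w1 z1 where 1: "w1 \<in> A - P" "z1 \<in> A - P" "w1 * x = \<pi> ^ exponent x * z1" by (rule exponentE[OF x])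
  obtain w2 z2 where 2: "w2 \<in> A - P" "z2 \<in> A - P" "w2 * y = \<pi> ^ exponent y * z2" by (rule exponentE[OF y])
  have "w1 * w2 * (x * y) = (w1 * x) * (w2 * y)" by simp
  also have "\<dots> = \<pi> ^ (exponent x + exponent y) * (z1 * z2)" by (simp add: 1 2 power_add)
  finally show ?thesis unfolding exponent_def[of "x * y"]
    using A_P_mult[OF 1(1) 2(1)] A_P_mult[OF 1(2) 2(2)] A_mult[OF x(1) y(1)] by (intro exponent_eqI)
qed

lemma exponent_ge_iff:
  assumes x: "x \<in> A" "x \<noteq> 0"
  shows "n \<le> exponent x \<longleftrightarrow> x \<in> power_P n"
proof
  assume n: "n \<le> exponent x"
  obtain w y where wy: "w \<in> A - P" "y \<in> A - P" "w * x = \<pi> ^ exponent x * y" by (rule exponentE[OF x])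
  have "w * x = \<pi> ^ n * (\<pi> ^ (exponent x - n) * y)" using wy(3) n by (simp add: mult.assoc[symmetric] power_add[symmetric])
  moreover have "\<pi> ^ (exponent x - n) * y \<in> A" using wy by (intro A_mult A_power \<pi>_A) auto
  ultimately show "x \<in> power_P n" using mem_power_P_iff[OF x(1)] wy(1) by blast
next
  assume n: "x \<in> power_P n"
  obtain w y where wy: "w \<in> A - P" "y \<in> A - P" "w * x = \<pi> ^ exponent x * y" by (rule exponentE[OF x])
  show "n \<le> exponent x" using mem_power_P_le[OF wy(1,2) x(1) wy(3) n] .
qed

lemma exponent_add:
  assumes x: "x \<in> A" "x \<noteq> 0" and y: "y \<in> A" "y \<noteq> 0" and xy: "x + y \<noteq> 0"
  shows "min (exponent x) (exponent y) \<le> exponent (x + y)"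
proof -
  let ?n = "min (exponent x) (exponent y)"
  have "x \<in> power_P ?n" "y \<in> power_P ?n"
    using exponent_ge_iff[OF x, of ?n] exponent_ge_iff[OF y, of ?n] by simp_all
  then show ?thesis using exponent_ge_iff[OF A_add[OF x(1) y(1)] xy] power_P_add by blast
qed

lemma exponent_unit:
  assumes "x \<in> A - P"
  shows "exponent x = 0"
  unfolding exponent_def
  using exponent_eqI[of 1 x x 0] assms A_1 P_1 by simp

lemma exponent_P:
  assumes "x \<in> P" "x \<noteq> 0"
  shows "exponent x > 0"
proof -
  have "x \<in> power_P 1" using power_P_prod[of 1 0 x] assms A_1 by (simp add: power_P_0)
  then show ?thesis using exponent_ge_iff[of x 1] assms P_sub by auto
qed

lemma exponent_power: "x \<in> A \<Longrightarrow> x \<noteq> 0 \<Longrightarrow> exponent (x ^ n) = n * exponent x"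
proof (induction n)
  case (Suc n)
  then show ?case using exponent_mult[of x "x ^ n"] A_power by simp
qed (simp add: exponent_unit A_1 P_1)

text \<open>The part of \<open>k\<close> prime to p is outside \<open>P\<close>, so only the power
  of p counts. Hence the P-adic valuation extends e times the p-adic one.\<close>

lemma exponent_int:
  assumes "k \<noteq> 0"
  shows "exponent (of_int k) = multiplicity (int p) k * exponent (real p)"
proof -
  have np: "\<not> is_unit (int p)" using p by (metis not_prime_1 int_dvd_int_iff of_nat_1 nat_dvd_1_iff_1)
  define l where "l = k div int p ^ multiplicity (int p) k"
  have k: "k = int p ^ multiplicity (int p) k * l" unfolding l_def by (simp add: multiplicity_dvd)
  have "\<not> int p dvd l" unfolding l_def using multiplicity_decompose[OF assms np] by simp
  then have l: "of_int l \<in> A - P" by (simp add: P_int A_int)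
  have "l \<noteq> 0" using k assms by auto
  have p0: "real p \<noteq> 0" using p by (simp add: prime_gt_0_nat)
  have "exponent (of_int k) = exponent (real p ^ multiplicity (int p) k * of_int l)"
    using arg_cong[OF k, of real_of_int] by simp
  also have "\<dots> = multiplicity (int p) k * exponent (real p) + 0"
    using exponent_mult[OF A_power[OF A_nat] _ A_int] exponent_power[OF A_nat p0] p0 \<open>l \<noteq> 0\<close> exponent_unit[OF l]
    by simp
  finally show ?thesis by simp
qed

end


section \<open>Completions\<close>

lemma tendsto_PInfty_nat:
  "(f \<longlonglongrightarrow> (\<infinity>::ereal)) \<longleftrightarrow> (\<forall>N::nat. \<exists>n0. \<forall>n\<ge>n0. ereal (real N) \<le> f n)"
proof
  assume "f \<longlonglongrightarrow> \<infinity>"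
  then show "\<forall>N::nat. \<exists>n0. \<forall>n\<ge>n0. ereal (real N) \<le> f n"
    unfolding tendsto_PInfty eventually_sequentially by (meson less_imp_le)
next
  assume N: "\<forall>N::nat. \<exists>n0. \<forall>n\<ge>n0. ereal (real N) \<le> f n"
  show "f \<longlonglongrightarrow> \<infinity>"
    unfolding tendsto_PInfty
  proof
    fix r :: real
    obtain M :: nat where "r < real M" using reals_Archimedean2 by blast
    moreover from N obtain n0 where "\<forall>n\<ge>n0. ereal (real M) \<le> f n" by blast
    ultimately have "\<forall>n\<ge>n0. ereal r < f n" by (metis less_ereal.simps(1) less_le_trans)
    then show "\<forall>\<^sub>F n in sequentially. ereal r < f n" by (auto simp: eventually_sequentially)
  qed
qed

text \<open>Instantiated twice: with the rationals and \<open>padic_val p\<close>, and with K and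
  \<open>prime_val\<close>. The carrier is a set because K is only a subset of the reals.\<close>

locale valued_field =
  fixes F :: "'a::field set" and v :: "'a \<Rightarrow> ereal"
  assumes F_1: "1 \<in> F" and F_add: "\<And>x y. x \<in> F \<Longrightarrow> y \<in> F \<Longrightarrow> x + y \<in> F"
    and F_minus: "\<And>x. x \<in> F \<Longrightarrow> - x \<in> F"
    and F_mult: "\<And>x y. x \<in> F \<Longrightarrow> y \<in> F \<Longrightarrow> x * y \<in> F"
    and v_0: "v 0 = \<infinity>" and v_finite: "\<And>x. x \<in> F \<Longrightarrow> x \<noteq> 0 \<Longrightarrow> \<exists>r. v x = ereal r"
    and v_mult: "\<And>x y. x \<in> F \<Longrightarrow> y \<in> F \<Longrightarrow> v (x * y) = v x + v y"
    and v_add: "\<And>x y. x \<in> F \<Longrightarrow> y \<in> F \<Longrightarrow> min (v x) (v y) \<le> v (x + y)"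
begin

abbreviation R :: "'a ring" where "R \<equiv> ring_of_type_algebra\<lparr>carrier := F\<rparr>"
abbreviation C :: "(nat \<Rightarrow> 'a) ring" where "C \<equiv> cauchy_ring R v"
abbreviation Null :: "(nat \<Rightarrow> 'a) set" where "Null \<equiv> null_seqs R v"
abbreviation cls :: "(nat \<Rightarrow> 'a) \<Rightarrow> (nat \<Rightarrow> 'a) set" where "cls s \<equiv> Null +>\<^bsub>C\<^esub> s"
abbreviation val :: "(nat \<Rightarrow> 'a) set \<Rightarrow> ereal" where "val \<equiv> completion_val R v"

lemma F_0: "0 \<in> F"
  using F_add[OF F_1 F_minus[OF F_1]] by simp

lemma F_diff: "x \<in> F \<Longrightarrow> y \<in> F \<Longrightarrow> x - y \<in> F"
  using F_add[of x "- y"] F_minus by simp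

lemma F_power: "x \<in> F \<Longrightarrow> x ^ n \<in> F"
  by (induction n) (simp_all add: F_1 F_mult)

lemma v_1: "v 1 = 0"
proof -
  obtain r where "v 1 = ereal r" using v_finite[OF F_1] by auto
  then show ?thesis using v_mult[OF F_1 F_1] by (simp add: zero_ereal_def)
qed

lemma v_neg: "x \<in> F \<Longrightarrow> v (- x) = v x"
proof -
  assume x: "x \<in> F"
  obtain r where r: "v (- 1) = ereal r" using v_finite[OF F_minus[OF F_1]] by auto
  then have "v (- 1) = 0" using v_mult[OF F_minus[OF F_1] F_minus[OF F_1]] v_1 by (simp add: zero_ereal_def)
  then show ?thesis using v_mult[OF F_minus[OF F_1] x] by simp
qed

lemma v_diff: "x \<in> F \<Longrightarrow> y \<in> F \<Longrightarrow> min (v x) (v y) \<le> v (x - y)"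
  using v_add[of x "- y"] F_minus v_neg by simp

lemma v_minus_commute: "x \<in> F \<Longrightarrow> y \<in> F \<Longrightarrow> v (x - y) = v (y - x)"
  using v_neg[OF F_diff, of x y] by simp

lemma v_add_eq:
  assumes x: "x \<in> F" and y: "y \<in> F" and less: "v x < v y"
  shows "v (x + y) = v x"
proof (rule antisym)
  show "v x \<le> v (x + y)" using v_add[OF x y] less by simp
  have "min (v (x + y)) (v y) \<le> v x" using v_diff[OF F_add[OF x y] y] by simp
  then show "v (x + y) \<le> v x" using less by (auto simp: min_def split: if_splits)
qed

lemma v_not_MInfty: "x \<in> F \<Longrightarrow> v x \<noteq> - \<infinity>"
  using v_0 v_finite[of x] by (cases "x = 0") auto

lemma v_power: "x \<in> F \<Longrightarrow> v (x ^ n) = ereal (real n) * v x" if "n > 0" for n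
  using that
proof (induction n)
  case (Suc n)
  show ?case
  proof (cases "n = 0")
    case False
    then have "v (x ^ Suc n) = v x + ereal (real n) * v x"
      using Suc v_mult[OF Suc.prems(1) F_power[OF Suc.prems(1)], of n] by simp
    also have "\<dots> = ereal (real (Suc n)) * v x"
      using v_not_MInfty[OF Suc.prems(1)] False by (cases "v x") (auto simp: algebra_simps)
    finally show ?thesis .
  qed (simp add: one_ereal_def[symmetric])
qed simp

lemma v_nonneg_mult: "x \<in> F \<Longrightarrow> y \<in> F \<Longrightarrow> v x \<ge> 0 \<Longrightarrow> v y \<ge> 0 \<Longrightarrow> v (x * y) \<ge> 0"
  by (simp add: v_mult)

lemma v_sum_ge: "finite S \<Longrightarrow> (\<And>i. i \<in> S \<Longrightarrow> g i \<in> F \<and> b \<le> v (g i)) \<Longrightarrow> sum g S \<in> F \<and> b \<le> v (sum g S)"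
proof (induction S rule: finite_induct)
  case (insert i S)
  then have 1: "sum g S \<in> F" "b \<le> v (sum g S)" "g i \<in> F" "b \<le> v (g i)" by auto
  then have "b \<le> v (g i + sum g S)" using v_add[of "g i" "sum g S"] by (meson min.boundedI order_trans)
  then show ?case using insert 1 by (simp add: F_add)
qed (simp add: v_0 F_0)

lemma cring_R: "cring R"
proof (intro cringI abelian_groupI comm_monoidI)
  fix x assume "x \<in> carrier R"
  then show "\<exists>y\<in>carrier R. y \<oplus>\<^bsub>R\<^esub> x = \<zero>\<^bsub>R\<^esub>"
    using F_minus by (auto simp: ring_of_type_algebra_def intro!: bexI[of _ "- x"])
qed (auto simp: ring_of_type_algebra_def F_0 F_1 F_add F_mult algebra_simps)

lemma R_minus: "x \<in> F \<Longrightarrow> y \<in> F \<Longrightarrow> x \<ominus>\<^bsub>R\<^esub> y = x - y"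
proof -
  assume x: "x \<in> F" and y: "y \<in> F"
  interpret R: cring R by (rule cring_R)
  have "\<ominus>\<^bsub>R\<^esub> y = - y"
    by (rule R.minus_equality) (use y F_minus in \<open>simp_all add: ring_of_type_algebra_def\<close>)
  then show ?thesis by (simp add: a_minus_def ring_of_type_algebra_def)
qed

section \<open>The ring of Cauchy sequences and its null ideal\<close>

definition cauchy :: "(nat \<Rightarrow> 'a) \<Rightarrow> bool" where
  "cauchy s \<longleftrightarrow> (\<forall>n. s n \<in> F) \<and> (\<forall>N::nat. \<exists>n0. \<forall>m\<ge>n0. \<forall>n\<ge>n0. ereal (real N) \<le> v (s m - s n))"

lemma carrier_C: "carrier C = {s. cauchy s}"
proof -
  have "(range s \<subseteq> carrier R \<and> (\<forall>N::nat. \<exists>n0. \<forall>m\<ge>n0. \<forall>n\<ge>n0. v (s m \<ominus>\<^bsub>R\<^esub> s n) \<ge> ereal (real N))) = cauchy s" for s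
  proof (cases "range s \<subseteq> F")
    case True
    then have "s n \<in> F" for n by blast
    then show ?thesis using True by (simp add: cauchy_def R_minus)
  qed (auto simp: cauchy_def)
  then show ?thesis by (simp add: cauchy_ring_def)
qed

lemma C_ops: "s \<otimes>\<^bsub>C\<^esub> t = (\<lambda>n. s n * t n)" "s \<oplus>\<^bsub>C\<^esub> t = (\<lambda>n. s n + t n)"
  "\<one>\<^bsub>C\<^esub> = (\<lambda>_. 1)" "\<zero>\<^bsub>C\<^esub> = (\<lambda>_. 0)"
  by (simp_all add: cauchy_ring_def ring_of_type_algebra_def)

lemma cauchyD: "cauchy s \<Longrightarrow> s n \<in> F"
  by (simp add: cauchy_def)

lemma cauchy_const: "x \<in> F \<Longrightarrow> cauchy (\<lambda>_. x)"
  by (simp add: cauchy_def v_0)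

lemma cauchy_add:
  assumes s: "cauchy s" and t: "cauchy t"
  shows "cauchy (\<lambda>n. s n + t n)"
  unfolding cauchy_def
proof (intro conjI allI)
  show "s n + t n \<in> F" for n using s t by (simp add: cauchy_def F_add)
  fix N :: nat
  obtain n0 where n0: "\<And>m n. m \<ge> n0 \<Longrightarrow> n \<ge> n0 \<Longrightarrow> ereal (real N) \<le> v (s m - s n)" using s unfolding cauchy_def by blast
  obtain n1 where n1: "\<And>m n. m \<ge> n1 \<Longrightarrow> n \<ge> n1 \<Longrightarrow> ereal (real N) \<le> v (t m - t n)" using t unfolding cauchy_def by blast
  have "ereal (real N) \<le> v ((s m + t m) - (s n + t n))" if "m \<ge> max n0 n1" "n \<ge> max n0 n1" for m n
  proof -
    have "(s m + t m) - (s n + t n) = (s m - s n) + (t m - t n)" by simp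
    moreover have "min (v (s m - s n)) (v (t m - t n)) \<le> v ((s m - s n) + (t m - t n))"
      using cauchyD[OF s] cauchyD[OF t] by (intro v_add F_diff)
    ultimately show ?thesis using n0[of m n] n1[of m n] that by (metis max.boundedE min.boundedI order_trans)
  qed
  then show "\<exists>n0. \<forall>m\<ge>n0. \<forall>n\<ge>n0. ereal (real N) \<le> v ((s m + t m) - (s n + t n))" by blast
qed

lemma cauchy_minus: "cauchy s \<Longrightarrow> cauchy (\<lambda>n. - s n)"
proof -
  assume s: "cauchy s"
  have "v (- s m - - s n) = v (s m - s n)" for m n
    using v_minus_commute[OF cauchyD[OF s, of n] cauchyD[OF s, of m]] by simp
  then show ?thesis using s unfolding cauchy_def by (simp add: F_minus del: minus_diff_minus diff_minus_eq_add)
qed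

lemma cauchy_diff: "cauchy s \<Longrightarrow> cauchy t \<Longrightarrow> cauchy (\<lambda>n. s n - t n)"
  using cauchy_add[of s "\<lambda>n. - t n"] cauchy_minus by simp

lemma cauchy_bounded:
  assumes s: "cauchy s"
  shows "\<exists>B n0. \<forall>n\<ge>n0. ereal (- real B) \<le> v (s n)"
proof -
  obtain n0 where n0: "\<And>m n. m \<ge> n0 \<Longrightarrow> n \<ge> n0 \<Longrightarrow> ereal (real 0) \<le> v (s m - s n)" using s unfolding cauchy_def by blast
  obtain B :: nat where B: "ereal (- real B) \<le> v (s n0)"
  proof (cases "v (s n0)")
    case (real r)
    obtain B :: nat where "- r < real B" using reals_Archimedean2 by blast
    then show ?thesis using that[of B] real by simp
  next
    case PInf
    then show ?thesis using that by simp
  next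
    case MInf
    then show ?thesis using v_not_MInfty[OF cauchyD[OF s]] by blast
  qed
  have "ereal (- real B) \<le> v (s n)" if "n \<ge> n0" for n
  proof -
    have "min (v (s n0)) (v (s n - s n0)) \<le> v (s n0 + (s n - s n0))"
      using cauchyD[OF s] by (intro v_add F_diff)
    moreover have "ereal (- real B) \<le> v (s n - s n0)"
      using n0[OF that order_refl] by (rule order_trans[rotated]) simp
    ultimately show ?thesis using B by (simp add: min_def split: if_splits)
  qed
  then show ?thesis by blast
qed

lemma v_mult_ge:
  assumes "x \<in> F" "y \<in> F" "ereal a \<le> v x" "ereal b \<le> v y"
  shows "ereal (a + b) \<le> v (x * y)"
  using add_mono[OF assms(3,4)] by (simp add: v_mult assms)

lemma cauchy_mult:
  assumes s: "cauchy s" and t: "cauchy t"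
  shows "cauchy (\<lambda>n. s n * t n)"
  unfolding cauchy_def
proof (intro conjI allI)
  show "s n * t n \<in> F" for n using s t by (simp add: cauchy_def F_mult)
  fix N :: nat
  obtain B1 k1 where B1: "\<And>n. n \<ge> k1 \<Longrightarrow> ereal (- real B1) \<le> v (s n)" using cauchy_bounded[OF s] by blast
  obtain B2 k2 where B2: "\<And>n. n \<ge> k2 \<Longrightarrow> ereal (- real B2) \<le> v (t n)" using cauchy_bounded[OF t] by blast
  \<comment> \<open>The thresholds are raised by \<open>B2\<close> and \<open>B1\<close> to offset
    the possibly negative bounds on the factors in s m (t m - t n) + t n (s m - s n).\<close>
  obtain n0 where n0: "\<And>m n. m \<ge> n0 \<Longrightarrow> n \<ge> n0 \<Longrightarrow> ereal (real (N + B2)) \<le> v (s m - s n)"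
    using s unfolding cauchy_def by blast
  obtain n1 where n1: "\<And>m n. m \<ge> n1 \<Longrightarrow> n \<ge> n1 \<Longrightarrow> ereal (real (N + B1)) \<le> v (t m - t n)"
    using t unfolding cauchy_def by blast
  let ?M = "max (max k1 k2) (max n0 n1)"
  have "ereal (real N) \<le> v (s m * t m - s n * t n)" if mn: "m \<ge> ?M" "n \<ge> ?M" for m n
  proof -
    have F: "s m \<in> F" "s n \<in> F" "t m \<in> F" "t n \<in> F" using cauchyD s t by auto
    have "ereal (- real B1 + real (N + B1)) \<le> v (s m * (t m - t n))"
      using mn by (intro v_mult_ge B1 n1 F F_diff) auto
    moreover have "ereal (- real B2 + real (N + B2)) \<le> v (t n * (s m - s n))"
      using mn by (intro v_mult_ge B2 n0 F F_diff) auto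
    moreover have "min (v (s m * (t m - t n))) (v (t n * (s m - s n))) \<le> v (s m * (t m - t n) + t n * (s m - s n))"
      using F by (intro v_add F_mult F_diff)
    moreover have "s m * (t m - t n) + t n * (s m - s n) = s m * t m - s n * t n" by (simp add: algebra_simps)
    ultimately show ?thesis by (simp add: min_def split: if_splits)
  qed
  then show "\<exists>n0. \<forall>m\<ge>n0. \<forall>n\<ge>n0. ereal (real N) \<le> v (s m * t m - s n * t n)" by blast
qed

lemma cring_C: "cring C"
proof (intro cringI abelian_groupI comm_monoidI)
  fix x assume "x \<in> carrier C"
  then show "\<exists>y\<in>carrier C. y \<oplus>\<^bsub>C\<^esub> x = \<zero>\<^bsub>C\<^esub>"
    by (intro bexI[of _ "\<lambda>n. - x n"]) (auto simp: carrier_C C_ops cauchy_minus)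
qed (auto simp: carrier_C C_ops algebra_simps intro!: cauchy_add cauchy_mult cauchy_const F_0 F_1)

sublocale C: cring C by (rule cring_C)

lemma C_minus:
  assumes "cauchy s" "cauchy t"
  shows "\<ominus>\<^bsub>C\<^esub> t = (\<lambda>n. - t n)" "s \<ominus>\<^bsub>C\<^esub> t = (\<lambda>n. s n - t n)"
proof -
  show *: "\<ominus>\<^bsub>C\<^esub> t = (\<lambda>n. - t n)"
    by (rule C.minus_equality) (use assms cauchy_minus in \<open>simp_all add: C_ops carrier_C\<close>)
  show "s \<ominus>\<^bsub>C\<^esub> t = (\<lambda>n. s n - t n)"
    by (simp add: a_minus_def * C_ops)
qed

lemma Null_iff: "s \<in> Null \<longleftrightarrow> cauchy s \<and> (\<lambda>n. v (s n)) \<longlonglongrightarrow> \<infinity>"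
  by (simp add: null_seqs_def carrier_C)

lemma Null_add:
  assumes "s \<in> Null" "t \<in> Null"
  shows "(\<lambda>n. s n + t n) \<in> Null"
proof -
  have F: "s n \<in> F" "t n \<in> F" for n using assms by (auto simp: Null_iff cauchy_def)
  have "\<exists>n0. \<forall>n\<ge>n0. ereal (real N) \<le> v (s n + t n)" for N
  proof -
    obtain n0 n1 where "\<And>n. n \<ge> n0 \<Longrightarrow> ereal (real N) \<le> v (s n)" "\<And>n. n \<ge> n1 \<Longrightarrow> ereal (real N) \<le> v (t n)"
      using assms unfolding Null_iff tendsto_PInfty_nat by meson
    then have "ereal (real N) \<le> v (s n + t n)" if "n \<ge> max n0 n1" for n
      using v_add[OF F(1) F(2), of n n] that by (meson max.boundedE min.boundedI order_trans)
    then show ?thesis by blast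
  qed
  then show ?thesis using assms by (simp add: Null_iff tendsto_PInfty_nat cauchy_add)
qed

lemma Null_minus: "s \<in> Null \<Longrightarrow> (\<lambda>n. - s n) \<in> Null"
  by (simp add: Null_iff cauchy_minus v_neg cauchyD)

lemma Null_mult:
  assumes s: "cauchy s" and t: "t \<in> Null"
  shows "(\<lambda>n. s n * t n) \<in> Null"
proof -
  have t': "cauchy t" using t by (simp add: Null_iff)
  obtain B k where B: "\<And>n. n \<ge> k \<Longrightarrow> ereal (- real B) \<le> v (s n)" using cauchy_bounded[OF s] by blast
  have "\<exists>n0. \<forall>n\<ge>n0. ereal (real N) \<le> v (s n * t n)" for N
  proof -
    obtain n0 where n0: "\<And>n. n \<ge> n0 \<Longrightarrow> ereal (real (N + B)) \<le> v (t n)"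
      using t unfolding Null_iff tendsto_PInfty_nat by blast
    have "ereal (- real B + real (N + B)) \<le> v (s n * t n)" if "n \<ge> max k n0" for n
      using that by (intro v_mult_ge B n0 cauchyD[OF s] cauchyD[OF t']) auto
    then show ?thesis by (intro exI[of _ "max k n0"]) simp
  qed
  then show ?thesis using s t' by (simp add: Null_iff tendsto_PInfty_nat cauchy_mult)
qed

lemma ideal_Null: "ideal Null C"
proof (rule idealI)
  show "subgroup Null (add_monoid C)"
  proof
    show "inv\<^bsub>add_monoid C\<^esub> x \<in> Null" if "x \<in> Null" for x
      unfolding a_inv_def[symmetric] using C_minus(1)[of x x] Null_minus[OF that] that by (simp add: Null_iff)
  qed (auto simp: carrier_C C_ops Null_add Null_iff[of "\<lambda>_. 0"] cauchy_const F_0 v_0 Null_iff[THEN iffD1] dest: Null_iff[THEN iffD1])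
  show "x \<otimes>\<^bsub>C\<^esub> a \<in> Null" "a \<otimes>\<^bsub>C\<^esub> x \<in> Null" if "a \<in> Null" "x \<in> carrier C" for a x
    using Null_mult[of x a] that by (simp_all add: carrier_C C_ops mult.commute)
qed (rule C.ring_axioms)

sublocale Null: ideal Null C by (rule ideal_Null)

lemma mem_cls:
  assumes "cauchy s"
  shows "t \<in> cls s \<longleftrightarrow> cauchy t \<and> (\<lambda>n. t n - s n) \<in> Null"
proof
  assume "t \<in> cls s"
  then obtain u where "u \<in> Null" "t = (\<lambda>n. u n + s n)" by (auto simp: a_r_coset_def' C_ops)
  then show "cauchy t \<and> (\<lambda>n. t n - s n) \<in> Null" using assms by (simp add: Null_iff cauchy_add)
next
  assume t: "cauchy t \<and> (\<lambda>n. t n - s n) \<in> Null"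
  have "t = (\<lambda>n. (t n - s n) + s n)" by simp
  then show "t \<in> cls s" using t by (force simp: a_r_coset_def' C_ops)
qed

lemma cls_self: "cauchy s \<Longrightarrow> s \<in> cls s"
  by (simp add: mem_cls Null_iff cauchy_const F_0 v_0)

lemma cls_eqI:
  assumes s: "cauchy s" and t: "cauchy t" and st: "(\<lambda>n. t n - s n) \<in> Null"
  shows "cls s = cls t"
proof -
  have "(\<lambda>n. x n - s n) \<in> Null \<longleftrightarrow> (\<lambda>n. x n - t n) \<in> Null" for x
    using Null_add[OF _ st, of "\<lambda>n. x n - t n"] Null_add[OF _ Null_minus[OF st], of "\<lambda>n. x n - s n"]
    by auto
  then show ?thesis using mem_cls[OF s] mem_cls[OF t] by blast
qed

section \<open>The valuation and limits in the completion\<close>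

lemma completion_cases:
  assumes "x \<in> carrier (completion R v)"
  obtains s where "cauchy s" "x = cls s"
  using assms by (auto simp: completion_def FactRing_def A_RCOSETS_def' carrier_C)

lemma cls_closed: "cauchy s \<Longrightarrow> cls s \<in> carrier (completion R v)"
  by (auto simp: completion_def FactRing_def A_RCOSETS_def' carrier_C)

text \<open>Outside the null ideal some N exceeds the valuation infinitely often, while late
  differences have valuation at least N. The strict ultrametric rule then makes the valuation
  constant from there on.\<close>

lemma val_limit_cases:
  assumes s: "cauchy s" and nN: "s \<notin> Null"
  obtains r n0 where "\<And>n. n \<ge> n0 \<Longrightarrow> v (s n) = ereal r"
proof -
  have "\<not> (\<forall>N::nat. \<exists>n0. \<forall>n\<ge>n0. ereal (real N) \<le> v (s n))"
    using s nN by (simp add: Null_iff tendsto_PInfty_nat)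
  then obtain N :: nat where N: "\<And>n0. \<exists>n\<ge>n0. v (s n) < ereal (real N)" by (auto simp: not_le)
  obtain n0 where n0: "\<And>m n. m \<ge> n0 \<Longrightarrow> n \<ge> n0 \<Longrightarrow> ereal (real N) \<le> v (s m - s n)"
    using s unfolding cauchy_def by blast
  obtain n1 where n1: "n1 \<ge> n0" "v (s n1) < ereal (real N)" using N by blast
  have eq: "v (s n) = v (s n1)" if "n \<ge> n0" for n
    using v_add_eq[of "s n1" "s n - s n1"] n0[OF that n1(1)] n1(2) cauchyD[OF s] F_diff by simp
  have "v (s n1) \<noteq> \<infinity>" "v (s n1) \<noteq> - \<infinity>" using n1 v_not_MInfty[OF cauchyD[OF s]] by auto
  then obtain r where "v (s n1) = ereal r" by (cases "v (s n1)") auto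
  then show ?thesis using eq that by metis
qed

text \<open>Justifies the \<open>THE\<close> in \<open>completion_val\<close>. For a null class all
  representatives tend to infinity; otherwise the valuation of \<open>s\<close> is eventually
  constant, and a null perturbation, eventually of larger valuation, does not change it.\<close>

lemma val_cls:
  assumes s: "cauchy s" and l: "(\<lambda>n. v (s n)) \<longlonglongrightarrow> l"
  shows "val (cls s) = l"
  unfolding completion_val_def
proof (rule the_equality)
  show "\<forall>t\<in>cls s. (\<lambda>n. v (t n)) \<longlonglongrightarrow> l"
  proof
    fix t assume t: "t \<in> cls s"
    then have u: "(\<lambda>n. t n - s n) \<in> Null" and ct: "cauchy t" using mem_cls[OF s] by auto
    show "(\<lambda>n. v (t n)) \<longlonglongrightarrow> l"
    proof (cases "s \<in> Null")
      case True
      then have "l = \<infinity>" using l by (auto simp: Null_iff intro: LIMSEQ_unique)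
      then show ?thesis using Null_add[OF u True] by (simp add: Null_iff)
    next
      case False
      then obtain r n0 where r: "\<And>n. n \<ge> n0 \<Longrightarrow> v (s n) = ereal r" using val_limit_cases[OF s] by metis
      have ev: "\<forall>\<^sub>F n in sequentially. v (s n) = ereal r"
        using r by (auto simp: eventually_sequentially)
      have "l = ereal r"
        using l tendsto_eventually[OF ev] LIMSEQ_unique by blast
      moreover have "\<forall>\<^sub>F n in sequentially. ereal r < v (t n - s n)"
        using u by (simp add: Null_iff tendsto_PInfty)
      then have "\<forall>\<^sub>F n in sequentially. v (t n) = ereal r"
        using ev
      proof eventually_elim
        case (elim n)
        then show ?case using v_add_eq[of "s n" "t n - s n"] cauchyD[OF s] cauchyD[OF ct] F_diff by simp
      qed
      ultimately show ?thesis by (simp add: tendsto_eventually)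
    qed
  qed
  show "l' = l" if "\<forall>t\<in>cls s. (\<lambda>n. v (t n)) \<longlonglongrightarrow> l'" for l'
    using that cls_self[OF s] l LIMSEQ_unique by blast
qed

lemma val_cls_eventually:
  assumes "cauchy s" and "\<And>n. n \<ge> n0 \<Longrightarrow> v (s n) = l"
  shows "val (cls s) = l"
  using assms(2) by (intro val_cls assms(1) tendsto_eventually) (auto simp: eventually_sequentially)

lemma val_limit:
  assumes s: "cauchy s"
  shows "(\<lambda>n. v (s n)) \<longlonglongrightarrow> val (cls s)"
proof -
  have "\<exists>l. (\<lambda>n. v (s n)) \<longlonglongrightarrow> l"
  proof (cases "s \<in> Null")
    case True
    then show ?thesis by (auto simp: Null_iff)
  next
    case False
    then obtain r n0 where r: "\<And>n. n \<ge> n0 \<Longrightarrow> v (s n) = ereal r" using val_limit_cases[OF s] by metis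
    then have "(\<lambda>n. v (s n)) \<longlonglongrightarrow> ereal r" by (intro tendsto_eventually) (auto simp: eventually_sequentially)
    then show ?thesis by blast
  qed
  then show ?thesis using val_cls[OF s] by metis
qed

lemma val_ge:
  assumes "cauchy s" and "\<And>n. n \<ge> n0 \<Longrightarrow> b \<le> v (s n)"
  shows "b \<le> val (cls s)"
  using val_limit[OF assms(1)] assms(2) by (intro LIMSEQ_le_const[of _ _ b]) auto

lemma val_infty_iff: "cauchy s \<Longrightarrow> val (cls s) = \<infinity> \<longleftrightarrow> s \<in> Null"
  using val_limit[of s] val_cls[of s \<infinity>] by (auto simp: Null_iff)

lemma cls_hom: "(\<lambda>s. cls s) \<in> ring_hom C (completion R v)"
  unfolding completion_def by (rule Null.rcos_ring_hom)

lemma cring_completion: "cring (completion R v)"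
  unfolding completion_def by (rule Null.quotient_is_cring[OF cring_C])

lemma cls_mult: "cauchy s \<Longrightarrow> cauchy t \<Longrightarrow> cls s \<otimes>\<^bsub>completion R v\<^esub> cls t = cls (\<lambda>n. s n * t n)"
  using ring_hom_mult[OF cls_hom, of s t] by (simp add: carrier_C C_ops)

lemma cls_one: "\<one>\<^bsub>completion R v\<^esub> = cls (\<lambda>_. 1)"
  using ring_hom_one[OF cls_hom] by (simp add: C_ops)

lemma cls_diff:
  assumes "cauchy s" "cauchy t"
  shows "cls s \<ominus>\<^bsub>completion R v\<^esub> cls t = cls (\<lambda>n. s n - t n)"
proof -
  interpret K: cring "completion R v" by (rule cring_completion)
  interpret h: ring_hom_cring C "completion R v" "\<lambda>s. cls s"
    by unfold_locales (rule cls_hom)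
  have st: "s \<in> carrier C" "t \<in> carrier C" using assms by (simp_all add: carrier_C)
  have "cls (s \<ominus>\<^bsub>C\<^esub> t) = cls s \<ominus>\<^bsub>completion R v\<^esub> cls t"
    using st by (simp add: a_minus_def)
  then show ?thesis using C_minus[OF assms] by simp
qed

lemma embed: "completion_embed R v x = cls (\<lambda>_. x)"
  by (simp add: completion_embed_def)

lemma embed_power:
  assumes "x \<in> F"
  shows "cls (\<lambda>_. x) [^]\<^bsub>completion R v\<^esub> (n::nat) = cls (\<lambda>_. x ^ n)"
  by (induction n) (use assms in \<open>simp_all add: cls_one cls_mult cauchy_const F_power mult.commute\<close>)

lemma val_embed: "x \<in> F \<Longrightarrow> val (cls (\<lambda>_. x)) = v x"
  by (intro val_cls_eventually cauchy_const) auto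

lemma embed_tendsto:
  assumes s: "cauchy s"
  shows "completion_tendsto R v (\<lambda>k. completion_embed R v (s k)) (cls s)"
  unfolding completion_tendsto_def tendsto_PInfty_nat
proof
  fix N :: nat
  obtain n0 where n0: "\<And>m n. m \<ge> n0 \<Longrightarrow> n \<ge> n0 \<Longrightarrow> ereal (real N) \<le> v (s m - s n)"
    using s unfolding cauchy_def by blast
  have "ereal (real N) \<le> val (cls (\<lambda>n. s k - s n))" if "k \<ge> n0" for k
    using n0[OF that] s by (intro val_ge[where ?n0.0 = n0] cauchy_diff cauchy_const cauchyD) auto
  then have "\<forall>k\<ge>n0. ereal (real N) \<le> val (completion_embed R v (s k) \<ominus>\<^bsub>completion R v\<^esub> cls s)"
    using s by (simp add: embed cls_diff cauchy_const cauchyD)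
  then show "\<exists>n0. \<forall>k\<ge>n0. ereal (real N) \<le> val (completion_embed R v (s k) \<ominus>\<^bsub>completion R v\<^esub> cls s)" by blast
qed

lemma val_diff_ge:
  assumes s: "cauchy s" and t: "cauchy t" and b: "b < val (cls s)" "b < val (cls t)"
  shows "b \<le> val (cls (\<lambda>n. s n - t n))"
proof -
  have "\<forall>\<^sub>F n in sequentially. b < v (s n) \<and> b < v (t n)"
    using order_tendstoD(1)[OF val_limit[OF s] b(1)] order_tendstoD(1)[OF val_limit[OF t] b(2)]
    by (rule eventually_conj)
  then obtain n0 where n0: "\<And>n. n \<ge> n0 \<Longrightarrow> b < v (s n) \<and> b < v (t n)"
    by (auto simp: eventually_sequentially)
  show ?thesis
  proof (rule val_ge[where ?n0.0 = n0, OF cauchy_diff[OF s t]])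
    fix n assume n: "n \<ge> n0"
    have "min (v (s n)) (v (t n)) \<le> v (s n - t n)"
      by (rule v_diff[OF cauchyD[OF s] cauchyD[OF t]])
    then show "b \<le> v (s n - t n)"
      using n0[OF n] by (meson less_imp_le min.boundedI order_trans)
  qed
qed

text \<open>x - y is the difference of u k - y and u k - x, whose valuations both exceed N for large
  k. Uniqueness gives meaning to the \<open>THE\<close> in \<open>kappa_padic\<close>.\<close>

lemma completion_limit_unique:
  assumes x: "x \<in> carrier (completion R v)" and y: "y \<in> carrier (completion R v)"
    and u: "\<And>k. u k \<in> carrier (completion R v)"
    and lim: "completion_tendsto R v u x" "completion_tendsto R v u y"
  shows "x = y"
proof -
  obtain a b where a: "cauchy a" "x = cls a" and b: "cauchy b" "y = cls b"
    using completion_cases[OF x] completion_cases[OF y] by metis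
  have ge: "ereal (real N) \<le> val (cls (\<lambda>n. a n - b n))" for N :: nat
  proof -
    have "\<forall>\<^sub>F k in sequentially. ereal (real N) < val (u k \<ominus>\<^bsub>completion R v\<^esub> x) \<and>
        ereal (real N) < val (u k \<ominus>\<^bsub>completion R v\<^esub> y)"
      using lim unfolding completion_tendsto_def tendsto_PInfty by (intro eventually_conj) blast+
    then obtain k where k: "ereal (real N) < val (u k \<ominus>\<^bsub>completion R v\<^esub> x)"
        "ereal (real N) < val (u k \<ominus>\<^bsub>completion R v\<^esub> y)"
      by (auto simp: eventually_sequentially)
    obtain c where c: "cauchy c" "u k = cls c" using completion_cases[OF u] by metis
    have "ereal (real N) \<le> val (cls (\<lambda>n. (c n - b n) - (c n - a n)))"
      using k a b c by (intro val_diff_ge cauchy_diff) (simp_all add: cls_diff)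
    then show ?thesis by simp
  qed
  have "val (cls (\<lambda>n. a n - b n)) = \<infinity>"
  proof (rule ereal_top)
    fix B
    obtain N :: nat where "B < real N" using reals_Archimedean2 by blast
    then show "ereal B \<le> val (cls (\<lambda>n. a n - b n))"
      using ge[of N] by (meson ereal_less_eq(3) less_imp_le order_trans)
  qed
  then have "(\<lambda>n. a n - b n) \<in> Null" using val_infty_iff cauchy_diff a b by blast
  then show ?thesis using cls_eqI[OF b(1) a(1)] a b by simp
qed

end

text \<open>Scaling valuations by a positive factor, in the application the ramification index,
  preserves Cauchy and null sequences, so \<open>f\<close> extends to the completions.\<close>

locale valued_field_hom = v: valued_field F v + w: valued_field L w
  for F :: "'a::field set" and v and L :: "'b::field set" and w +
  fixes f :: "'a \<Rightarrow> 'b" and e :: real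
  assumes f_closed: "\<And>x. x \<in> F \<Longrightarrow> f x \<in> L"
    and f_diff: "\<And>x y. x \<in> F \<Longrightarrow> y \<in> F \<Longrightarrow> f (x - y) = f x - f y"
    and e_pos: "e > 0" and f_val: "\<And>x. x \<in> F \<Longrightarrow> w (f x) = ereal e * v x"
begin

lemma scale_ge: "\<exists>M::nat. \<forall>x\<in>F. ereal (real M) \<le> v x \<longrightarrow> ereal (real N) \<le> w (f x)" for N :: nat
proof -
  obtain M :: nat where M: "real N / e < real M" using reals_Archimedean2 by blast
  have "ereal (real N) \<le> w (f x)" if "x \<in> F" "ereal (real M) \<le> v x" for x
  proof -
    have "real N \<le> e * real M" using M e_pos by (simp add: field_simps)
    then have "ereal (real N) \<le> ereal e * ereal (real M)" by simp
    also have "\<dots> \<le> ereal e * v x" using e_pos that by (intro ereal_mult_left_mono) auto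
    finally show ?thesis using f_val[OF that(1)] by simp
  qed
  then show ?thesis by blast
qed

lemma map_cauchy:
  assumes s: "v.cauchy s"
  shows "w.cauchy (f \<circ> s)"
  unfolding w.cauchy_def
proof (intro conjI allI)
  show "(f \<circ> s) n \<in> L" for n using v.cauchyD[OF s] f_closed by simp
  fix N :: nat
  obtain M :: nat where M: "\<And>x. x \<in> F \<Longrightarrow> ereal (real M) \<le> v x \<Longrightarrow> ereal (real N) \<le> w (f x)" using scale_ge by blast
  obtain n0 where n0: "\<And>m n. m \<ge> n0 \<Longrightarrow> n \<ge> n0 \<Longrightarrow> ereal (real M) \<le> v (s m - s n)"
    using s unfolding v.cauchy_def by blast
  have "ereal (real N) \<le> w ((f \<circ> s) m - (f \<circ> s) n)" if "m \<ge> n0" "n \<ge> n0" for m n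
    using M[OF v.F_diff n0[OF that]] f_diff v.cauchyD[OF s] by simp
  then show "\<exists>n0. \<forall>m\<ge>n0. \<forall>n\<ge>n0. ereal (real N) \<le> w ((f \<circ> s) m - (f \<circ> s) n)" by blast
qed

lemma map_Null:
  assumes s: "s \<in> v.Null"
  shows "f \<circ> s \<in> w.Null"
proof -
  have cs: "v.cauchy s" using s by (simp add: v.Null_iff)
  have "\<exists>n0. \<forall>n\<ge>n0. ereal (real N) \<le> w ((f \<circ> s) n)" for N :: nat
  proof -
    obtain M :: nat where M: "\<And>x. x \<in> F \<Longrightarrow> ereal (real M) \<le> v x \<Longrightarrow> ereal (real N) \<le> w (f x)" using scale_ge by blast
    obtain n0 where "\<And>n. n \<ge> n0 \<Longrightarrow> ereal (real M) \<le> v (s n)"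
      using s unfolding v.Null_iff tendsto_PInfty_nat by blast
    then show ?thesis using M v.cauchyD[OF cs] by auto
  qed
  then show ?thesis using map_cauchy[OF cs] by (simp add: w.Null_iff tendsto_PInfty_nat)
qed

text \<open>Congruent representatives have congruent images, so the image inside
  \<open>completion_map\<close> is a singleton and \<open>the_elem\<close> returns its
  element.\<close>

lemma completion_map_cls:
  assumes s: "v.cauchy s"
  shows "completion_map f w.R w (v.cls s) = w.cls (f \<circ> s)"
proof -
  have "w.cls (f \<circ> t) = w.cls (f \<circ> s)" if "t \<in> v.cls s" for t
  proof (rule sym, rule w.cls_eqI)
    have t: "v.cauchy t" "(\<lambda>n. t n - s n) \<in> v.Null" using that v.mem_cls[OF s] by auto
    show "w.cauchy (f \<circ> s)" "w.cauchy (f \<circ> t)" using s t map_cauchy by auto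
    have "(\<lambda>n. (f \<circ> t) n - (f \<circ> s) n) = f \<circ> (\<lambda>n. t n - s n)"
      using f_diff v.cauchyD[OF s] v.cauchyD[OF t(1)] by auto
    then show "(\<lambda>n. (f \<circ> t) n - (f \<circ> s) n) \<in> w.Null" using map_Null[OF t(2)] by simp
  qed
  then have "(\<lambda>t. w.cls (f \<circ> t)) ` v.cls s = {w.cls (f \<circ> s)}"
    using v.cls_self[OF s] by blast
  then show ?thesis by (simp add: completion_map_def)
qed

end


section \<open>The theorem\<close>

context valued_field
begin

lemma F_of_nat: "of_nat n \<in> F"
  by (induction n) (simp_all add: F_0 F_1 F_add)

lemma v_of_nat_nonneg: "v (of_nat n) \<ge> 0"
proof (induction n)
  case (Suc n)
  then show ?case using v_add[OF F_1 F_of_nat[of n]] v_1 by (simp add: min_def split: if_splits)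
qed (simp add: v_0)

lemma v_power_nonneg: "x \<in> F \<Longrightarrow> v x \<ge> 0 \<Longrightarrow> v (x ^ n) \<ge> 0"
  by (induction n) (simp_all add: v_1 v_nonneg_mult F_power)

text \<open>x^n - 1 is x - 1 times a geometric sum, whose valuation is nonnegative because that of x
  is.\<close>

lemma v_power_minus_1_ge:
  assumes x: "x \<in> F" "v (x - 1) \<ge> 0"
  shows "v (x ^ n - 1) \<ge> v (x - 1)"
proof -
  have "v x \<ge> 0" using v_add[OF F_diff[OF x(1) F_1] F_1] x(2) v_1 by (simp add: min_def split: if_splits)
  then have s: "(\<Sum>i<n. x ^ i) \<in> F \<and> 0 \<le> v (\<Sum>i<n. x ^ i)"
    using x by (intro v_sum_ge) (auto simp: F_power v_power_nonneg)
  have "v (x ^ n - 1) = v (x - 1) + v (\<Sum>i<n. x ^ i)"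
    using s v_mult[OF F_diff[OF x(1) F_1]] by (simp add: power_diff_1_eq)
  then show ?thesis using s add_left_mono[of 0 "v (\<Sum>i<n. x ^ i)" "v (x - 1)"] by simp
qed

text \<open>The geometric sum of p powers of x equals p plus the differences x^i - 1, so it has
  valuation at least \<delta>.\<close>

lemma v_power_prime_minus_1_ge:
  assumes x: "x \<in> F" and \<delta>: "\<delta> \<ge> 0" "ereal \<delta> \<le> v (x - 1)" "ereal \<delta> \<le> v (of_nat p)"
  shows "v (x - 1) + ereal \<delta> \<le> v (x ^ p - 1)"
proof -
  have x1: "v (x - 1) \<ge> 0" using \<delta> by (meson ereal_less_eq(5) order_trans)
  have "(\<Sum>i<p. x ^ i - 1) \<in> F \<and> ereal \<delta> \<le> v (\<Sum>i<p. x ^ i - 1)"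
    using v_power_minus_1_ge[OF x x1] \<delta>(2) x by (intro v_sum_ge) (auto intro!: F_diff F_power F_1 intro: order_trans)
  then have s: "(\<Sum>i<p. x ^ i - 1) \<in> F" "ereal \<delta> \<le> v (\<Sum>i<p. x ^ i - 1)" by auto
  have "(\<Sum>i<p. x ^ i) = of_nat p + (\<Sum>i<p. x ^ i - 1)" by (simp add: sum_subtractf)
  then have t: "(\<Sum>i<p. x ^ i) \<in> F" "ereal \<delta> \<le> v (\<Sum>i<p. x ^ i)"
    using v_add[OF F_of_nat[of p] s(1)] s \<delta>(3) F_add[OF F_of_nat s(1)]
    by (auto simp del: sum_subtractf intro: order_trans[OF min.boundedI])
  have "v (x ^ p - 1) = v (x - 1) + v (\<Sum>i<p. x ^ i)"
    using t v_mult[OF F_diff[OF x F_1]] by (simp add: power_diff_1_eq)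
  then show ?thesis using t by (simp add: add_left_mono)
qed

text \<open>Every p-th power gains at least \<delta>, so the bound grows linearly in M and passes
  any finite value once \<delta> > 0.\<close>

lemma v_power_prime_power_minus_1_ge:
  assumes x: "x \<in> F" and \<delta>: "\<delta> \<ge> 0" "ereal \<delta> \<le> v (x - 1)" "ereal \<delta> \<le> v (of_nat p)"
  shows "ereal (real (Suc M) * \<delta>) \<le> v (x ^ (p ^ M) - 1)"
proof (induction M)
  case (Suc M)
  let ?y = "x ^ (p ^ M)"
  have "\<delta> \<le> real (Suc M) * \<delta>" using \<delta>(1) by (simp add: algebra_simps)
  then have "ereal \<delta> \<le> v (?y - 1)" using Suc by (meson ereal_less_eq(3) order_trans)
  then have "v (?y - 1) + ereal \<delta> \<le> v (?y ^ p - 1)"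
    using \<delta> x by (intro v_power_prime_minus_1_ge F_power)
  moreover have "?y ^ p = x ^ (p ^ Suc M)" by (simp flip: power_mult add: mult.commute)
  moreover have "ereal (real (Suc M) * \<delta>) + ereal \<delta> \<le> v (?y - 1) + ereal \<delta>" using Suc by (rule add_right_mono)
  ultimately show ?case by (simp add: algebra_simps)
qed (use \<delta> in simp)

text \<open>With t = x - 1, the middle binomial coefficients of (1 + t)^p are divisible by p, so x^p
  - 1 is t^p up to terms of positive valuation.\<close>

lemma v_power_prime_minus_1_unit:
  assumes p: "prime p" and x: "x \<in> F" "v (x - 1) = 0" and vp: "v (of_nat p) > 0"
  shows "v (x ^ p - 1) = 0"
proof -
  define t where "t = x - 1"
  have t: "t \<in> F" "v t = 0" using x F_1 by (simp_all add: t_def F_diff)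
  have p2: "p \<ge> 2" using p by (rule prime_ge_2_nat)
  have split: "{..p} = insert 0 (insert p {1..<p})" using p2 by auto
  have "x ^ p = (\<Sum>k\<le>p. of_nat (p choose k) * t ^ k)"
    using binomial_ring[of t 1 p] by (simp add: t_def)
  also have "\<dots> = 1 + (t ^ p + (\<Sum>k\<in>{1..<p}. of_nat (p choose k) * t ^ k))"
    unfolding split using p2 by simp
  finally have eq: "x ^ p - 1 = t ^ p + (\<Sum>k\<in>{1..<p}. of_nat (p choose k) * t ^ k)" by simp
  have "of_nat (p choose k) * t ^ k \<in> F \<and> v (of_nat p) \<le> v (of_nat (p choose k) * t ^ k)" if k: "k \<in> {1..<p}" for k
  proof
    have "p dvd (p choose k)" using p k by (intro dvd_choose_prime) auto
    then obtain c where c: "p choose k = p * c" by (rule dvdE)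
    have eq: "of_nat (p choose k) * t ^ k = of_nat p * (of_nat c * t ^ k)" by (simp add: c mult.assoc)
    have "0 \<le> v (of_nat c * t ^ k)"
      using t by (intro v_nonneg_mult F_of_nat F_power v_of_nat_nonneg v_power_nonneg) auto
    then show "v (of_nat p) \<le> v (of_nat (p choose k) * t ^ k)"
      unfolding eq using v_mult[OF F_of_nat[of p] F_mult[OF F_of_nat[of c] F_power[OF t(1), of k]]]
        add_left_mono[of 0 "v (of_nat c * t ^ k)" "v (of_nat p)"] by simp
  qed (use t in \<open>simp add: F_mult F_of_nat F_power\<close>)
  then have s: "(\<Sum>k\<in>{1..<p}. of_nat (p choose k) * t ^ k) \<in> F"
      "v (of_nat p) \<le> v (\<Sum>k\<in>{1..<p}. of_nat (p choose k) * t ^ k)"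
    using v_sum_ge[of "{1..<p}" "\<lambda>k. of_nat (p choose k) * t ^ k" "v (of_nat p)"] by auto
  have "v (t ^ p) = 0" using v_power[OF _ t(1), of p] t p2 by simp
  then show ?thesis unfolding eq using v_add_eq[OF F_power[OF t(1)] s(1), of p] s(2) vp by (metis less_le_trans)
qed

lemma v_power_prime_power_minus_1_unit:
  assumes p: "prime p" and x: "x \<in> F" "v (x - 1) = 0" and vp: "v (of_nat p) > 0"
  shows "v (x ^ (p ^ M) - 1) = 0"
proof (induction M)
  case (Suc M)
  have "x ^ (p ^ Suc M) = (x ^ (p ^ M)) ^ p" by (simp flip: power_mult add: mult.commute)
  then show ?case using v_power_prime_minus_1_unit[OF p F_power[OF x(1)] Suc vp] by simp
qed (use x in simp)

lemma v_power_minus_1_neg: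
  assumes x: "x \<in> F" "v x < 0" and n: "n > 0"
  shows "v (x ^ n - 1) < 0"
proof -
  have "v (x ^ n) < 0"
    using v_power[OF n x(1)] x n v_not_MInfty[OF x(1)] by (cases "v x") (auto simp: mult_pos_neg)
  then have "v (x ^ n + - 1) = v (x ^ n)"
    by (intro v_add_eq F_power x F_minus F_1) (simp add: v_neg F_1 v_1)
  then show ?thesis using \<open>v (x ^ n) < 0\<close> by simp
qed

text \<open>A non-integral \<open>x\<close> has \<open>v x < 0\<close>; otherwise Frobenius keeps \<open>x\<close> off the residue class of \<open>1\<close>.\<close>

lemma v_power_prime_power_minus_1_le:
  assumes p: "prime p" and x: "x \<in> F" "v (x - 1) \<le> 0" and vp: "v (of_nat p) > 0"
  shows "v (x ^ (p ^ M) - 1) \<le> 0"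
proof (cases "v x < 0")
  case True
  then show ?thesis using v_power_minus_1_neg[OF x(1) True, of "p ^ M"] p by (simp add: prime_gt_0_nat)
next
  case False
  then have "v (x - 1) \<ge> 0" using v_diff[OF x(1) F_1] v_1 by (simp add: min_def split: if_splits)
  then show ?thesis using v_power_prime_power_minus_1_unit[OF p x(1) _ vp] x(2) by simp
qed

end

section \<open>The P-adic valuation of K and the image of kappa_d^(p)\<close>

context number_ring_prime
begin

abbreviation Frac :: "real ring" where "Frac \<equiv> ring_of_type_algebra\<lparr>carrier := F\<rparr>"

abbreviation e :: real where "e \<equiv> real (exponent (real p))"

lemma ring_of_integers_Frac: "ring_of_integers Frac = ring_of_type_algebra\<lparr>carrier := A\<rparr>"
  by (simp add: ring_of_integers_def A_eq)

lemma prime_exponent_eq: "prime_exponent Frac P x = exponent x"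
  by (simp add: prime_exponent_def exponent_def power_P_def ring_of_integers_Frac)

lemma prime_val_0: "prime_val Frac P 0 = \<infinity>"
  by (simp add: prime_val_def)

text \<open>Cross-multiplying two fractions for the same number and applying
  \<open>exponent_mult\<close> gives equal differences of exponents, so the \<open>THE\<close> in
  \<open>prime_val\<close> does not depend on the fraction.\<close>

lemma prime_val_quotient:
  assumes a: "a \<in> A" "a \<noteq> 0" and b: "b \<in> A" "b \<noteq> 0"
  shows "prime_val Frac P (a / b) = ereal (real (exponent a) - real (exponent b))"
proof -
  have "(THE l. \<exists>a'\<in>A - {0}. \<exists>b'\<in>A - {0}. a / b = a' / b' \<and> l = ereal (real (exponent a') - real (exponent b')))
      = ereal (real (exponent a) - real (exponent b))"
  proof (rule the_equality)
    show "\<exists>a'\<in>A - {0}. \<exists>b'\<in>A - {0}. a / b = a' / b' \<and>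
        ereal (real (exponent a) - real (exponent b)) = ereal (real (exponent a') - real (exponent b'))"
      using a b by blast
    fix l assume "\<exists>a'\<in>A - {0}. \<exists>b'\<in>A - {0}. a / b = a' / b' \<and> l = ereal (real (exponent a') - real (exponent b'))"
    then obtain a' b' where ab: "a' \<in> A" "a' \<noteq> 0" "b' \<in> A" "b' \<noteq> 0" "a / b = a' / b'"
      and l: "l = ereal (real (exponent a') - real (exponent b'))" by blast
    have "a * b' = a' * b" using ab b by (simp add: field_simps)
    then have "exponent a + exponent b' = exponent a' + exponent b"
      using exponent_mult[OF a ab(3,4)] exponent_mult[OF ab(1,2) b] by simp
    then have "real (exponent a) + real (exponent b') = real (exponent a') + real (exponent b)"
      by (metis of_nat_add)
    then show "l = ereal (real (exponent a) - real (exponent b))" by (simp add: l)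
  qed
  then show ?thesis
    using a b by (simp add: prime_val_def prime_exponent_eq) (simp add: ring_of_integers_Frac)
qed

lemma fractionE:
  assumes "x \<in> F" "x \<noteq> 0"
  obtains a b where "a \<in> A" "a \<noteq> 0" "b \<in> A" "b \<noteq> 0" "x = a / b"
proof -
  obtain c :: int where c: "c \<noteq> 0" "of_int c * x \<in> A" by (rule integral_multiple[OF assms(1)])
  then show ?thesis using that[of "of_int c * x" "of_int c"] A_int assms by simp
qed

lemma valued_field_prime_val: "valued_field F (prime_val Frac P)"
proof
  fix x y assume x: "x \<in> F" and y: "y \<in> F"
  show "prime_val Frac P (x * y) = prime_val Frac P x + prime_val Frac P y"
  proof (cases "x = 0 \<or> y = 0")
    case True
    have "prime_val Frac P z \<noteq> - \<infinity>" if "z \<in> F" for z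
      using prime_val_quotient prime_val_0 fractionE[OF that] by (metis MInfty_neq_ereal(1) MInfty_neq_PInfty(1))
    then show ?thesis using True x y by (auto simp: prime_val_0)
  next
    case False
    obtain a b where ab: "a \<in> A" "a \<noteq> 0" "b \<in> A" "b \<noteq> 0" "x = a / b" using fractionE[OF x] False by blast
    obtain a' b' where ab': "a' \<in> A" "a' \<noteq> 0" "b' \<in> A" "b' \<noteq> 0" "y = a' / b'" using fractionE[OF y] False by blast
    have "x * y = (a * a') / (b * b')" by (simp add: ab ab')
    then show ?thesis
      using prime_val_quotient[OF A_mult[OF ab(1) ab'(1)] _ A_mult[OF ab(3) ab'(3)]] ab ab'
      by (simp add: prime_val_quotient exponent_mult)
  qed
  show "min (prime_val Frac P x) (prime_val Frac P y) \<le> prime_val Frac P (x + y)"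
  proof (cases "x = 0 \<or> y = 0 \<or> x + y = 0")
    case True
    then show ?thesis by (auto simp: prime_val_0)
  next
    case False
    obtain a b where ab: "a \<in> A" "a \<noteq> 0" "b \<in> A" "b \<noteq> 0" "x = a / b" using fractionE[OF x] False by blast
    obtain a' b' where ab': "a' \<in> A" "a' \<noteq> 0" "b' \<in> A" "b' \<noteq> 0" "y = a' / b'" using fractionE[OF y] False by blast
    let ?c = "a * b'" and ?d = "a' * b" and ?n = "b * b'"
    have c: "?c \<in> A" "?c \<noteq> 0" and d: "?d \<in> A" "?d \<noteq> 0" and n: "?n \<in> A" "?n \<noteq> 0"
      using ab ab' by (auto intro: A_mult)
    \<comment> \<open>Over a common denominator the same exponent is subtracted from all three
      terms, which leaves \<open>exponent_add\<close> for the numerators.\<close>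
    have eqs: "x = ?c / ?n" "y = ?d / ?n" "x + y = (?c + ?d) / ?n" using ab ab' by (simp_all add: field_simps)
    have s: "?c + ?d \<in> A" "?c + ?d \<noteq> 0" using c d A_add eqs(3) False by auto
    have "min (exponent ?c) (exponent ?d) \<le> exponent (?c + ?d)" by (rule exponent_add[OF c d s(2)])
    moreover note prime_val_quotient[OF c n] prime_val_quotient[OF d n] prime_val_quotient[OF s n]
    ultimately have "min (prime_val Frac P (?c / ?n)) (prime_val Frac P (?d / ?n)) \<le> prime_val Frac P ((?c + ?d) / ?n)"
      by (simp only: min_def) (simp split: if_splits)
    then show ?thesis unfolding eqs(3) unfolding eqs(1,2) .
  qed
next
  fix x assume "x \<in> F" "x \<noteq> 0"
  then show "\<exists>r. prime_val Frac P x = ereal r" using fractionE prime_val_quotient by metis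
qed (use F_1 F_add F_minus F_mult prime_val_0 in auto)

lemma e_pos: "e > 0"
  using exponent_P[OF p_in] p by (simp add: prime_gt_0_nat)

lemma prime_val_of_rat: "prime_val Frac P (of_rat q) = ereal e * padic_val p q"
proof (cases "q = 0")
  case True
  then show ?thesis using e_pos by (simp add: padic_val_def prime_val_0)
next
  case False
  define a b where "a = fst (quotient_of q)" and "b = snd (quotient_of q)"
  have b: "b > 0" by (simp add: b_def quotient_of_denom_pos')
  have q: "q = of_int a / of_int b" using quotient_of_div[of q a b] by (simp add: a_def b_def)
  have a: "a \<noteq> 0" using False q by auto
  have "prime_val Frac P (of_rat q) = ereal (real (exponent (of_int a)) - real (exponent (of_int b)))"
    using prime_val_quotient[OF A_int[of a] _ A_int[of b]] a b by (simp add: q of_rat_divide)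
  also have "\<dots> = ereal (e * (real (multiplicity (int p) a) - real (multiplicity (int p) b)))"
    using a b by (simp add: exponent_int algebra_simps)
  also have "\<dots> = ereal e * padic_val p q" using False by (simp add: padic_val_def a_def b_def)
  finally show ?thesis .
qed

lemma F_of_rat: "of_rat q \<in> F"
proof -
  have "real_of_rat q = of_int (fst (quotient_of q)) / of_int (snd (quotient_of q))"
    using quotient_of_div[of q] by (metis of_rat_divide of_rat_of_int_eq prod.collapse)
  then show ?thesis using F_div A_F A_int by simp
qed

text \<open>The laws for products and sums are pulled back along \<open>of_rat\<close> from the
  P-adic valuation, which is e times \<open>padic_val p\<close> on rationals; the positive factor e
  cancels.\<close>

lemma valued_field_padic_val: "valued_field UNIV (padic_val p)"
proof
  interpret w: valued_field F "prime_val Frac P" by (rule valued_field_prime_val)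
  fix x y :: rat
  have "ereal e * padic_val p (x * y) = ereal e * padic_val p x + ereal e * padic_val p y"
    using w.v_mult[OF F_of_rat[of x] F_of_rat[of y]] by (simp only: prime_val_of_rat flip: of_rat_mult)
  moreover have "\<dots> = ereal e * (padic_val p x + padic_val p y)"
    by (rule ereal_distrib_left[symmetric]) (auto simp: padic_val_def)
  ultimately have "ereal e * padic_val p (x * y) = ereal e * (padic_val p x + padic_val p y)" by simp
  then show "padic_val p (x * y) = padic_val p x + padic_val p y"
    using e_pos by (simp add: ereal_mult_cancel_left)
  have "min (ereal e * padic_val p x) (ereal e * padic_val p y) \<le> ereal e * padic_val p (x + y)"
    using w.v_add[OF F_of_rat[of x] F_of_rat[of y]] by (simp add: prime_val_of_rat flip: of_rat_add)
  then show "min (padic_val p x) (padic_val p y) \<le> padic_val p (x + y)"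
    using e_pos by (auto simp: min_def ereal_mult_le_mult_iff split: if_splits)
qed (auto simp: padic_val_def)

lemma valued_field_hom_of_rat: "valued_field_hom UNIV (padic_val p) F (prime_val Frac P) of_rat e"
  using valued_field_prime_val valued_field_padic_val F_of_rat e_pos prime_val_of_rat
  by (simp add: valued_field_hom_def valued_field_hom_axioms_def of_rat_diff)

lemma padic_val_of_int_ge:
  assumes "int p ^ N dvd j"
  shows "ereal (real N) \<le> padic_val p (of_int j)"
proof (cases "j = 0")
  case False
  have "\<not> is_unit (int p)" using p by (metis not_prime_1 int_dvd_int_iff of_nat_1 nat_dvd_1_iff_1)
  then have "N \<le> multiplicity (int p) j" using False assms by (intro multiplicity_geI) auto
  then show ?thesis using False by (simp add: padic_val_def)
qed (simp add: padic_val_def)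

text \<open>Polymorphic in the target, so that one notation serves the rational and the real
  sequence.\<close>

abbreviation count :: "nat \<Rightarrow> nat \<Rightarrow> 'b::semiring_1" where
  "count d k \<equiv> of_nat (indep_count d (p ^ k))"

text \<open>The congruences between consecutive levels telescope. They start at level 1, since
  a_d(1) does not fit the pattern; hence the bound \<open>max 1 N\<close>.\<close>

lemma count_cauchy:
  assumes d: "d \<ge> 1"
  shows "valued_field.cauchy UNIV (padic_val p) (\<lambda>k. count d k)"
proof -
  interpret v: valued_field UNIV "padic_val p" by (rule valued_field_padic_val)
  have dvd: "int p ^ Suc k dvd int (indep_count d (p ^ (k + j))) - int (indep_count d (p ^ k))" if k: "k \<ge> 1" for k j
  proof (induction j)
    case (Suc j)
    have "int (p ^ Suc (k + j)) dvd int (indep_count d (p ^ Suc (k + j))) - int (indep_count d (p ^ (k + j)))"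
      using k by (intro indep_count_prime_power_cong p d) simp
    moreover have "int p ^ Suc k dvd int (p ^ Suc (k + j))" by (simp add: le_imp_power_dvd del: power_Suc)
    ultimately have "int p ^ Suc k dvd int (indep_count d (p ^ Suc (k + j))) - int (indep_count d (p ^ (k + j)))"
      by (rule dvd_trans[rotated])
    from dvd_add[OF this Suc] show ?case by simp
  qed simp
  have ge: "ereal (real N) \<le> padic_val p (count d m - count d n)" if "m \<ge> n" "n \<ge> max 1 N" for m n N
  proof -
    have "int p ^ N dvd int p ^ Suc n" using that by (intro le_imp_power_dvd) simp
    then have "int p ^ N dvd int (indep_count d (p ^ m)) - int (indep_count d (p ^ n))"
      using dvd[of n "m - n"] that by (simp del: power_Suc) (meson dvd_trans)
    from padic_val_of_int_ge[OF this] show ?thesis by simp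
  qed
  have "ereal (real N) \<le> padic_val p (count d m - count d n)" if "m \<ge> max 1 N" "n \<ge> max 1 N" for m n N
  proof (cases "m \<ge> n")
    case False
    then have "ereal (real N) \<le> padic_val p (count d n - count d m)" using ge[of m n N] that by simp
    then show ?thesis using v.v_minus_commute[of "count d n" "count d m"] by simp
  qed (use ge that in blast)
  then show ?thesis unfolding v.cauchy_def by blast
qed

text \<open>Being Cauchy, the counts define a class to which their embeddings converge. It is a
  p-adic integer because natural numbers have nonnegative valuation, and limits are unique.\<close>

lemma kappa_padic_eq:
  assumes d: "d \<ge> 1"
  shows "kappa_padic d p = null_seqs rat_ring (padic_val p) +>\<^bsub>cauchy_ring rat_ring (padic_val p)\<^esub> (\<lambda>k. count d k)"
proof -
  interpret v: valued_field UNIV "padic_val p" by (rule valued_field_padic_val)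
  have R: "v.R = rat_ring" by (simp add: ring_of_type_algebra_def)
  note c = count_cauchy[OF d]
  have "(THE x. x \<in> padic_ints p \<and> completion_tendsto v.R (padic_val p)
      (\<lambda>k. completion_embed v.R (padic_val p) (count d k)) x) = v.cls (\<lambda>k. count d k)"
  proof (rule the_equality)
    have "0 \<le> v.val (v.cls (\<lambda>k. count d k))"
      by (rule v.val_ge[OF c]) (rule v.v_of_nat_nonneg)
    then have "v.cls (\<lambda>k. count d k) \<in> padic_ints p"
      using v.cls_closed[OF c] by (simp add: padic_ints_def R)
    then show "v.cls (\<lambda>k. count d k) \<in> padic_ints p \<and> completion_tendsto v.R (padic_val p)
      (\<lambda>k. completion_embed v.R (padic_val p) (count d k)) (v.cls (\<lambda>k. count d k))"
      using v.embed_tendsto[OF c] by blast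
    fix x assume x: "x \<in> padic_ints p \<and> completion_tendsto v.R (padic_val p)
      (\<lambda>k. completion_embed v.R (padic_val p) (count d k)) x"
    show "x = v.cls (\<lambda>k. count d k)"
    proof (rule v.completion_limit_unique[where u = "\<lambda>k. completion_embed v.R (padic_val p) (count d k)"])
      show "x \<in> carrier (completion v.R (padic_val p))" using x by (simp add: padic_ints_def R)
      show "completion_embed v.R (padic_val p) (count d k) \<in> carrier (completion v.R (padic_val p))" for k
        unfolding v.embed by (intro v.cls_closed v.cauchy_const) simp
    qed (use x v.embed_tendsto[OF c] v.cls_closed[OF c] in blast)+
  qed
  then show ?thesis by (simp add: kappa_padic_def R)
qed

text \<open>\<open>of_rat\<close> maps each count to itself, so the counts represent kappa_d^(p) in
  K_P as well, and valuations can be read off from these terms.\<close>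

lemma kappa_padic_image:
  assumes d: "d \<ge> 1"
  shows "completion_map of_rat Frac (prime_val Frac P) (kappa_padic d p)
       = null_seqs Frac (prime_val Frac P) +>\<^bsub>cauchy_ring Frac (prime_val Frac P)\<^esub> (\<lambda>k. count d k)"
    and "valued_field.cauchy F (prime_val Frac P) (\<lambda>k. count d k)"
proof -
  interpret h: valued_field_hom UNIV "padic_val p" F "prime_val Frac P" of_rat e
    by (rule valued_field_hom_of_rat)
  have R: "h.v.R = rat_ring" by (simp add: ring_of_type_algebra_def)
  have "of_rat \<circ> (\<lambda>k. count d k) = (\<lambda>k. count d k :: real)" by (simp add: fun_eq_iff)
  then show "completion_map of_rat Frac (prime_val Frac P) (kappa_padic d p)
       = null_seqs Frac (prime_val Frac P) +>\<^bsub>cauchy_ring Frac (prime_val Frac P)\<^esub> (\<lambda>k. count d k)"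
    "valued_field.cauchy F (prime_val Frac P) (\<lambda>k. count d k)"
    using h.completion_map_cls[OF count_cauchy[OF d]] h.map_cauchy[OF count_cauchy[OF d]]
    by (simp_all add: kappa_padic_eq[OF d] R)
qed

text \<open>Tameness spreads the value at level 1 to all higher levels, and passing to P multiplies
  it by e. It is positive because p divides a_d(p) - 1 and finite because a_d(p) > 1.\<close>

lemma tame_valuation:
  assumes d: "d \<ge> 1" and tame: "p \<in> Tame d"
  shows "\<exists>\<rho>>0. ereal e * padic_val p (of_nat (indep_count d p) - 1) = ereal \<rho> \<and>
    (\<forall>k\<ge>1. prime_val Frac P (count d k - 1) = ereal \<rho>)"
proof -
  have p2: "p \<ge> 2" using p by (rule prime_ge_2_nat)
  let ?r = "padic_val p (of_nat (indep_count d p) - 1)"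
  have "int p ^ 1 dvd int (indep_count d p) - 1" using indep_count_prime_cong[OF p d] by simp
  from padic_val_of_int_ge[OF this] have r: "?r \<ge> 1" by (simp add: one_ereal_def)
  have "of_nat (indep_count d p) - 1 \<noteq> (0::rat)"
    using indep_count_gt_1[OF p2 d] by (metis eq_iff_diff_eq_0 less_irrefl of_nat_eq_1_iff)
  then obtain r where r': "?r = ereal r" by (simp add: padic_val_def)
  have "prime_val Frac P (count d k - 1) = ereal (e * r)" if "k \<ge> 1" for k
  proof -
    have "padic_val p (count d k - 1) = ereal r" using tame that r' by (simp add: Tame_def)
    then show ?thesis using prime_val_of_rat[of "count d k - 1"] by (simp add: of_rat_diff)
  qed
  moreover have "e * r > 0" using e_pos r r' by (simp add: one_ereal_def)
  ultimately show ?thesis using r' by (intro exI[of _ "e * r"]) simp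
qed

end

section \<open>The field Q(kappa_d) and the final comparison\<close>

lemma number_ring_prime_rat_adjoin:
  assumes alg: "algebraic \<theta>" and p: "prime p" and P: "prime_above (rat_adjoin \<theta>) p P"
  obtains m where "number_ring_prime (generate_field real_ring {\<theta>})
    {x \<in> generate_field real_ring {\<theta>}. algebraic_int x} P p m"
proof -
  let ?F = "generate_field real_ring {\<theta>}"
  let ?A = "{x \<in> ?F. algebraic_int x}"
  let ?O = "ring_of_type_algebra\<lparr>carrier := ?A\<rparr>"
  interpret K: field real_ring by (rule field_from_type_algebra)
  have O: "ring_of_integers (rat_adjoin \<theta>) = ?O"
    by (simp add: ring_of_integers_def rat_adjoin_def)
  interpret P: primeideal P ?O using P by (simp add: prime_above_def O)
  have ops: "x \<otimes>\<^bsub>real_ring\<^esub> y = x * y" "x \<oplus>\<^bsub>real_ring\<^esub> y = x + y"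
    "\<one>\<^bsub>real_ring\<^esub> = 1" "\<zero>\<^bsub>real_ring\<^esub> = 0" for x y
    by (simp_all add: ring_of_type_algebra_def)
  have neg: "\<ominus>\<^bsub>real_ring\<^esub> x = - x" for x
    by (rule K.minus_equality) (auto simp: ring_of_type_algebra_def)
  have inv: "inv\<^bsub>real_ring\<^esub> x = inverse x" if "x \<noteq> 0" for x
    using that by (intro K.comm_inv_char) (auto simp: ring_of_type_algebra_def)
  have F0: "0 \<in> ?F" using K.zero_in_generate[of "{\<theta>}"] by (simp add: ops)
  have "number_ring_prime ?F ?A P p m" if m: "\<And>f. (\<And>i. i \<le> m \<Longrightarrow> f i \<in> ?F) \<Longrightarrow>
       \<exists>c :: nat \<Rightarrow> int. (\<exists>i\<le>m. c i \<noteq> 0) \<and> (\<Sum>i\<le>m. of_int (c i) * f i) = 0" for m :: nat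
  proof
    show "\<exists>c :: nat \<Rightarrow> int. (\<exists>i\<le>m. c i \<noteq> 0) \<and> (\<Sum>i\<le>m. of_int (c i) * f i) = 0"
      if "\<And>i. i \<le> m \<Longrightarrow> f i \<in> ?F" for f using that by (rule m)
    show "1 \<in> ?F" using generate_field.one[of real_ring "{\<theta>}"] by (simp add: ops)
    show "x + y \<in> ?F" "x * y \<in> ?F" if "x \<in> ?F" "y \<in> ?F" for x y
      using generate_field.eng_add[OF that] generate_field.eng_mult[OF that] by (simp_all add: ops)
    show "- x \<in> ?F" if "x \<in> ?F" for x
      using generate_field.a_inv[OF that] by (simp add: neg)
    show "inverse x \<in> ?F" if "x \<in> ?F" for x
      using generate_field.m_inv[OF that] F0 by (cases "x = 0") (simp_all add: inv ops)
    \<comment> \<open>Closure of the algebraic integers of the field comes from the ring structure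
      contained in \<open>primeideal\<close>.\<close>
    show "x + y \<in> ?A" "x * y \<in> ?A" if "x \<in> ?A" "y \<in> ?A" for x y
      using P.a_closed P.m_closed that by (simp_all add: ops)
    show "P \<subseteq> ?A" using P.a_subset by simp
    show "x + y \<in> P" if "x \<in> P" "y \<in> P" for x y
      using additive_subgroup.a_closed[OF P.additive_subgroup_axioms that] by (simp add: ops)
    show "x * y \<in> P" if "x \<in> ?A" "y \<in> P" for x y
      using P.I_l_closed[of y x] that by (simp add: ops)
    show "1 \<notin> P" using P.one_imp_carrier P.I_notcarr by (auto simp: ops)
    show "x \<in> P \<or> y \<in> P" if "x \<in> ?A" "y \<in> ?A" "x * y \<in> P" for x y
      using P.I_prime[of x y] that by (simp add: ops)
    show "real p \<in> P" using P by (simp add: prime_above_def)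
  qed (use p in simp_all)
  then show ?thesis using that algebraic_generate_field_dependent[OF alg] by metis
qed

theorem theorem4p23:
  fixes d p :: nat and P :: "real set"
  assumes "d \<ge> 1"
    and "algebraic (kappa d)"
    and "p \<in> Tame d"
    and "prime_above (rat_adjoin (kappa d)) p P"
  shows "let K = rat_adjoin (kappa d);
             r = padic_val p (of_nat (indep_count d p) - 1);
             KP = completion K (prime_val K P);
             v = completion_val K (prime_val K P);
             \<iota> = completion_embed K (prime_val K P);
             e = v (\<iota> (real p));
             \<kappa> = \<iota> (kappa d);
             \<kappa>p = completion_map of_rat K (prime_val K P) (kappa_padic d p)
         in (v (\<kappa> \<ominus>\<^bsub>KP\<^esub> \<one>\<^bsub>KP\<^esub>) > 0 \<longrightarrow>
               (\<forall>\<^sub>F k in sequentially. v (\<kappa>p \<ominus>\<^bsub>KP\<^esub> \<kappa> [^]\<^bsub>KP\<^esub> (p ^ (k * d))) = e * r))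
          \<and> (v (\<kappa> \<ominus>\<^bsub>KP\<^esub> \<one>\<^bsub>KP\<^esub>) \<le> 0 \<longrightarrow>
               (\<forall>k\<ge>1. v (\<kappa>p \<ominus>\<^bsub>KP\<^esub> \<kappa> [^]\<^bsub>KP\<^esub> (p ^ (k * d)))
                        = v (\<kappa> [^]\<^bsub>KP\<^esub> (p ^ (k * d)) \<ominus>\<^bsub>KP\<^esub> \<one>\<^bsub>KP\<^esub>)
                    \<and> v (\<kappa> [^]\<^bsub>KP\<^esub> (p ^ (k * d)) \<ominus>\<^bsub>KP\<^esub> \<one>\<^bsub>KP\<^esub>) \<le> 0))
          \<and> (\<forall>\<^sub>F k in sequentially. \<kappa>p \<noteq> \<kappa> [^]\<^bsub>KP\<^esub> (p ^ (k * d)))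
          \<and> \<not> completion_limit_point K (prime_val K P) (\<lambda>k. \<kappa> [^]\<^bsub>KP\<^esub> (p ^ (k * d))) \<kappa>p"
proof -
  let ?F = "generate_field real_ring {kappa d}"
  have p: "prime p" using assms(3) by (simp add: Tame_def)
  obtain m where "number_ring_prime ?F {x \<in> ?F. algebraic_int x} P p m"
    by (rule number_ring_prime_rat_adjoin[OF assms(2) p assms(4)])
  then interpret N: number_ring_prime ?F "{x \<in> ?F. algebraic_int x}" P p m .
  define K where "K = rat_adjoin (kappa d)"
  have K: "K = N.Frac" by (simp add: K_def rat_adjoin_def)
  define w where "w = prime_val K P"
  interpret w: valued_field ?F w unfolding w_def K by (rule N.valued_field_prime_val)
  have RK: "w.R = K" by (simp add: K)
  obtain \<rho> where \<rho>_all: "\<rho> > 0 \<and> ereal N.e * padic_val p (of_nat (indep_count d p) - 1) = ereal \<rho> \<and>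
    (\<forall>k\<ge>1. w (of_nat (indep_count d (p ^ k)) - 1) = ereal \<rho>)"
    using N.tame_valuation[OF assms(1,3), folded K w_def] by (elim exE)
  then have \<rho>: "\<rho> > 0" "ereal N.e * padic_val p (of_nat (indep_count d p) - 1) = ereal \<rho>"
    "\<And>k. k \<ge> 1 \<Longrightarrow> w (of_nat (indep_count d (p ^ k)) - 1) = ereal \<rho>"
    by simp_all
  define a where "a k = real (indep_count d (p ^ k))" for k
  have a: "w.cauchy a" and map: "completion_map of_rat K w (kappa_padic d p) = w.cls a"
    using N.kappa_padic_image[OF assms(1), folded K w_def] by (simp_all add: a_def[abs_def] K[symmetric])
  have aF: "a k \<in> ?F" for k unfolding a_def by (rule w.F_of_nat)
  have \<kappa>: "kappa d \<in> ?F" by (rule generate_field.incl) simp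
  \<comment> \<open>Writing p as p / 1 identifies the ramification index v(p) of the statement with
    the exponent of p.\<close>
  have vp: "w (real p) = ereal N.e"
    using N.prime_val_quotient[of "real p" 1] N.A_nat N.A_1 N.P_1 N.exponent_unit[of 1] p
    by (simp add: w_def K prime_gt_0_nat)
  have vp0: "w (of_nat p) > 0" using vp N.e_pos by simp
  define z where "z k = kappa d ^ (p ^ (k * d)) - 1" for k
  have zF: "z k \<in> ?F" for k unfolding z_def by (intro w.F_diff w.F_power \<kappa> w.F_1)
  define D where "D k = w.cls a \<ominus>\<^bsub>completion K w\<^esub> (completion_embed K w (kappa d) [^]\<^bsub>completion K w\<^esub> (p ^ (k * d)))" for k
  have pow: "completion_embed K w (kappa d) [^]\<^bsub>completion K w\<^esub> n = w.cls (\<lambda>_. kappa d ^ n)" for n :: nat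
    using w.embed[of "kappa d"] w.embed_power[OF \<kappa>] by (simp add: RK)
  have cp: "w.cauchy (\<lambda>_. kappa d ^ n)" for n by (intro w.cauchy_const w.F_power \<kappa>)
  have D_eq: "D k = w.cls (\<lambda>n. a n - kappa d ^ (p ^ (k * d)))" for k
    using w.cls_diff[OF a cp] by (simp add: D_def pow RK)
  have D_cauchy: "w.cauchy (\<lambda>n. a n - kappa d ^ (p ^ (k * d)))" for k
    by (intro w.cauchy_diff a cp)
  \<comment> \<open>Both terms are compared with 1. The first difference has valuation \<rho> for n
    \<ge> 1, so the smaller valuation wins whenever that of \<open>z k\<close> is not \<rho>. Index
    0, which belongs to a_d(1), is skipped.\<close>
  have shift: "a n - kappa d ^ (p ^ (k * d)) = (a n - 1) - z k" for n k by (simp add: z_def)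
  have D1: "completion_val K w (D k) = ereal \<rho>" if "ereal \<rho> < w (z k)" for k
  proof -
    have "w (a n - kappa d ^ (p ^ (k * d))) = ereal \<rho>" if "n \<ge> 1" for n
      unfolding shift using w.v_add_eq[of "a n - 1" "- z k"] \<rho>(3)[OF that] \<open>ereal \<rho> < w (z k)\<close> aF zF
      by (simp add: a_def w.v_neg w.F_diff w.F_minus w.F_1)
    from w.val_cls_eventually[OF D_cauchy this] show ?thesis by (simp add: D_eq RK)
  qed
  have D2: "completion_val K w (D k) = w (z k)" if "w (z k) < ereal \<rho>" for k
  proof -
    have "w (a n - kappa d ^ (p ^ (k * d))) = w (z k)" if "n \<ge> 1" for n
      unfolding shift using w.v_add_eq[of "- z k" "a n - 1"] \<rho>(3)[OF that] \<open>w (z k) < ereal \<rho>\<close> aF zF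
      by (simp add: a_def w.v_neg w.F_diff w.F_minus w.F_1)
    from w.val_cls_eventually[OF D_cauchy this] show ?thesis by (simp add: D_eq RK)
  qed
  have val_z: "completion_val K w (completion_embed K w (kappa d) [^]\<^bsub>completion K w\<^esub> (p ^ (k * d)) \<ominus>\<^bsub>completion K w\<^esub> \<one>\<^bsub>completion K w\<^esub>) = w (z k)" for k
    using w.cls_diff[OF cp w.cauchy_const[OF w.F_1]] w.val_embed[OF zF]
    by (simp add: pow RK w.cls_one[unfolded RK] z_def)
  have val_1: "completion_val K w (completion_embed K w (kappa d) \<ominus>\<^bsub>completion K w\<^esub> \<one>\<^bsub>completion K w\<^esub>) = w (kappa d - 1)"
    using w.cls_diff[OF w.cauchy_const[OF \<kappa>] w.cauchy_const[OF w.F_1]] w.val_embed[OF w.F_diff[OF \<kappa> w.F_1]] w.embed[of "kappa d"]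
    by (simp add: RK w.cls_one[unfolded RK])
  have val_p: "completion_val K w (completion_embed K w (real p)) = ereal N.e"
    using w.val_embed[OF w.F_of_nat[of p]] w.embed[of "real p"] vp by (simp add: RK)
  have case1: "\<forall>\<^sub>F k in sequentially. completion_val K w (D k) = ereal \<rho>" if pos: "w (kappa d - 1) > 0"
  proof -
    \<comment> \<open>\<delta> is the smaller of the valuations of kappa_d - 1 and p. If kappa_d =
      1, the former is infinite and e is taken.\<close>
    obtain \<delta> where \<delta>: "\<delta> > 0" "ereal \<delta> \<le> w (kappa d - 1)" "ereal \<delta> \<le> w (of_nat p)"
    proof (cases "w (kappa d - 1)")
      case (real r)
      then show ?thesis using that[of "min r N.e"] pos vp N.e_pos by simp
    qed (use that[of N.e] pos vp N.e_pos in auto)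
    \<comment> \<open>Ensures (k d + 1) \<delta> > \<rho> for all k \<ge> n, because d \<ge> 1 gives
      k d \<ge> k.\<close>
    obtain n :: nat where n: "\<rho> / \<delta> < real n" using reals_Archimedean2 by blast
    have "ereal \<rho> < w (z k)" if k: "k \<ge> n" for k
    proof -
      have "n \<le> k * d" using k assms(1) by (metis le_trans mult_le_mono2 nat_mult_1_right)
      then have "real n \<le> real (Suc (k * d))" unfolding of_nat_le_iff by simp
      then have "\<rho> / \<delta> < real (Suc (k * d))" using n by (rule less_le_trans[rotated])
      then have "\<rho> < real (Suc (k * d)) * \<delta>" using \<delta>(1) by (simp only: pos_divide_less_eq)
      then have "ereal \<rho> < ereal (real (Suc (k * d)) * \<delta>)" by simp
      also have "\<dots> \<le> w (z k)"
        unfolding z_def using \<delta> by (intro w.v_power_prime_power_minus_1_ge \<kappa>) auto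
      finally show ?thesis .
    qed
    then show ?thesis using D1 by (auto simp: eventually_sequentially)
  qed
  have case2: "w (z k) \<le> 0 \<and> completion_val K w (D k) = w (z k)" if "w (kappa d - 1) \<le> 0" for k
  proof -
    have le: "w (z k) \<le> 0" unfolding z_def by (rule w.v_power_prime_power_minus_1_le[OF p \<kappa> that vp0])
    also have "0 < ereal \<rho>" using \<rho>(1) by simp
    finally show ?thesis using D2 le by blast
  qed
  \<comment> \<open>One finite bound for both cases settles the last two claims: equality would need
    valuation infinity, and a limit point would need unbounded valuations.\<close>
  have bound: "\<forall>\<^sub>F k in sequentially. completion_val K w (D k) \<le> ereal \<rho>"
  proof (cases "w (kappa d - 1) > 0")
    case True
    from case1[OF this] show ?thesis by eventually_elim simp
  next
    case False
    then have "completion_val K w (D k) \<le> ereal \<rho>" for k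
      using case2[of k] \<rho>(1) by (metis ereal_less_eq(5) less_imp_le not_le order_trans)
    then show ?thesis by simp
  qed
  have ne: "\<forall>\<^sub>F k in sequentially. w.cls a \<noteq> completion_embed K w (kappa d) [^]\<^bsub>completion K w\<^esub> (p ^ (k * d))"
    using bound
  proof eventually_elim
    case (elim k)
    have "completion_val K w (w.cls a \<ominus>\<^bsub>completion K w\<^esub> w.cls a) = \<infinity>"
      using w.cls_diff[OF a a] w.val_embed[OF w.F_0] w.v_0 by (simp add: RK)
    then show ?case using elim by (auto simp: D_def)
  qed
  have "\<not> completion_limit_point K w (\<lambda>k. completion_embed K w (kappa d) [^]\<^bsub>completion K w\<^esub> (p ^ (k * d))) (w.cls a)"
  proof
    assume "completion_limit_point K w (\<lambda>k. completion_embed K w (kappa d) [^]\<^bsub>completion K w\<^esub> (p ^ (k * d))) (w.cls a)"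
    then obtain s where s: "strict_mono s" and lim: "(\<lambda>k. completion_val K w
        (completion_embed K w (kappa d) [^]\<^bsub>completion K w\<^esub> (p ^ (s k * d)) \<ominus>\<^bsub>completion K w\<^esub> w.cls a)) \<longlonglongrightarrow> \<infinity>"
      by (auto simp: completion_limit_point_def completion_tendsto_def)
    \<comment> \<open>\<open>completion_limit_point\<close> subtracts in the opposite order, and the
      valuation ignores the sign.\<close>
    have sym: "completion_val K w (completion_embed K w (kappa d) [^]\<^bsub>completion K w\<^esub> (p ^ (k * d)) \<ominus>\<^bsub>completion K w\<^esub> w.cls a)
        = completion_val K w (D k)" for k
    proof -
      have "w (kappa d ^ (p ^ (k * d)) - a n) = w (a n - kappa d ^ (p ^ (k * d)))" for n
        by (intro w.v_minus_commute aF w.F_power \<kappa>)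
      then have "completion_val w.R w (w.cls (\<lambda>n. kappa d ^ (p ^ (k * d)) - a n)) = completion_val w.R w (D k)"
        using w.val_limit[OF D_cauchy[of k]] by (intro w.val_cls w.cauchy_diff a cp) (simp add: D_eq)
      then show ?thesis using w.cls_diff[OF cp a] by (simp add: pow RK)
    qed
    have "\<forall>\<^sub>F k in sequentially. ereal \<rho> < completion_val K w (D (s k))"
      using lim unfolding sym tendsto_PInfty by blast
    moreover have "\<forall>\<^sub>F k in sequentially. completion_val K w (D (s k)) \<le> ereal \<rho>"
      using eventually_subseq[OF s bound] .
    ultimately have "\<forall>\<^sub>F k in sequentially. False" by eventually_elim simp
    then show False by simp
  qed
  then show ?thesis
    unfolding Let_def K_def[symmetric] w_def[symmetric] map val_1 val_z val_p \<rho>(2)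
      D_def[symmetric]
    using case1 case2 ne by blast
qed

end
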